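(* Let $G=\mathrm{Sp}_4$ over $F$, and let $G^0\simeq U(1)\times\mathrm{SL}_2$, the point $x_0$, the character $\phi$, the pair $(K^0_{x_0},\rho^0_{x_0})$ with $\rho^0_{x_0}$ trivial, and the pair $(K_{x_0},\rho^{\mathrm{nt}}_{x_0})$ obtained from the non-twisted Kim–Yu construction be as described in the context. Then there is no support-preserving algebra isomorphism $$\mathcal H(G^0(F),\rho^0_{x_0})\ \xrightarrow{\ \sim\ }\ \mathcal H(G(F),\rho^{\mathrm{nt}}_{x_0}).$$
   Context: $F$ is a non-archimedean local field with residue characteristic $p\ne2$, uniformizer $\pi_F$; $\mathcal C$ is an algebraically closed field of characteristic $0$ (coefficients); $\Psi:F\to\mathcal C^\times$ is an additive character trivial on $\mathfrak p_F$ and nontrivial on $\mathcal O_F$. **Groups.** $G=\mathrm{Sp}_4$ is defined by the symplectic form with matrix $\begin{pmatrix}0&0&0&1\\0&0&-1&0\\0&1&0&0\\-1&0&0&0\end{pmatrix}$, $T=\{\mathrm{diag}(t_1,t_2,t_2^{-1},t_1^{-1})\}$, $\alpha_1^\vee(t)=\mathrm{diag}(t,1,1,t^{-1})$, $\alpha_2^\vee(t)=\mathrm{diag}(1,t,t^{-1},1)$. Let $o\in\mathcal A(G,T,F)$ be the point with $G(F)_{o,0}=\mathrm{Sp}_4(\mathcal O_F)$, and $x_0=o-\frac14\alpha_1^\vee+\frac1{16}\alpha_2^\vee$. Let $X\in\mathrm{Lie}^*(G)(F)$, $X((A_{ij}))=\pi_F^{-1}A_{14}+A_{41}$. $G^0$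 is the centralizer of $X$ in $G$: $$G^0=\left\{\begin{pmatrix}a&0&b\\0&h&0\\ b\pi_F^{-1}&0&a\end{pmatrix}: h\in\mathrm{SL}_2,\ a^2-b^2\pi_F^{-1}=1\right\}\simeq U(1)\times\mathrm{SL}_2,$$ a tamely ramified twisted Levi subgroup (with $h$ the middle $2\times2$ block). $M^0\subset G^0$ is the Levi subgroup (a maximal torus) where $h=\mathrm{diag}(t,t^{-1})$; the point $x_0$ lies in (the image under admissible embeddings of) $\mathcal B(M^0,F)\subset\mathcal B(G^0,F)\subset\mathcal B(G,F)$. Subscripts $x_0,r$ and $x_0,r+$ denote Moy–Prasad filtrations. **Characters and pairs.** $\phi$ is a character of $G^0(F)$ that is trivial on the $\mathrm{SL}_2(F)$-factor and whose restriction to $G^0(F)_{x_0,1/2}$ is trivial on $G^0(F)_{x_0,1/2+}$ and given on $G^0(F)_{x_0,1/2}/G^0(F)_{x_0,1/2+}\simeq\mathrm{Lie}(G^0)(F)_{x_0,1/2}/\mathrm{Lie}(G^0)(F)_{x_0,1/2+}$ by $Y\mapsto\Psi(X(Y))$. $K^0_{x_0}=G^0(F)_{x_0,0}$ and $\rho^0_{x_0}$ is its trivial representation. (Concretely, $K^0_{x_0}$ consists of the elements of $G^0(F)$ with $h\in\begin{pmatrix}\mathcal O_F^\times&\mathcal O_F\\ \mathfrak p_F&\mathcal O_F^\times\end{pmatrix}$ whose $U(1)$-component lies in the parahoric subgroup of $U(1)$.) $(K_{x_0},\rho^{\mathrm{nt}}_{x_0})$ is the pair attached by the (non-twisted) Kim–Yu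 construction to the datum $\bigl((G^0\subset G,M^0),(\frac12,\frac12),x_0,(M^0(F)_{x_0,0},\text{trivial}),(\phi,1)\bigr)$. Explicitly, with $r=\frac12$: choose a maximal torus $T'$ of $G^0$ with tame splitting field $E$ and $x_0\in\mathcal A(G^0,T',E)$; $J$ (resp. $J_+$) is the intersection with $G(F)$ of the group generated by $T'(E)_r$, $U_\alpha(E)_{x_0,r}$ ($\alpha\in\Phi(G^0,T')$), and $U_\alpha(E)_{x_0,r/2}$ (resp. $U_\alpha(E)_{x_0,r/2+}$) for $\alpha\in\Phi(G,T')\smallsetminus\Phi(G^0,T')$; $K_{x_0}=K^0_{x_0}J=K^0_{x_0}G(F)_{x_0,1/4}$. $\widehat\phi$ is the character of $K^0_{x_0}J_+$ equal to $\phi$ on $K^0_{x_0}$ and trivial on the group defined like $J_+$ with $r$ replaced by $r+$. $V=J/J_+$ is a symplectic $\mathbb F_p$-space with form $\langle j_1,j_2\rangle=\iota_p(\widehat\phi(j_1j_2j_1^{-1}j_2^{-1}))$, $\iota_p:\mu_p(\mathcal C)\simeq\mathbb F_p$ fixed. $V^\#=V\times\mathbb F_p$ with $(v,a)(w,b)=(v+w,a+b+\frac12\langle v,w\rangle)$. $\omega$ is the Heisenberg–Weil representation of $\mathrm{Sp}(V)\ltimes V^\#$: irreducible on $V^\#$ with $(0,a)$ acting by $\iota_p^{-1}(a)$, and for a Lagrangian $W\subset V$ with stabilizer $P_W$, its restriction to $P_W\ltimes V^\#$ is induced from the character $(g,(w,a))\mapsto\mathrm{sgn}_{\mathbb F_p}(\det(g|_W))\,\iota_p^{-1}(a)$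 of $P_W\ltimes(W\times\mathbb F_p)$. There is a $K^0_{x_0}$-equivariant surjection $j:J\to V^\#$ lifting $J\to V$ and equal to $u\mapsto(0,\iota_p(\widehat\phi(u)))$ on $J_+$. $\rho^{\mathrm{nt}}_{x_0}$ is the representation of $K_{x_0}$ with $k\in K^0_{x_0}$ acting by $\phi(k)\,\omega(\mathrm{Ad}(k)|_V)$ and $u\in J$ acting by $\omega(j(u))$. **Hecke algebras.** $\mathcal H(H,\rho)$, for a representation $(\rho,V_\rho)$ of a compact open $K\subseteq H$, is the algebra of compactly supported $f:H\to\mathrm{End}(V_\rho)$ with $f(k_1hk_2)=\rho(k_1)f(h)\rho(k_2)$ and $(f_1*f_2)(g)=\sum_{h\in H/K}f_1(h)f_2(h^{-1}g)$. An algebra isomorphism $\mathcal I:\mathcal H(G^0(F),\rho^0_{x_0})\to\mathcal H(G(F),\rho^{\mathrm{nt}}_{x_0})$ is support-preserving if $\mathrm{supp}(\mathcal I(f))=K_{x_0}\,\mathrm{supp}(f)\,K_{x_0}$ for all $f\in\mathcal H(G^0(F),\rho^0_{x_0})$. *)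

theory Defs
  imports "HOL-Analysis.Analysis"
    "HOL-Algebra.Bij" "HOL-Algebra.Coset" "HOL-Algebra.FiniteProduct" "HOL-Algebra.Generated_Groups"
begin

section \<open>Local fields\<close>

text \<open>Valuations are real-valued functions on the nonzero elements; their value at \<open>0\<close> is never
  used. A depth is \<open>r\<close> or \<open>r+\<close>, as in the indices of Moy--Prasad filtrations.\<close>

datatype depth = At real | After real

primrec reaches :: "depth \<Rightarrow> real \<Rightarrow> bool" where
  "reaches (At r) t \<longleftrightarrow> r \<le> t"
| "reaches (After r) t \<longleftrightarrow> r < t"

definition val_ideal :: "('a::field \<Rightarrow> real) \<Rightarrow> depth \<Rightarrow> 'a set" where
  "val_ideal v d = {x. x = 0 \<or> reaches d (v x)}"

abbreviation int_ring :: "('a::field \<Rightarrow> real) \<Rightarrow> 'a set" where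
  "int_ring v \<equiv> val_ideal v (At 0)"

abbreviation max_ideal :: "('a::field \<Rightarrow> real) \<Rightarrow> 'a set" where
  "max_ideal v \<equiv> val_ideal v (After 0)"

definition valuation :: "('a::field \<Rightarrow> real) \<Rightarrow> bool" where
  "valuation v \<longleftrightarrow>
     (\<forall>x y. x \<noteq> 0 \<longrightarrow> y \<noteq> 0 \<longrightarrow> v (x * y) = v x + v y) \<and>
     (\<forall>x y. x \<noteq> 0 \<longrightarrow> y \<noteq> 0 \<longrightarrow> x + y \<noteq> 0 \<longrightarrow> min (v x) (v y) \<le> v (x + y))"

definition val_complete :: "('a::field \<Rightarrow> real) \<Rightarrow> bool" where
  "val_complete v \<longleftrightarrow>
     (\<forall>a :: nat \<Rightarrow> 'a. (\<forall>r. \<exists>N. \<forall>m\<ge>N. \<forall>n\<ge>N. a m - a n \<in> val_ideal v (At r)) \<longrightarrow>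
        (\<exists>L. \<forall>r. \<exists>N. \<forall>n\<ge>N. a n - L \<in> val_ideal v (At r)))"

definition nonarch_local_field :: "('a::field \<Rightarrow> real) \<Rightarrow> bool" where
  "nonarch_local_field v \<longleftrightarrow>
     valuation v \<and> v ` (- {0}) = \<int> \<and> val_complete v \<and>
     finite (int_ring v // {(x, y). x \<in> int_ring v \<and> y \<in> int_ring v \<and> x - y \<in> max_ideal v})"

definition residue_char :: "('a::field \<Rightarrow> real) \<Rightarrow> nat \<Rightarrow> bool" where
  "residue_char v p \<longleftrightarrow> prime p \<and> of_nat p \<in> max_ideal v"

definition uniformizer :: "('a::field \<Rightarrow> real) \<Rightarrow> 'a \<Rightarrow> bool" where
  "uniformizer v \<pi> \<longleftrightarrow> \<pi> \<noteq> 0 \<and> v \<pi> = 1"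

definition level_zero_additive_char ::
    "('a::field \<Rightarrow> real) \<Rightarrow> ('a \<Rightarrow> 'c::field) \<Rightarrow> bool" where
  "level_zero_additive_char v \<Psi> \<longleftrightarrow>
     (\<forall>x. \<Psi> x \<noteq> 0) \<and> (\<forall>x y. \<Psi> (x + y) = \<Psi> x * \<Psi> y) \<and>
     (\<forall>x\<in>max_ideal v. \<Psi> x = 1) \<and> (\<exists>x\<in>int_ring v. \<Psi> x \<noteq> 1)"

text \<open>\<open>E = F(s)\<close> with \<open>s\<^sup>2 = \<pi>\<close>, embedded by \<open>\<epsilon>\<close> and with the valuation extending the
  one of \<open>F\<close>. It is a tame splitting field of the torus \<open>T'\<close> below.\<close>

definition sqrt_extension ::
    "('f::field \<Rightarrow> real) \<Rightarrow> 'f \<Rightarrow> ('f \<Rightarrow> 'e::field) \<Rightarrow> 'e \<Rightarrow> ('e \<Rightarrow> real) \<Rightarrow> bool" where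
  "sqrt_extension v \<pi> \<epsilon> s w \<longleftrightarrow>
     \<epsilon> 1 = 1 \<and> (\<forall>x y. \<epsilon> (x + y) = \<epsilon> x + \<epsilon> y) \<and> (\<forall>x y. \<epsilon> (x * y) = \<epsilon> x * \<epsilon> y) \<and>
     s ^ 2 = \<epsilon> \<pi> \<and> (\<forall>z. \<exists>a b. z = \<epsilon> a + \<epsilon> b * s) \<and>
     valuation w \<and> (\<forall>x. x \<noteq> 0 \<longrightarrow> w (\<epsilon> x) = v x)"


section \<open>The symplectic group and its filtration at \<open>x\<^sub>0\<close>\<close>

type_synonym 'a mat4 = "'a^4^4"

definition sp_form :: "'a::field mat4" where
  "sp_form = vector [vector [0, 0, 0, 1],
                     vector [0, 0, -1, 0],
                     vector [0, 1, 0, 0],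
                     vector [-1, 0, 0, 0]]"

definition Sp4 :: "'a::field mat4 monoid" where
  "Sp4 = \<lparr>carrier = {g. transpose g ** sp_form ** g = sp_form}, mult = (**), one = mat 1\<rparr>"

definition lie_sp4 :: "'a::field mat4 set" where
  "lie_sp4 = {A. transpose A ** sp_form + sp_form ** A = 0}"

definition conj_by :: "'a::field mat4 \<Rightarrow> 'a mat4 \<Rightarrow> 'a mat4" where
  "conj_by k g = k ** g ** inv\<^bsub>Sp4\<^esub> k"

definition torus_elt :: "'a::field \<Rightarrow> 'a \<Rightarrow> 'a mat4" where
  "torus_elt t1 t2 = vector [vector [t1, 0, 0, 0],
                             vector [0, t2, 0, 0],
                             vector [0, 0, inverse t2, 0],
                             vector [0, 0, 0, inverse t1]]"

text \<open>Weights of the standard representation: \<open>(m, n)\<close> is the character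
  \<open>torus_elt t1 t2 \<mapsto> t1\<^sup>m t2\<^sup>n\<close>. The roots are the differences of distinct weights, and
  \<open>root_at_x0\<close> is the pairing of a character with \<open>x\<^sub>0 - o = - \<alpha>\<^sub>1\<^sup>\<or>/4 + \<alpha>\<^sub>2\<^sup>\<or>/16\<close>.\<close>

definition wt :: "4 \<Rightarrow> int \<times> int" where
  "wt i = (if i = 1 then (1, 0) else if i = 2 then (0, 1) else if i = 3 then (0, -1) else (-1, 0))"

definition roots :: "(int \<times> int) set" where
  "roots = {wt i - wt j | i j. i \<noteq> j}"

definition roots0 :: "(int \<times> int) set" where
  "roots0 = {(0, 2), (0, -2)}"

definition root_at_x0 :: "int \<times> int \<Rightarrow> real" where
  "root_at_x0 \<alpha> = - real_of_int (fst \<alpha>) / 4 + real_of_int (snd \<alpha>) / 16"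

definition gl4_fil :: "('a::field \<Rightarrow> real) \<Rightarrow> depth \<Rightarrow> 'a mat4 set" where
  "gl4_fil v d = {A. \<forall>i j. A$i$j = 0 \<or> reaches d (v (A$i$j) + root_at_x0 (wt i - wt j))}"

text \<open>\<open>T\<^sub>d\<close> (for positive depths) and \<open>U\<^sub>\<alpha>,\<^sub>x\<^sub>0,\<^sub>d\<close>, for the diagonal torus \<open>T\<close>.
  An element of the root group \<open>U\<^sub>\<alpha>\<close> is \<open>1 + A\<close> with \<open>A\<close> in the root space of \<open>\<alpha>\<close>,
  since \<open>A\<^sup>2 = 0\<close> there.\<close>

definition torus_fil :: "('a::field \<Rightarrow> real) \<Rightarrow> depth \<Rightarrow> 'a mat4 set" where
  "torus_fil v d = {torus_elt t1 t2 | t1 t2. t1 \<noteq> 0 \<and> t2 \<noteq> 0 \<and>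
     t1 - 1 \<in> val_ideal v d \<and> t2 - 1 \<in> val_ideal v d}"

definition root_fil :: "('a::field \<Rightarrow> real) \<Rightarrow> int \<times> int \<Rightarrow> depth \<Rightarrow> 'a mat4 set" where
  "root_fil v \<alpha> d = {mat 1 + A | A. A \<in> lie_sp4 \<and> A \<in> gl4_fil v d \<and>
     (\<forall>i j. A$i$j \<noteq> 0 \<longrightarrow> wt i - wt j = \<alpha>)}"

text \<open>The matrix below lies in the parahoric subgroup \<open>G(E)\<^sub>x\<^sub>0,\<^sub>0\<close>, hence fixes \<open>x\<^sub>0\<close>, and
  \<open>T' = cayley T cayley\<^sup>-\<^sup>1\<close> is the maximal torus \<open>M\<^sup>0\<close> of \<open>G\<^sup>0\<close>. So \<open>x\<^sub>0\<close> is in the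
  apartment of \<open>T'\<close> over \<open>E\<close>, and conjugation by \<open>cayley\<close> carries \<open>T\<^sub>d\<close> and
  \<open>U\<^sub>\<alpha>,\<^sub>x\<^sub>0,\<^sub>d\<close> for \<open>T\<close> to those for \<open>T'\<close>, and \<open>roots0\<close> to the roots of \<open>G\<^sup>0\<close>.\<close>

definition cayley :: "'e::field \<Rightarrow> 'e mat4" where
  "cayley s = vector [vector [1 / 2, 0, 0, s],
                      vector [0, 1, 0, 0],
                      vector [0, 0, 1, 0],
                      vector [- 1 / (2 * s), 0, 0, 1]]"

definition twisted_points ::
    "('f::field \<Rightarrow> 'e::field) \<Rightarrow> 'e \<Rightarrow> 'e mat4 set \<Rightarrow> 'f mat4 set" where
  "twisted_points \<epsilon> s S =
     {g \<in> carrier Sp4. map_matrix \<epsilon> g \<in> generate Sp4 (conj_by (cayley s) ` S)}"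

definition G0_fil ::
    "('f::field \<Rightarrow> 'e::field) \<Rightarrow> 'e \<Rightarrow> ('e \<Rightarrow> real) \<Rightarrow> depth \<Rightarrow> 'f mat4 set" where
  "G0_fil \<epsilon> s w d = twisted_points \<epsilon> s (torus_fil w d \<union> (\<Union>\<alpha>\<in>roots0. root_fil w \<alpha> d))"

definition yu_group ::
    "('f::field \<Rightarrow> 'e::field) \<Rightarrow> 'e \<Rightarrow> ('e \<Rightarrow> real) \<Rightarrow> depth \<Rightarrow> depth \<Rightarrow> 'f mat4 set" where
  "yu_group \<epsilon> s w d d' = twisted_points \<epsilon> s
     (torus_fil w d \<union> (\<Union>\<alpha>\<in>roots0. root_fil w \<alpha> d) \<union> (\<Union>\<alpha>\<in>roots - roots0. root_fil w \<alpha> d'))"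

definition J_gp :: "('f::field \<Rightarrow> 'e::field) \<Rightarrow> 'e \<Rightarrow> ('e \<Rightarrow> real) \<Rightarrow> 'f mat4 set" where
  "J_gp \<epsilon> s w = yu_group \<epsilon> s w (At (1/2)) (At (1/4))"

definition J_plus :: "('f::field \<Rightarrow> 'e::field) \<Rightarrow> 'e \<Rightarrow> ('e \<Rightarrow> real) \<Rightarrow> 'f mat4 set" where
  "J_plus \<epsilon> s w = yu_group \<epsilon> s w (At (1/2)) (After (1/4))"

definition J_plus_plus :: "('f::field \<Rightarrow> 'e::field) \<Rightarrow> 'e \<Rightarrow> ('e \<Rightarrow> real) \<Rightarrow> 'f mat4 set" where
  "J_plus_plus \<epsilon> s w = yu_group \<epsilon> s w (After (1/2)) (After (1/4))"


section \<open>The twisted Levi subgroup and the character\<close>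

definition X_fun :: "'f::field \<Rightarrow> 'f mat4 \<Rightarrow> 'f" where
  "X_fun \<pi> A = inverse \<pi> * A$1$4 + A$4$1"

definition G0 :: "'f::field \<Rightarrow> 'f mat4 set" where
  "G0 \<pi> = {g \<in> carrier Sp4. \<forall>A\<in>lie_sp4. X_fun \<pi> (conj_by (inv\<^bsub>Sp4\<^esub> g) A) = X_fun \<pi> A}"

definition lie_G0 :: "'f::field \<Rightarrow> 'f mat4 set" where
  "lie_G0 \<pi> = {Y \<in> lie_sp4. \<forall>A\<in>lie_sp4. X_fun \<pi> (Y ** A - A ** Y) = 0}"

definition G0_elt :: "'f::field \<Rightarrow> 'f \<Rightarrow> 'f \<Rightarrow> 'f^2^2 \<Rightarrow> 'f mat4" where
  "G0_elt \<pi> a b h = vector [vector [a, 0, 0, b],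
                            vector [0, h$1$1, h$1$2, 0],
                            vector [0, h$2$1, h$2$2, 0],
                            vector [b * inverse \<pi>, 0, 0, a]]"

text \<open>\<open>U(1)\<close> is a ramified norm-one torus: its parahoric subgroup has index \<open>2\<close> and consists
  of the elements congruent to \<open>1\<close> (not \<open>-1\<close>) modulo the maximal ideal of \<open>E\<close>.\<close>

definition K0 :: "('f::field \<Rightarrow> real) \<Rightarrow> 'f \<Rightarrow> 'f mat4 set" where
  "K0 v \<pi> = {G0_elt \<pi> a b h | a b h.
     a ^ 2 - b ^ 2 * inverse \<pi> = 1 \<and> a - 1 \<in> max_ideal v \<and> det h = 1 \<and>
     h$1$1 \<in> int_ring v - max_ideal v \<and> h$1$2 \<in> int_ring v \<and>
     h$2$1 \<in> max_ideal v \<and> h$2$2 \<in> int_ring v - max_ideal v}"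

text \<open>In the last clause, the Moy--Prasad isomorphism from \<open>G\<^sup>0\<^sub>x\<^sub>0,\<^sub>1\<^sub>/\<^sub>2 / G\<^sup>0\<^sub>x\<^sub>0,\<^sub>1\<^sub>/\<^sub>2\<^sub>+\<close> to the
  Lie algebra quotient is the one induced from \<open>GL\<^sub>4\<close>, where it is \<open>1 + Y \<mapsto> Y\<close>.\<close>

definition is_phi ::
    "('f::field \<Rightarrow> real) \<Rightarrow> 'f \<Rightarrow> ('f \<Rightarrow> 'e::field) \<Rightarrow> 'e \<Rightarrow> ('e \<Rightarrow> real) \<Rightarrow>
     ('f \<Rightarrow> 'c::field) \<Rightarrow> ('f mat4 \<Rightarrow> 'c) \<Rightarrow> bool" where
  "is_phi v \<pi> \<epsilon> s w \<Psi> \<phi> \<longleftrightarrow>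
     (\<forall>g\<in>G0 \<pi>. \<phi> g \<noteq> 0) \<and> (\<forall>g\<in>G0 \<pi>. \<forall>g'\<in>G0 \<pi>. \<phi> (g ** g') = \<phi> g * \<phi> g') \<and>
     (\<forall>h. det h = 1 \<longrightarrow> \<phi> (G0_elt \<pi> 1 0 h) = 1) \<and>
     (\<forall>g\<in>G0_fil \<epsilon> s w (After (1/2)). \<phi> g = 1) \<and>
     (\<forall>g\<in>G0_fil \<epsilon> s w (At (1/2)). \<forall>Y\<in>lie_G0 \<pi> \<inter> gl4_fil v (At (1/2)).
        g - mat 1 - Y \<in> gl4_fil v (After (1/2)) \<longrightarrow> \<phi> g = \<Psi> (X_fun \<pi> Y))"


section \<open>Representations\<close>

definition is_rep ::
    "'g monoid \<Rightarrow> ('c::field \<Rightarrow> 'w::ab_group_add \<Rightarrow> 'w) \<Rightarrow> ('g \<Rightarrow> 'w \<Rightarrow> 'w) \<Rightarrow> bool" where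
  "is_rep G sc \<rho> \<longleftrightarrow>
     vector_space sc \<and> (\<forall>g\<in>carrier G. Vector_Spaces.linear sc sc (\<rho> g)) \<and>
     \<rho> \<one>\<^bsub>G\<^esub> = id \<and> (\<forall>g\<in>carrier G. \<forall>h\<in>carrier G. \<rho> (g \<otimes>\<^bsub>G\<^esub> h) = \<rho> g \<circ> \<rho> h)"

definition irreducible_rep ::
    "'g monoid \<Rightarrow> ('c::field \<Rightarrow> 'w::ab_group_add \<Rightarrow> 'w) \<Rightarrow> ('g \<Rightarrow> 'w \<Rightarrow> 'w) \<Rightarrow> bool" where
  "irreducible_rep G sc \<rho> \<longleftrightarrow>
     is_rep G sc \<rho> \<and> (UNIV :: 'w set) \<noteq> {0} \<and>
     (\<forall>U. module.subspace sc U \<longrightarrow> (\<forall>g\<in>carrier G. \<rho> g ` U \<subseteq> U) \<longrightarrow> U = {0} \<or> U = UNIV)"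

text \<open>\<open>\<rho>\<close> is induced from the character \<open>\<theta>\<close> of the finite-index subgroup \<open>B\<close>: there is a line on
  which \<open>B\<close> acts by \<open>\<theta>\<close> and whose translates by \<open>G/B\<close> decompose the space.\<close>

definition induced_rep ::
    "'g monoid \<Rightarrow> 'g set \<Rightarrow> ('g \<Rightarrow> 'c) \<Rightarrow>
     ('c::field \<Rightarrow> 'w::ab_group_add \<Rightarrow> 'w) \<Rightarrow> ('g \<Rightarrow> 'w \<Rightarrow> 'w) \<Rightarrow> bool" where
  "induced_rep G B \<theta> sc \<rho> \<longleftrightarrow>
     is_rep G sc \<rho> \<and>
     (\<exists>u R. (\<forall>b\<in>B. \<rho> b u = sc (\<theta> b) u) \<and>
        R \<subseteq> carrier G \<and> bij_betw (\<lambda>r. r <#\<^bsub>G\<^esub> B) R {g <#\<^bsub>G\<^esub> B | g. g \<in> carrier G} \<and>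
        inj_on (\<lambda>r. \<rho> r u) R \<and> \<not> module.dependent sc ((\<lambda>r. \<rho> r u) ` R) \<and>
        module.span sc ((\<lambda>r. \<rho> r u) ` R) = UNIV)"


section \<open>Symplectic spaces over the prime field and the Heisenberg--Weil representation\<close>

text \<open>The type \<open>'k\<close> is the prime field, and \<open>V\<close> an abelian group (written multiplicatively) killed
  by its characteristic, so that subspaces are subgroups and linear maps are homomorphisms.\<close>

definition fp_scale :: "'v monoid \<Rightarrow> 'k::{finite,field} \<Rightarrow> 'v \<Rightarrow> 'v" where
  "fp_scale V a x = x [^]\<^bsub>V\<^esub> (LEAST n::nat. of_nat n = a)"

definition fp_comb :: "'v monoid \<Rightarrow> nat \<Rightarrow> (nat \<Rightarrow> 'v) \<Rightarrow> (nat \<Rightarrow> 'k::{finite,field}) \<Rightarrow> 'v" where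
  "fp_comb V n b c = finprod V (\<lambda>i. fp_scale V (c i) (b i)) {..<n}"

definition fp_basis :: "'k::{finite,field} itself \<Rightarrow> 'v monoid \<Rightarrow> 'v set \<Rightarrow> nat \<Rightarrow> (nat \<Rightarrow> 'v) \<Rightarrow> bool" where
  "fp_basis k V W n b \<longleftrightarrow>
     (\<forall>i<n. b i \<in> W) \<and> bij_betw (fp_comb V n b) ({..<n} \<rightarrow>\<^sub>E (UNIV :: 'k set)) W"

definition det_nat :: "nat \<Rightarrow> (nat \<Rightarrow> nat \<Rightarrow> 'k::field) \<Rightarrow> 'k" where
  "det_nat n A = (\<Sum>\<sigma> | \<sigma> permutes {..<n}. of_int (sign \<sigma>) * (\<Prod>i<n. A i (\<sigma> i)))"

definition det_on :: "'v monoid \<Rightarrow> 'v set \<Rightarrow> ('v \<Rightarrow> 'v) \<Rightarrow> 'k::{finite,field}" where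
  "det_on V W g = (THE d. \<exists>n b A. fp_basis TYPE('k) V W n b \<and>
     (\<forall>j<n. g (b j) = fp_comb V n b (\<lambda>i. A i j)) \<and> d = det_nat n A)"

definition quadratic_char :: "'k::field \<Rightarrow> 'c::field" where
  "quadratic_char a = (if a = 0 then 0 else if \<exists>b. b ^ 2 = a then 1 else -1)"

definition root_of_unity_iso :: "nat \<Rightarrow> ('c::field \<Rightarrow> 'k::field) \<Rightarrow> bool" where
  "root_of_unity_iso p \<iota> \<longleftrightarrow> bij_betw \<iota> {z. z ^ p = 1} UNIV \<and>
     (\<forall>z z'. z ^ p = 1 \<longrightarrow> z' ^ p = 1 \<longrightarrow> \<iota> (z * z') = \<iota> z + \<iota> z')"

definition iota_inv :: "nat \<Rightarrow> ('c::field \<Rightarrow> 'k::field) \<Rightarrow> 'k \<Rightarrow> 'c" where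
  "iota_inv p \<iota> = inv_into {z. z ^ p = 1} \<iota>"

definition heis_gp :: "'v monoid \<Rightarrow> ('v \<Rightarrow> 'v \<Rightarrow> 'k::field) \<Rightarrow> ('v \<times> 'k) monoid" where
  "heis_gp V form = \<lparr>carrier = carrier V \<times> UNIV,
     mult = (\<lambda>(x, a) (y, b). (x \<otimes>\<^bsub>V\<^esub> y, a + b + form x y / 2)), one = (\<one>\<^bsub>V\<^esub>, 0)\<rparr>"

definition symp_gp :: "'v monoid \<Rightarrow> ('v \<Rightarrow> 'v \<Rightarrow> 'k) \<Rightarrow> ('v \<Rightarrow> 'v) monoid" where
  "symp_gp V form = (BijGroup (carrier V))\<lparr>carrier :=
     {g \<in> auto V. \<forall>x\<in>carrier V. \<forall>y\<in>carrier V. form (g x) (g y) = form x y}\<rparr>"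

text \<open>The semidirect product of \<open>symp_gp\<close> acting on \<open>heis_gp\<close>; the pair \<open>(g, h)\<close> stands for \<open>h g\<close>.\<close>

definition jacobi_gp :: "'v monoid \<Rightarrow> ('v \<Rightarrow> 'v \<Rightarrow> 'k::field) \<Rightarrow> (('v \<Rightarrow> 'v) \<times> ('v \<times> 'k)) monoid" where
  "jacobi_gp V form = \<lparr>carrier = carrier (symp_gp V form) \<times> carrier (heis_gp V form),
     mult = (\<lambda>(g, h) (g', (x, a)).
       (g \<otimes>\<^bsub>symp_gp V form\<^esub> g', h \<otimes>\<^bsub>heis_gp V form\<^esub> (g x, a))),
     one = (\<one>\<^bsub>symp_gp V form\<^esub>, \<one>\<^bsub>heis_gp V form\<^esub>)\<rparr>"

definition lagrangian :: "'v monoid \<Rightarrow> ('v \<Rightarrow> 'v \<Rightarrow> 'k::field) \<Rightarrow> 'v set \<Rightarrow> bool" where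
  "lagrangian V form W \<longleftrightarrow> subgroup W V \<and> W = {x \<in> carrier V. \<forall>y\<in>W. form x y = 0}"

definition heisenberg_weil ::
    "nat \<Rightarrow> ('c::field \<Rightarrow> 'k::{finite,field}) \<Rightarrow> 'v monoid \<Rightarrow> ('v \<Rightarrow> 'v \<Rightarrow> 'k) \<Rightarrow>
     ('c \<Rightarrow> 'w::ab_group_add \<Rightarrow> 'w) \<Rightarrow> (('v \<Rightarrow> 'v) \<times> ('v \<times> 'k) \<Rightarrow> 'w \<Rightarrow> 'w) \<Rightarrow> bool" where
  "heisenberg_weil p \<iota> V form sc \<omega> \<longleftrightarrow>
     is_rep (jacobi_gp V form) sc \<omega> \<and>
     irreducible_rep (heis_gp V form) sc (\<lambda>h. \<omega> (\<one>\<^bsub>symp_gp V form\<^esub>, h)) \<and>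
     (\<forall>a. \<omega> (\<one>\<^bsub>symp_gp V form\<^esub>, (\<one>\<^bsub>V\<^esub>, a)) = sc (iota_inv p \<iota> a)) \<and>
     (\<forall>W. lagrangian V form W \<longrightarrow>
        (let P = {g \<in> carrier (symp_gp V form). g ` W = W} in
         induced_rep ((jacobi_gp V form)\<lparr>carrier := P \<times> carrier (heis_gp V form)\<rparr>)
           (P \<times> (W \<times> UNIV))
           (\<lambda>(g, (x, a)). quadratic_char (det_on V W g :: 'k) * iota_inv p \<iota> a)
           sc \<omega>))"


section \<open>The non-twisted Kim--Yu construction\<close>

definition K_gp ::
    "('f::field \<Rightarrow> real) \<Rightarrow> 'f \<Rightarrow> ('f \<Rightarrow> 'e::field) \<Rightarrow> 'e \<Rightarrow> ('e \<Rightarrow> real) \<Rightarrow> 'f mat4 set" where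
  "K_gp v \<pi> \<epsilon> s w = K0 v \<pi> <#>\<^bsub>Sp4\<^esub> J_gp \<epsilon> s w"

definition is_phi_hat ::
    "('f::field \<Rightarrow> real) \<Rightarrow> 'f \<Rightarrow> ('f \<Rightarrow> 'e::field) \<Rightarrow> 'e \<Rightarrow> ('e \<Rightarrow> real) \<Rightarrow>
     ('f mat4 \<Rightarrow> 'c::field) \<Rightarrow> ('f mat4 \<Rightarrow> 'c) \<Rightarrow> bool" where
  "is_phi_hat v \<pi> \<epsilon> s w \<phi> \<phi>h \<longleftrightarrow>
     (let D = K0 v \<pi> <#>\<^bsub>Sp4\<^esub> J_plus \<epsilon> s w in
       (\<forall>g\<in>D. \<phi>h g \<noteq> 0) \<and> (\<forall>g\<in>D. \<forall>g'\<in>D. \<phi>h (g ** g') = \<phi>h g * \<phi>h g') \<and>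
       (\<forall>g\<in>K0 v \<pi>. \<phi>h g = \<phi> g) \<and> (\<forall>g\<in>J_plus_plus \<epsilon> s w. \<phi>h g = 1))"

definition V_space ::
    "('f::field \<Rightarrow> 'e::field) \<Rightarrow> 'e \<Rightarrow> ('e \<Rightarrow> real) \<Rightarrow> 'f mat4 set monoid" where
  "V_space \<epsilon> s w = (Sp4\<lparr>carrier := J_gp \<epsilon> s w\<rparr>) Mod J_plus \<epsilon> s w"

definition V_form ::
    "('c \<Rightarrow> 'k) \<Rightarrow> ('f::field mat4 \<Rightarrow> 'c) \<Rightarrow> 'f mat4 set \<Rightarrow> 'f mat4 set \<Rightarrow> 'k" where
  "V_form \<iota> \<phi>h C D =
     (let j1 = (SOME g. g \<in> C); j2 = (SOME g. g \<in> D)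
      in \<iota> (\<phi>h (j1 ** j2 ** inv\<^bsub>Sp4\<^esub> j1 ** inv\<^bsub>Sp4\<^esub> j2)))"

definition Ad_V :: "'f::field mat4 set monoid \<Rightarrow> 'f mat4 \<Rightarrow> 'f mat4 set \<Rightarrow> 'f mat4 set" where
  "Ad_V V k = (\<lambda>C\<in>carrier V. conj_by k ` C)"

definition special_hom ::
    "('f::field \<Rightarrow> real) \<Rightarrow> 'f \<Rightarrow> ('f \<Rightarrow> 'e::field) \<Rightarrow> 'e \<Rightarrow> ('e \<Rightarrow> real) \<Rightarrow>
     ('c \<Rightarrow> 'k::field) \<Rightarrow> ('f mat4 \<Rightarrow> 'c) \<Rightarrow> ('f mat4 \<Rightarrow> 'f mat4 set \<times> 'k) \<Rightarrow> bool" where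
  "special_hom v \<pi> \<epsilon> s w \<iota> \<phi>h j \<longleftrightarrow>
     (let J = J_gp \<epsilon> s w; V = V_space \<epsilon> s w; H = heis_gp V (V_form \<iota> \<phi>h) in
       j \<in> hom (Sp4\<lparr>carrier := J\<rparr>) H \<and> j ` J = carrier H \<and>
       (\<forall>k\<in>K0 v \<pi>. \<forall>u\<in>J. j (conj_by k u) = (Ad_V V k (fst (j u)), snd (j u))) \<and>
       (\<forall>u\<in>J. fst (j u) = J_plus \<epsilon> s w #>\<^bsub>Sp4\<^esub> u) \<and>
       (\<forall>u\<in>J_plus \<epsilon> s w. j u = (\<one>\<^bsub>V\<^esub>, \<iota> (\<phi>h u))))"

text \<open>\<open>\<rho>\<close>, on the vector space with scalar multiplication \<open>sc\<close>, is the representation of \<open>K_gp\<close>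
  constructed from \<open>\<phi>\<close>.\<close>

definition nontwisted_kim_yu_rep ::
    "('f::field \<Rightarrow> real) \<Rightarrow> 'f \<Rightarrow> nat \<Rightarrow> ('f \<Rightarrow> 'e::field) \<Rightarrow> 'e \<Rightarrow> ('e \<Rightarrow> real) \<Rightarrow>
     ('c::field \<Rightarrow> 'k::{finite,field}) \<Rightarrow> ('f mat4 \<Rightarrow> 'c) \<Rightarrow>
     ('c \<Rightarrow> 'w::ab_group_add \<Rightarrow> 'w) \<Rightarrow> ('f mat4 \<Rightarrow> 'w \<Rightarrow> 'w) \<Rightarrow> bool" where
  "nontwisted_kim_yu_rep v \<pi> p \<epsilon> s w \<iota> \<phi> sc \<rho> \<longleftrightarrow>
     is_rep (Sp4\<lparr>carrier := K_gp v \<pi> \<epsilon> s w\<rparr>) sc \<rho> \<and>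
     (\<exists>\<phi>h j \<omega>.
        let V = V_space \<epsilon> s w; form = V_form \<iota> \<phi>h in
        is_phi_hat v \<pi> \<epsilon> s w \<phi> \<phi>h \<and> special_hom v \<pi> \<epsilon> s w \<iota> \<phi>h j \<and>
        heisenberg_weil p \<iota> V form sc \<omega> \<and>
        (\<forall>k\<in>K0 v \<pi>. \<forall>x. \<rho> k x = sc (\<phi> k) (\<omega> (Ad_V V k, \<one>\<^bsub>heis_gp V form\<^esub>) x)) \<and>
        (\<forall>u\<in>J_gp \<epsilon> s w. \<rho> u = \<omega> (\<one>\<^bsub>symp_gp V form\<^esub>, j u)))"


section \<open>Hecke algebras\<close>

definition mat_topology :: "('f::field \<Rightarrow> real) \<Rightarrow> 'f mat4 topology" where
  "mat_topology v = topology (\<lambda>U. \<forall>g\<in>U. \<exists>r. \<forall>g'.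
     (\<forall>i j. g'$i$j - g$i$j \<in> val_ideal v (At r)) \<longrightarrow> g' \<in> U)"

definition supp :: "('g \<Rightarrow> 'w \<Rightarrow> 'w::zero) \<Rightarrow> 'g set" where
  "supp f = {g. f g \<noteq> (\<lambda>_. 0)}"

text \<open>Functions on a subgroup \<open>H\<close> of \<open>Sp4(F)\<close> are extended by zero.\<close>

definition hecke ::
    "('f::field \<Rightarrow> real) \<Rightarrow> 'f mat4 set \<Rightarrow> 'f mat4 set \<Rightarrow>
     ('c::field \<Rightarrow> 'w::ab_group_add \<Rightarrow> 'w) \<Rightarrow> ('f mat4 \<Rightarrow> 'w \<Rightarrow> 'w) \<Rightarrow> ('f mat4 \<Rightarrow> 'w \<Rightarrow> 'w) set" where
  "hecke v H K sc \<rho> = {f. supp f \<subseteq> H \<and> compactin (mat_topology v) (supp f) \<and>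
     (\<forall>h\<in>H. Vector_Spaces.linear sc sc (f h)) \<and>
     (\<forall>k1\<in>K. \<forall>h\<in>H. \<forall>k2\<in>K. f (k1 ** h ** k2) = \<rho> k1 \<circ> f h \<circ> \<rho> k2)}"

text \<open>The sum over \<open>H/K\<close> is restricted to the finitely many cosets meeting the support of
  the first factor.\<close>

definition hecke_conv ::
    "'f::field mat4 set \<Rightarrow> ('f mat4 \<Rightarrow> 'w::ab_group_add \<Rightarrow> 'w) \<Rightarrow> ('f mat4 \<Rightarrow> 'w \<Rightarrow> 'w) \<Rightarrow>
     ('f mat4 \<Rightarrow> 'w \<Rightarrow> 'w)" where
  "hecke_conv K f1 f2 = (\<lambda>g x. \<Sum>C \<in> {h <#\<^bsub>Sp4\<^esub> K | h. h \<in> supp f1}.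
     let h = (SOME h. h \<in> C) in f1 h (f2 (inv\<^bsub>Sp4\<^esub> h ** g) x))"

definition hecke_algebra_iso ::
    "('f::field \<Rightarrow> real) \<Rightarrow>
     'f mat4 set \<Rightarrow> 'f mat4 set \<Rightarrow> ('c::field \<Rightarrow> 'w::ab_group_add \<Rightarrow> 'w) \<Rightarrow> ('f mat4 \<Rightarrow> 'w \<Rightarrow> 'w) \<Rightarrow>
     'f mat4 set \<Rightarrow> 'f mat4 set \<Rightarrow> ('c \<Rightarrow> 'u::ab_group_add \<Rightarrow> 'u) \<Rightarrow> ('f mat4 \<Rightarrow> 'u \<Rightarrow> 'u) \<Rightarrow>
     (('f mat4 \<Rightarrow> 'w \<Rightarrow> 'w) \<Rightarrow> ('f mat4 \<Rightarrow> 'u \<Rightarrow> 'u)) \<Rightarrow> bool" where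
  "hecke_algebra_iso v H K sc \<rho> H' K' sc' \<rho>' I \<longleftrightarrow>
     (let A = hecke v H K sc \<rho>; A' = hecke v H' K' sc' \<rho>' in
       bij_betw I A A' \<and>
       (\<forall>f1\<in>A. \<forall>f2\<in>A. I (\<lambda>g x. f1 g x + f2 g x) = (\<lambda>g x. I f1 g x + I f2 g x)) \<and>
       (\<forall>c. \<forall>f\<in>A. I (\<lambda>g x. sc c (f g x)) = (\<lambda>g x. sc' c (I f g x))) \<and>
       (\<forall>f1\<in>A. \<forall>f2\<in>A. I (hecke_conv K f1 f2) = hecke_conv K' (I f1) (I f2)))"

definition support_preserving ::
    "('f::field mat4 \<Rightarrow> 'w::ab_group_add \<Rightarrow> 'w) set \<Rightarrow> 'f mat4 set \<Rightarrow>
     (('f mat4 \<Rightarrow> 'w \<Rightarrow> 'w) \<Rightarrow> ('f mat4 \<Rightarrow> 'u::ab_group_add \<Rightarrow> 'u)) \<Rightarrow> bool" where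
  "support_preserving A K' I \<longleftrightarrow>
     (\<forall>f\<in>A. supp (I f) = K' <#>\<^bsub>Sp4\<^esub> supp f <#>\<^bsub>Sp4\<^esub> K')"

definition trivial_rep :: "'g \<Rightarrow> 'c \<Rightarrow> 'c" where
  "trivial_rep g = id"

end

theory Submission
  imports Defs
begin

text \<open>The point \<open>x\<^sub>0\<close> is generic enough that \<open>G\<^sub>x\<^sub>0\<close> has no jump at depth \<open>1/4\<close>: hence \<open>J =
  J\<^sub>+\<close>, \<open>V = 0\<close>, and \<open>\<rho>\<close> acts on \<open>K\<close> through the scalars \<open>\<phi>\<close> on \<open>K\<^sup>0\<close> and \<open>g \<mapsto> \<Psi>(X(g - 1))\<close>
  on \<open>J\<close>. Let \<open>s\<close> be the Weyl element of the \<open>SL\<^sub>2\<close> factor and \<open>f\<close> the indicator function of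
  \<open>K\<^sup>0 s K\<^sup>0\<close>. As \<open>f * f\<close> counts cosets, it does not vanish at \<open>s\<close>. If \<open>T\<close> is any element of
  the other Hecke algebra with support \<open>K s K\<close>, then the cosets in \<open>K s K / K\<close> are indexed
  by pairs \<open>(y, x)\<close> of residues, and \<open>(T * T)(s) = (\<Sum>\<^sub>y\<^sub>\<noteq>\<^sub>0 \<Sum>\<^sub>x \<Psi>(x\<^sup>2/y)) T(s)\<^sup>2\<close>. The
  double sum is zero: \<open>x = 0\<close> contributes \<open>q - 1\<close>, and every other \<open>x\<close> contributes the sum
  \<open>-1\<close> of \<open>\<Psi>\<close> over the nonzero residues. So \<open>T * T\<close> vanishes at \<open>s\<close>, which no
  support-preserving isomorphism allows.\<close>

section \<open>Symplectic matrices\<close>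

text \<open>The groups are given by generators over the ramified extension \<open>E\<close>,
  conjugated by \<open>cayley\<close> and cut down to \<open>F\<close>, while the coset count needs
  matrix entries. They are therefore enclosed: \<open>J_gp\<close> lies in a congruence subgroup,
  and \<open>J_plus_plus\<close> contains the elements of that subgroup with X(g - 1) in the maximal
  ideal, by elimination over \<open>E\<close>. The norm-one torus fills the gap, and
  \<open>\<phi>\<close> is known on it. The roots outside \<open>G\<^sup>0\<close> take the values
  3/16, 5/16 and 1/2 at \<open>x\<^sub>0\<close>, up to sign. None is congruent to 1/4 modulo 1/2,
  so 1/4 is not a jump even over \<open>E\<close>; over \<open>F\<close> the next jump is 5/16. As
  5/16 + 5/16 exceeds 1/2, X(g - 1) is additive modulo the maximal ideal. The vanishing double sum
  hides a quadratic character: for fixed y the sum over x is a Gauss sum proportional to the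
  quadratic character of y, whose values add up to zero. Summing over y first avoids Gauss sums. On
  \<open>G\<^sup>0\<close> no such sign enters, and the square of \<open>f\<close> keeps the nonzero
  value q - 1 at the Weyl element.\<close>

lemma vector_4:
  "(vector [x, y, z, t] :: ('a::zero)^4) $ 1 = x"
  "(vector [x, y, z, t] :: ('a::zero)^4) $ 2 = y"
  "(vector [x, y, z, t] :: ('a::zero)^4) $ 3 = z"
  "(vector [x, y, z, t] :: ('a::zero)^4) $ 4 = t"
  by (simp_all add: vector_def)

lemmas mat4_simps = vec_eq_iff forall_4 matrix_matrix_mult_def sum_4 transpose_def mat_def vector_4

text \<open>The pulled-back form is again alternating, so of its sixteen entries only the six above
  the diagonal carry equations.\<close>

lemma carrier_Sp4_iff:
  "g \<in> carrier Sp4 \<longleftrightarrow>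
     g$1$1 * g$4$2 - g$2$1 * g$3$2 + g$3$1 * g$2$2 - g$4$1 * g$1$2 = 0 \<and>
     g$1$1 * g$4$3 - g$2$1 * g$3$3 + g$3$1 * g$2$3 - g$4$1 * g$1$3 = 0 \<and>
     g$1$1 * g$4$4 - g$2$1 * g$3$4 + g$3$1 * g$2$4 - g$4$1 * g$1$4 = 1 \<and>
     g$1$2 * g$4$3 - g$2$2 * g$3$3 + g$3$2 * g$2$3 - g$4$2 * g$1$3 = - 1 \<and>
     g$1$2 * g$4$4 - g$2$2 * g$3$4 + g$3$2 * g$2$4 - g$4$2 * g$1$4 = 0 \<and>
     g$1$3 * g$4$4 - g$2$3 * g$3$4 + g$3$3 * g$2$4 - g$4$3 * g$1$4 = 0"
  by (simp add: Sp4_def sp_form_def mat4_simps) (auto simp: algebra_simps)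

text \<open>The adjoint with respect to \<open>sp_form\<close>, hence the inverse of a symplectic
  matrix. It only permutes entries up to sign, so bounds on entries carry over to the inverse
  without any division.\<close>

definition sp_inv :: "'a::field mat4 \<Rightarrow> 'a mat4" where
  "sp_inv g = vector [vector [g$4$4, - g$3$4, g$2$4, - g$1$4],
                      vector [- g$4$3, g$3$3, - g$2$3, g$1$3],
                      vector [g$4$2, - g$3$2, g$2$2, - g$1$2],
                      vector [- g$4$1, g$3$1, - g$2$1, g$1$1]]"

lemma sp_inv_left: "g \<in> carrier Sp4 \<Longrightarrow> sp_inv g ** g = mat 1"
  unfolding carrier_Sp4_iff
  by (simp add: sp_inv_def mat4_simps) (simp add: algebra_simps)

lemma sp_inv_right: "g \<in> carrier Sp4 \<Longrightarrow> g ** sp_inv g = mat 1"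
  by (metis sp_inv_left matrix_left_right_inverse)

lemma Sp4_simps [simp]: "mult Sp4 = (**)" "one Sp4 = mat 1"
  by (simp_all add: Sp4_def)

lemma group_Sp4: "group (Sp4 :: 'a::field mat4 monoid)"
proof (rule groupI)
  show "x \<otimes>\<^bsub>Sp4\<^esub> y \<in> carrier Sp4" if "x \<in> carrier Sp4" "y \<in> carrier
      Sp4" for x y :: "'a mat4"
  proof -
    have "transpose (x ** y) ** sp_form ** (x ** y) = transpose y ** (transpose x ** sp_form ** x) ** y"
      by (simp add: matrix_transpose_mul matrix_mul_assoc)
    also have "\<dots> = sp_form" using that by (simp add: Sp4_def)
    finally show ?thesis by (simp add: Sp4_def)
  qed
  show "\<exists>y\<in>carrier Sp4. y \<otimes>\<^bsub>Sp4\<^esub> x = \<one>\<^bsub>Sp4\<^esub>" if "x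
      \<in> carrier Sp4" for x :: "'a mat4"
  proof (intro bexI[of _ "sp_inv x"])
    show "sp_inv x \<otimes>\<^bsub>Sp4\<^esub> x = \<one>\<^bsub>Sp4\<^esub>" using sp_inv_left[OF
        that] by simp
    have "transpose (sp_inv x) ** sp_form ** sp_inv x
        = transpose (sp_inv x) ** (transpose x ** sp_form ** x) ** sp_inv x"
      using that by (simp add: Sp4_def)
    also have "\<dots> = transpose (x ** sp_inv x) ** sp_form ** (x ** sp_inv x)"
      by (simp add: matrix_transpose_mul matrix_mul_assoc)
    also have "\<dots> = sp_form" using sp_inv_right[OF that] by (simp add: transpose_mat)
    finally show "sp_inv x \<in> carrier Sp4" by (simp add: Sp4_def)
  qed
qed (auto simp: matrix_mul_assoc Sp4_def transpose_mat)

interpretation Sp4: group Sp4 by (rule group_Sp4)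

lemma inv_Sp4: "g \<in> carrier Sp4 \<Longrightarrow> inv\<^bsub>Sp4\<^esub> g = sp_inv g"
  by (metis Sp4.inv_closed Sp4.l_inv Sp4_simps sp_inv_right matrix_mul_assoc matrix_mul_lid matrix_mul_rid)

lemma sp_inv_closed [simp]: "g \<in> carrier Sp4 \<Longrightarrow> sp_inv g \<in> carrier Sp4"
  using Sp4.inv_closed inv_Sp4 by metis

lemma Sp4_mult_closed [simp]: "g \<in> carrier Sp4 \<Longrightarrow> h \<in> carrier Sp4
    \<Longrightarrow> g ** h \<in> carrier Sp4"
  using Sp4.m_closed by simp

lemma Sp4_one_closed [simp]: "mat 1 \<in> carrier Sp4"
  using Sp4.one_closed by simp

lemma sp_inv_mult: "g \<in> carrier Sp4 \<Longrightarrow> h \<in> carrier Sp4 \<Longrightarrow> sp_inv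
    (g ** h) = sp_inv h ** sp_inv g"
  using Sp4.inv_mult_group[of g h] by (simp add: inv_Sp4)

lemma sp_inv_inv [simp]: "sp_inv (sp_inv g) = g"
  by (simp add: sp_inv_def mat4_simps)

lemma sp_inv_cancel:
  assumes "g \<in> carrier Sp4"
  shows "sp_inv g ** (g ** a) = a" "g ** (sp_inv g ** a) = a"
    "a ** g ** sp_inv g = a" "a ** sp_inv g ** g = a"
  using assms by (metis matrix_mul_assoc matrix_mul_lid matrix_mul_rid sp_inv_left sp_inv_right)+

lemma conj_by_eq: "k \<in> carrier Sp4 \<Longrightarrow> conj_by k g = k ** g ** sp_inv k"
  by (simp add: conj_by_def inv_Sp4)

section \<open>Moy--Prasad lattices for a valuation\<close>

locale valued =
  fixes v :: "'a::field \<Rightarrow> real"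
  assumes valuation: "valuation v"
begin

lemma v_mult: "x \<noteq> 0 \<Longrightarrow> y \<noteq> 0 \<Longrightarrow> v (x * y) = v x + v y"
  using valuation unfolding valuation_def by blast

lemma v_add: "x \<noteq> 0 \<Longrightarrow> y \<noteq> 0 \<Longrightarrow> x + y \<noteq> 0
    \<Longrightarrow> min (v x) (v y) \<le> v (x + y)"
  using valuation unfolding valuation_def by blast

lemma v_one [simp]: "v 1 = 0"
  using v_mult[of 1 1] by simp

lemma v_minus [simp]: "v (- x) = v x"
proof (cases "x = 0")
  case False
  have "v (- 1) = 0" using v_mult[of "- 1" "- 1"] by simp
  then show ?thesis using v_mult[of "- 1" x] False by simp
qed simp

lemma v_inverse: "x \<noteq> 0 \<Longrightarrow> v (inverse x) = - v x"
  using v_mult[of x "inverse x"] by simp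

lemma v_divide: "x \<noteq> 0 \<Longrightarrow> y \<noteq> 0 \<Longrightarrow> v (x / y) = v x - v y"
  by (simp add: divide_inverse v_mult v_inverse)

abbreviation vge :: "real \<Rightarrow> 'a \<Rightarrow> bool" where
  "vge r x \<equiv> x \<in> val_ideal v (At r)"

lemma vge_iff: "vge r x \<longleftrightarrow> x = 0 \<or> r \<le> v x"
  by (simp add: val_ideal_def)

lemma vge_zero [simp]: "vge r 0"
  by (simp add: vge_iff)

lemma vge_mono: "vge r x \<Longrightarrow> t \<le> r \<Longrightarrow> vge t x"
  by (auto simp: vge_iff)

lemma vge_add: "vge r x \<Longrightarrow> vge r y \<Longrightarrow> vge r (x + y)"
  using v_add[of x y] by (cases "x = 0 \<or> y = 0 \<or> x + y = 0") (auto simp: vge_iff)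

lemma vge_minus [simp]: "vge r (- x) \<longleftrightarrow> vge r x"
  by (simp add: vge_iff)

lemma vge_diff: "vge r x \<Longrightarrow> vge r y \<Longrightarrow> vge r (x - y)"
  using vge_add[of x r "- y"] by simp

lemma vge_mult: "vge r x \<Longrightarrow> vge t y \<Longrightarrow> vge (r + t) (x * y)"
  by (cases "x = 0 \<or> y = 0") (auto simp: vge_iff v_mult)

lemma vge_mult': "vge r x \<Longrightarrow> vge t y \<Longrightarrow> u \<le> r + t \<Longrightarrow>
    vge u (x * y)"
  using vge_mono[OF vge_mult] by blast

lemma vge_divide: "vge r x \<Longrightarrow> y \<noteq> 0 \<Longrightarrow> u \<le> r - v y
    \<Longrightarrow> vge u (x / y)"
  by (cases "x = 0") (auto simp: vge_iff v_divide)

lemma vge_sum: "(\<And>i. i \<in> I \<Longrightarrow> vge r (f i)) \<Longrightarrow> vge r (sum f I)"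
  by (induction I rule: infinite_finite_induct) (auto intro: vge_add)

lemma unit_of_one_plus:
  assumes "vge r (x - 1)" "0 < r"
  shows "x \<noteq> 0" "v x = 0"
proof -
  show x0: "x \<noteq> 0" using assms by (auto simp: vge_iff)
  show "v x = 0"
  proof (cases "x = 1")
    case False
    then have d: "x - 1 \<noteq> 0" "0 < v (x - 1)" using assms by (auto simp: vge_iff)
    have "min (v (x - 1)) (v 1) \<le> v x" using v_add[of "x - 1" 1] d x0 by simp
    moreover have "min (v x) (v (x - 1)) \<le> v 1"
      using v_add[of x "- (x - 1)"] d x0 v_minus[of "x - 1"] by simp
    ultimately show ?thesis using d by (auto simp: min_def split: if_splits)
  qed simp
qed

end

text \<open>The four weights evaluated at \<open>x\<^sub>0 - o\<close>. Once a root value is a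
  difference of two of these, depths add up along a matrix product because the middle index
  cancels.\<close>

definition x0_wt :: "4 \<Rightarrow> real" where
  "x0_wt i = (if i = 1 then - 1 / 4 else if i = 2 then 1 / 16 else if i = 3 then - 1 / 16 else 1 / 4)"

lemma root_at_x0_wt: "root_at_x0 (wt i - wt j) = x0_wt i - x0_wt j"
  using exhaust_4[of i] exhaust_4[of j] by (auto simp: root_at_x0_def wt_def x0_wt_def)

text \<open>In the index type \<open>4\<close> numerals are read modulo 4, so \<open>5 - i\<close>
  reverses the order of the indices. The form pairs each weight with its negative; hence the
  reversal negates \<open>x0_wt\<close>, and \<open>sp_inv\<close> keeps every depth.\<close>

lemma sp_inv_entry: "sp_inv g $ i $ j = (if (i = 1 \<or> i = 3) = (j = 1 \<or> j = 3) then g $ (5 - j)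
    $ (5 - i) else - g $ (5 - j) $ (5 - i))"
  using exhaust_4[of i] exhaust_4[of j] by (auto simp: sp_inv_def vector_4)

section \<open>Lattices of matrices at \<open>x\<^sub>0\<close> and their congruence
  subgroups\<close>

context valued
begin

lemma gl4_At_iff: "A \<in> gl4_fil v (At d) \<longleftrightarrow> (\<forall>i j. vge (d - x0_wt i +
    x0_wt j) (A $ i $ j))"
  unfolding gl4_fil_def root_at_x0_wt vge_iff by (auto simp: algebra_simps)

lemma gl4_mono: "A \<in> gl4_fil v (At d) \<Longrightarrow> d' \<le> d \<Longrightarrow> A \<in>
    gl4_fil v (At d')"
  unfolding gl4_At_iff by (meson vge_mono add_right_mono diff_right_mono)

lemma gl4_add: "A \<in> gl4_fil v (At d) \<Longrightarrow> B \<in> gl4_fil v (At d) \<Longrightarrow> A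
    + B \<in> gl4_fil v (At d)"
  unfolding gl4_At_iff by (auto intro: vge_add)

lemma gl4_minus: "A \<in> gl4_fil v (At d) \<Longrightarrow> - A \<in> gl4_fil v (At d)"
  unfolding gl4_At_iff by auto

lemma gl4_mult:
  assumes "A \<in> gl4_fil v (At d)" "B \<in> gl4_fil v (At d')" "e \<le> d + d'"
  shows "A ** B \<in> gl4_fil v (At e)"
  unfolding gl4_At_iff
proof (intro allI)
  fix i j
  show "vge (e - x0_wt i + x0_wt j) ((A ** B) $ i $ j)"
    unfolding matrix_matrix_mult_def using assms unfolding gl4_At_iff
    by (auto intro!: vge_sum) (rule vge_mult', blast, blast, simp)
qed

lemma gl4_one: "mat 1 \<in> gl4_fil v (At 0)"
  unfolding gl4_At_iff by (auto simp: mat_def vge_iff)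

lemma x0_wt_reflect: "x0_wt (5 - i) = - x0_wt i"
  using exhaust_4[of i] by (auto simp: x0_wt_def)

lemma gl4_sp_inv: "g \<in> gl4_fil v (At d) \<Longrightarrow> sp_inv g \<in> gl4_fil v (At d)"
  unfolding gl4_At_iff
proof (intro allI)
  fix i j
  assume "\<forall>i j. vge (d - x0_wt i + x0_wt j) (g $ i $ j)"
  then have "vge (d - x0_wt (5 - j) + x0_wt (5 - i)) (g $ (5 - j) $ (5 - i))" by blast
  then show "vge (d - x0_wt i + x0_wt j) (sp_inv g $ i $ j)"
    unfolding sp_inv_entry x0_wt_reflect by (auto simp: algebra_simps)
qed

text \<open>This serves as an entrywise upper bound for generated groups: for nonnegative depth it
  is closed under products and inverses, so it contains what its elements generate, and it is stable
  under conjugation by symplectic matrices of depth zero.\<close>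

definition cong_gp :: "real \<Rightarrow> 'a mat4 set" where
  "cong_gp d = {g \<in> carrier Sp4. g - mat 1 \<in> gl4_fil v (At d)}"

end

lemma mat_diff_rdistrib: "(A - B) ** C = A ** C - B ** (C :: 'a::field mat4)"
  by (simp add: mat4_simps algebra_simps)

lemma mat_add_rdistrib: "(A + B) ** C = A ** C + B ** (C :: 'a::field mat4)"
  by (simp add: mat4_simps algebra_simps)

lemma mat_diff_ldistrib: "C ** (A - B) = C ** A - C ** (B :: 'a::field mat4)"
  by (simp add: mat4_simps algebra_simps)

lemma mat_mult_minus: "(- A) ** B = - (A ** B)" "A ** (- B) = - (A ** (B :: 'a::field mat4))"
  by (simp_all add: mat4_simps algebra_simps)

context valued
begin

lemma cong_gp_gl4: "0 \<le> d \<Longrightarrow> g \<in> cong_gp d \<Longrightarrow> g \<in> gl4_fil v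
    (At 0)"
  using gl4_add[of "g - mat 1" 0 "mat 1"] gl4_one gl4_mono[of _ d 0] by (auto simp: cong_gp_def)

lemma cong_gp_mult:
  assumes "0 \<le> d" "g \<in> cong_gp d" "h \<in> cong_gp d"
  shows "g ** h \<in> cong_gp d"
proof -
  have "g ** h - mat 1 = g ** (h - mat 1) + (g - mat 1)"
    by (simp add: mat_diff_ldistrib)
  moreover have "g ** (h - mat 1) \<in> gl4_fil v (At d)"
    using assms cong_gp_gl4[of d g] by (auto intro!: gl4_mult[of _ 0 _ d] simp: cong_gp_def)
  ultimately have "g ** h - mat 1 \<in> gl4_fil v (At d)"
    using assms gl4_add by (metis (no_types, lifting) cong_gp_def mem_Collect_eq)
  then show ?thesis using assms by (simp add: cong_gp_def)
qed

lemma cong_gp_sp_inv: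
  assumes "0 \<le> d" "g \<in> cong_gp d"
  shows "sp_inv g \<in> cong_gp d"
proof -
  have g: "g \<in> carrier Sp4" using assms by (simp add: cong_gp_def)
  have "sp_inv g - mat 1 = - (sp_inv g ** (g - mat 1))"
    using g by (simp add: mat_diff_ldistrib sp_inv_left)
  moreover have "sp_inv g ** (g - mat 1) \<in> gl4_fil v (At d)"
    using assms cong_gp_gl4[of d g] by (auto intro!: gl4_mult[of _ 0 _ d] gl4_sp_inv simp: cong_gp_def)
  ultimately show ?thesis using g gl4_minus by (auto simp: cong_gp_def)
qed

lemma cong_gp_conj:
  assumes "c \<in> carrier Sp4" "c \<in> gl4_fil v (At 0)" "g \<in> cong_gp d"
  shows "conj_by c g \<in> cong_gp d"
proof -
  have "conj_by c g - mat 1 = c ** (g - mat 1) ** sp_inv c"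
    using assms by (simp add: conj_by_eq mat_diff_ldistrib mat_diff_rdistrib sp_inv_right)
  moreover have "c ** (g - mat 1) ** sp_inv c \<in> gl4_fil v (At d)"
    using assms
    by (intro gl4_mult[where d = d and d' = 0] gl4_mult[where d = 0 and d' = d] gl4_sp_inv)
      (auto simp: cong_gp_def)
  ultimately show ?thesis using assms by (simp add: cong_gp_def conj_by_eq)
qed

lemma generate_cong_gp:
  assumes "0 \<le> d" "S \<subseteq> cong_gp d" "g \<in> generate Sp4 S"
  shows "g \<in> cong_gp d"
  using assms(3)
proof (induction rule: generate.induct)
  case one
  then show ?case by (simp add: cong_gp_def gl4_At_iff)
next
  case (incl h)
  then show ?case using assms by blast
next
  case (inv h)
  then have "h \<in> cong_gp d" using assms by blast
  then show ?case using cong_gp_sp_inv[OF assms(1)] by (simp add: inv_Sp4 cong_gp_def)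
next
  case (eng h1 h2)
  then show ?case using cong_gp_mult[OF assms(1)] by simp
qed

section \<open>Torus and root group elements as symplectic matrices\<close>

lemma torus_elt_Sp4: "t1 \<noteq> 0 \<Longrightarrow> t2 \<noteq> 0 \<Longrightarrow> torus_elt t1 t2
    \<in> carrier Sp4"
  unfolding carrier_Sp4_iff torus_elt_def by (simp add: vector_4)

lemma torus_fil_cong_gp: "0 < d \<Longrightarrow> torus_fil v (At d) \<subseteq> cong_gp d"
proof
  fix g assume d: "0 < d" and "g \<in> torus_fil v (At d)"
  then obtain t1 t2 where t: "g = torus_elt t1 t2" "t1 \<noteq> 0" "t2 \<noteq> 0" "vge d (t1 - 1)"
      "vge d (t2 - 1)"
    unfolding torus_fil_def by blast
  have i: "vge d (inverse t - 1)" if "t \<noteq> 0" "vge d (t - 1)" for t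
  proof -
    have "inverse t - 1 = - ((t - 1) / t)" using that by (simp add: field_simps)
    then show ?thesis using that unit_of_one_plus[of t d] d vge_divide[of "t - 1" d t d] by simp
  qed
  show "g \<in> cong_gp d"
    using t i d torus_elt_Sp4[of t1 t2]
    by (simp add: cong_gp_def) (simp add: gl4_At_iff forall_4 torus_elt_def vector_4 mat_def x0_wt_def)
qed

lemma wt_diff_nonzero: "i \<noteq> j \<Longrightarrow> wt i - wt j \<noteq> 0"
  using exhaust_4[of i] exhaust_4[of j] by (auto simp: wt_def zero_prod_def)

text \<open>The four weights are the vertices of a square, and no vertex is the midpoint of two
  others. This is what makes root vectors square to zero.\<close>

lemma wt_diff_eq: "wt i - wt k = wt k - wt j \<Longrightarrow> i = k"
  using exhaust_4[of i] exhaust_4[of j] exhaust_4[of k] by (auto simp: wt_def zero_prod_def)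

lemma root_vector_square_zero:
  fixes A :: "'b::field mat4"
  assumes "\<alpha> \<in> roots" "\<forall>i j. A$i$j \<noteq> 0 \<longrightarrow> wt i - wt j = \<alpha>"
  shows "A ** A = 0"
proof -
  have "A$i$k * A$k$j = 0" for i j k
  proof (rule ccontr)
    assume "A$i$k * A$k$j \<noteq> 0"
    then have ik: "wt i - wt k = \<alpha>" and kj: "wt k - wt j = \<alpha>" using assms(2) by auto
    have "i = k" by (rule wt_diff_eq[of _ _ j]) (simp only: ik kj)
    moreover obtain a b where "\<alpha> = wt a - wt b" "a \<noteq> b" using assms(1) by (auto simp:
        roots_def)
    ultimately show False using ik wt_diff_nonzero[of a b] by simp
  qed
  then have "(\<Sum>k\<in>UNIV. A$i$k * A$k$j) = 0" for i j by (intro sum.neutral) blast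
  then show ?thesis by (simp add: matrix_matrix_mult_def vec_eq_iff)
qed

text \<open>The terms linear in \<open>A\<close> cancel because \<open>A\<close> is in the Lie
  algebra. The quadratic term is \<open>- sp_form ** (A ** A)\<close>, which vanishes for a root
  vector.\<close>

lemma root_fil_Sp4:
  fixes u :: "'b::field \<Rightarrow> real"
  assumes "\<alpha> \<in> roots" "g \<in> root_fil u \<alpha> d"
  shows "g \<in> carrier Sp4"
proof -
  obtain A where A: "g = mat 1 + A" "A \<in> lie_sp4" "\<forall>i j. A$i$j \<noteq> 0 \<longrightarrow>
      wt i - wt j = \<alpha>"
    using assms(2) unfolding root_fil_def by blast
  have sq: "A ** A = 0" using root_vector_square_zero[OF assms(1) A(3)] .
  have lie: "transpose A ** sp_form = - (sp_form ** A)"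
    using A(2) by (simp add: lie_sp4_def eq_neg_iff_add_eq_0)
  have "transpose g = mat 1 + transpose A" by (simp add: A(1) vec_eq_iff transpose_def mat_def)
  then have "transpose g ** sp_form ** g = (mat 1 + transpose A) ** sp_form ** (mat 1 + A)"
    using A by simp
  also have "\<dots> = sp_form + sp_form ** A + transpose A ** sp_form + (transpose A ** sp_form) ** A"
    by (simp add: matrix_add_ldistrib mat_add_rdistrib algebra_simps)
  also have "\<dots> = sp_form - sp_form ** (A ** A)"
    unfolding lie by (simp add: mat_mult_minus matrix_mul_assoc)
  also have "\<dots> = sp_form" unfolding sq by (simp add: matrix_matrix_mult_def vec_eq_iff)
  finally show ?thesis by (simp add: Sp4_def)
qed

lemma root_fil_cong_gp:
  assumes "\<alpha> \<in> roots"
  shows "root_fil v \<alpha> (At d) \<subseteq> cong_gp d"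
  using root_fil_Sp4[OF assms] by (auto simp: cong_gp_def) (auto simp: root_fil_def)

lemma roots0_subset: "roots0 \<subseteq> roots"
proof -
  have "wt 2 - wt 3 \<in> roots" "wt 3 - wt 2 \<in> roots"
    unfolding roots_def mem_Collect_eq
    by (rule exI[of _ 2], rule exI[of _ 3], simp) (rule exI[of _ 3], rule exI[of _ 2], simp)
  then show ?thesis by (simp add: roots0_def wt_def)
qed

lemma torus_fil_mono: "d' \<le> d \<Longrightarrow> torus_fil v (At d) \<subseteq> torus_fil v (At d')"
  unfolding torus_fil_def by (auto intro: vge_mono)

lemma root_fil_mono: "d' \<le> d \<Longrightarrow> root_fil v \<alpha> (At d) \<subseteq> root_fil v
    \<alpha> (At d')"
  unfolding root_fil_def using gl4_mono by blast

end

section \<open>Triangular decomposition over the splitting field\<close>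

text \<open>This and the next seven definitions parametrize the root groups of the diagonal torus,
  labelled by a matrix position of the root. A short root occupies two positions, and the form fixes
  the sign of the second entry.\<close>

definition e21 :: "'a::field \<Rightarrow> 'a mat4" where
  "e21 a = vector [vector [1, 0, 0, 0], vector [a, 1, 0, 0], vector [0, 0, 1, 0], vector [0, 0, a, 1]]"

definition e31 :: "'a::field \<Rightarrow> 'a mat4" where
  "e31 a = vector [vector [1, 0, 0, 0], vector [0, 1, 0, 0], vector [a, 0, 1, 0], vector [0, - a, 0, 1]]"

definition e41 :: "'a::field \<Rightarrow> 'a mat4" where
  "e41 a = vector [vector [1, 0, 0, 0], vector [0, 1, 0, 0], vector [0, 0, 1, 0], vector [a, 0, 0, 1]]"

definition e12 :: "'a::field \<Rightarrow> 'a mat4" where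
  "e12 a = vector [vector [1, a, 0, 0], vector [0, 1, 0, 0], vector [0, 0, 1, a], vector [0, 0, 0, 1]]"

definition e13 :: "'a::field \<Rightarrow> 'a mat4" where
  "e13 a = vector [vector [1, 0, a, 0], vector [0, 1, 0, - a], vector [0, 0, 1, 0], vector [0, 0, 0, 1]]"

definition e14 :: "'a::field \<Rightarrow> 'a mat4" where
  "e14 a = vector [vector [1, 0, 0, a], vector [0, 1, 0, 0], vector [0, 0, 1, 0], vector [0, 0, 0, 1]]"

definition e23 :: "'a::field \<Rightarrow> 'a mat4" where
  "e23 a = vector [vector [1, 0, 0, 0], vector [0, 1, a, 0], vector [0, 0, 1, 0], vector [0, 0, 0, 1]]"

definition e32 :: "'a::field \<Rightarrow> 'a mat4" where
  "e32 a = vector [vector [1, 0, 0, 0], vector [0, 1, 0, 0], vector [0, a, 1, 0], vector [0, 0, 0, 1]]"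

lemmas e_defs = e21_def e31_def e41_def e12_def e13_def e14_def e23_def e32_def

lemma e_cancel:
  "e21 a ** e21 (- a) = mat 1" "e31 a ** e31 (- a) = mat 1" "e41 a ** e41 (- a) = mat 1"
  "e12 (- a) ** e12 a = mat 1" "e13 (- a) ** e13 a = mat 1" "e14 (- a) ** e14 a = mat 1"
  "e23 (- a) ** e23 a = mat 1" "e32 a ** e32 (- a) = mat 1"
  by (simp_all add: e_defs mat4_simps)

text \<open>The generators before conjugation by \<open>cayley\<close>: elimination is carried out
  for the diagonal torus and transported afterwards.\<close>

definition yu_gens :: "('a::field \<Rightarrow> real) \<Rightarrow> depth \<Rightarrow> depth
    \<Rightarrow> 'a mat4 set" where
  "yu_gens w d d' = torus_fil w d \<union> (\<Union>\<alpha>\<in>roots0. root_fil w \<alpha> d)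
      \<union> (\<Union>\<alpha>\<in>roots - roots0. root_fil w \<alpha> d')"

lemma yu_gensI:
  "g \<in> torus_fil w d \<Longrightarrow> g \<in> yu_gens w d d'"
  "\<alpha> \<in> roots0 \<Longrightarrow> g \<in> root_fil w \<alpha> d \<Longrightarrow> g \<in>
      yu_gens w d d'"
  "\<alpha> \<in> roots - roots0 \<Longrightarrow> g \<in> root_fil w \<alpha> d' \<Longrightarrow> g
      \<in> yu_gens w d d'"
  unfolding yu_gens_def by blast+

lemma wt_diff_roots: "i \<noteq> j \<Longrightarrow> wt i - wt j \<in> roots"
  unfolding roots_def by blast

lemma outer_roots: "(1, 1) \<in> roots - roots0" "(1, -1) \<in> roots - roots0" "(-1, 1) \<in> roots -
    roots0"
  "(-1, -1) \<in> roots - roots0" "(2, 0) \<in> roots - roots0" "(-2, 0) \<in> roots - roots0"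
  using wt_diff_roots[of 1 3] wt_diff_roots[of 1 2] wt_diff_roots[of 2 1] wt_diff_roots[of 3 1]
    wt_diff_roots[of 1 4] wt_diff_roots[of 4 1]
  by (simp_all add: wt_def roots0_def)

lemma root_fil_iff:
  "g \<in> root_fil w \<alpha> d \<longleftrightarrow> g - mat 1 \<in> lie_sp4 \<and> g - mat 1 \<in>
      gl4_fil w d \<and>
     (\<forall>i j. (g - mat 1)$i$j \<noteq> 0 \<longrightarrow> wt i - wt j = \<alpha>)"
proof -
  have "g = mat 1 + A \<longleftrightarrow> A = g - mat 1" for A by auto
  then show ?thesis unfolding root_fil_def by simp
qed

lemma lie_sp4_iff:
  "A \<in> lie_sp4 \<longleftrightarrow> A$4$4 = - A$1$1 \<and> A$3$3 = - A$2$2 \<and> A$4$3 = A$2$1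
      \<and> A$4$2 = - A$3$1 \<and>
     A$3$4 = A$1$2 \<and> A$2$4 = - A$1$3"
  by (simp add: lie_sp4_def sp_form_def mat4_simps) (intro iffI; elim conjE; intro conjI; algebra)

text \<open>The shifts are the values of the eight roots at \<open>x\<^sub>0\<close>. Here
  \<open>w\<close> is an arbitrary function, so the two elements that also contain
  \<open>- a\<close> ask for \<open>w (- a) = w a\<close>.\<close>

lemma e_in_root_fil:
  fixes w :: "'a::field \<Rightarrow> real"
  shows "a = 0 \<or> reaches d (w a + 5 / 16) \<Longrightarrow> e21 a \<in> root_fil w (-1, 1) d"
    "a = 0 \<or> reaches d (w a + 3 / 16) \<Longrightarrow> w (- a) = w a \<Longrightarrow> e31 a \<in>
        root_fil w (-1, -1) d"
    "a = 0 \<or> reaches d (w a + 1 / 2) \<Longrightarrow> e41 a \<in> root_fil w (-2, 0) d"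
    "a = 0 \<or> reaches d (w a - 5 / 16) \<Longrightarrow> e12 a \<in> root_fil w (1, -1) d"
    "a = 0 \<or> reaches d (w a - 3 / 16) \<Longrightarrow> w (- a) = w a \<Longrightarrow> e13 a \<in>
        root_fil w (1, 1) d"
    "a = 0 \<or> reaches d (w a - 1 / 2) \<Longrightarrow> e14 a \<in> root_fil w (2, 0) d"
    "a = 0 \<or> reaches d (w a + 1 / 8) \<Longrightarrow> e23 a \<in> root_fil w (0, 2) d"
    "a = 0 \<or> reaches d (w a - 1 / 8) \<Longrightarrow> e32 a \<in> root_fil w (0, -2) d"
  by (simp_all add: root_fil_iff lie_sp4_iff gl4_fil_def root_at_x0_def e_defs forall_4 mat_def
      vector_4 wt_def)

context valued
begin

text \<open>The Lie algebra version of the generators of \<open>J\<^sub>+\<^sub>+\<close>, slightly thickened: depth \<open>5/16\<close>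
  everywhere, and depth \<open>9/16\<close> along the torus and the roots of \<open>G\<^sup>0\<close>. A product of two
  elements has depth \<open>10/16\<close>, so \<open>1 + deep_lat\<close> is closed under multiplication.\<close>

definition deep_lat :: "'a mat4 set" where
  "deep_lat = {B \<in> gl4_fil v (At (5/16)). vge (9/16) (B$1$1) \<and> vge (9/16) (B$2$2) \<and> vge
      (9/16) (B$3$3) \<and>
     vge (9/16) (B$4$4) \<and> vge (7/16) (B$2$3) \<and> vge (11/16) (B$3$2)}"

definition deep_gp :: "'a mat4 set" where
  "deep_gp = {g \<in> carrier Sp4. g - mat 1 \<in> deep_lat}"

lemma gl4_deep_lat: "A \<in> gl4_fil v (At (10/16)) \<Longrightarrow> A \<in> deep_lat"
proof -
  assume A: "A \<in> gl4_fil v (At (10/16))"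
  have "vge d (A$i$j)" if "d \<le> 10/16 - x0_wt i + x0_wt j" for d i j
    using A that vge_mono unfolding gl4_At_iff by blast
  then show ?thesis
    using gl4_mono[OF A, of "5/16"] by (simp add: deep_lat_def x0_wt_def)
qed

lemma deep_lat_add: "A \<in> deep_lat \<Longrightarrow> B \<in> deep_lat \<Longrightarrow> A + B \<in>
    deep_lat"
  unfolding deep_lat_def by (auto intro: vge_add gl4_add)

lemma deep_gp_mult:
  assumes "g \<in> deep_gp" "h \<in> deep_gp"
  shows "g ** h \<in> deep_gp"
proof -
  let ?A = "g - mat 1" and ?B = "h - mat 1"
  have "g ** h - mat 1 = ?A + ?B + ?A ** ?B"
    by (simp add: mat_diff_ldistrib mat_diff_rdistrib)
  moreover have "?A ** ?B \<in> deep_lat"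
    using assms gl4_mult[of ?A "5/16" ?B "5/16" "10/16"] gl4_deep_lat
    by (simp add: deep_gp_def deep_lat_def)
  ultimately have "g ** h - mat 1 \<in> deep_lat"
    using assms deep_lat_add by (metis (no_types, lifting) deep_gp_def mem_Collect_eq)
  then show ?thesis using assms by (simp add: deep_gp_def)
qed

text \<open>Each bound is the depth in \<open>deep_lat\<close> minus the value of the root at
  \<open>x\<^sub>0\<close>: for instance 5/16 + 5/16 at position (1,2) and 9/16 - 1/8 at
  (2,3).\<close>

lemma deep_gp_entries:
  assumes "g \<in> deep_gp"
  shows "vge (9/16) (g$1$1 - 1)" "vge (9/16) (g$2$2 - 1)" "vge (10/16) (g$1$2)" "vge (1/2) (g$1$3)"
    "vge (13/16) (g$1$4)" "vge 0 (g$2$1)" "vge (1/8) (g$3$1)" "vge (- 3/16) (g$4$1)"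
    "vge (7/16) (g$2$3)" "vge (11/16) (g$3$2)"
  using assms unfolding deep_gp_def deep_lat_def gl4_At_iff forall_4 by (simp_all add: mat_def x0_wt_def)

lemma e_deep_gp:
  "vge 0 a \<Longrightarrow> e21 a \<in> deep_gp" "vge (1/8) a \<Longrightarrow> e31 a \<in> deep_gp"
      "vge (- 3/16) a \<Longrightarrow> e41 a \<in> deep_gp"
  "vge (10/16) a \<Longrightarrow> e12 a \<in> deep_gp" "vge (1/2) a \<Longrightarrow> e13 a \<in>
      deep_gp" "vge (13/16) a \<Longrightarrow> e14 a \<in> deep_gp"
  "vge (7/16) a \<Longrightarrow> e23 a \<in> deep_gp" "vge (11/16) a \<Longrightarrow> e32 a \<in> deep_gp"
  unfolding deep_gp_def deep_lat_def gl4_At_iff forall_4 carrier_Sp4_iff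
  by (auto simp: e_defs mat_def x0_wt_def vector_4 intro: vge_mono)

text \<open>Gaussian elimination within \<open>deep_gp\<close>. The pivots are congruent to 1, so a
  multiplier inherits the bound of the entry that it clears. Each elementary factor is then an
  element of \<open>deep_gp\<close> and also an allowed generator, since 5/16 and 9/16 are strictly
  larger than 1/4 and 1/2.\<close>

lemma deep_gp_generated:
  assumes "g \<in> deep_gp"
  shows "g \<in> generate Sp4 (yu_gens v (After (1/2)) (After (1/4)))" (is "g \<in> ?G")
proof -
  have gen: "x ** y \<in> ?G" if "x \<in> ?G" "y \<in> ?G" for x y
    using generate.eng[OF that] by simp
  have incl: "x \<in> ?G" if "x \<in> root_fil v \<alpha> (After (1/4))" "\<alpha> \<in> roots -
      roots0" for x \<alpha>
    using that generate.incl yu_gensI(3) by metis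
  have incl0: "x \<in> ?G" if "x \<in> root_fil v \<alpha> (After (1/2))" "\<alpha> \<in> roots0" for x
      \<alpha>
    using that generate.incl yu_gensI(2) by metis
  have e: "vge 0 a \<Longrightarrow> e21 a \<in> ?G" "vge (1/8) a \<Longrightarrow> e31 a \<in> ?G"
      "vge (- 3/16) a \<Longrightarrow> e41 a \<in> ?G"
    "vge (10/16) a \<Longrightarrow> e12 a \<in> ?G" "vge (1/2) a \<Longrightarrow> e13 a \<in> ?G"
        "vge (13/16) a \<Longrightarrow> e14 a \<in> ?G"
    "vge (7/16) a \<Longrightarrow> e23 a \<in> ?G" "vge (11/16) a \<Longrightarrow> e32 a \<in> ?G" for a
    by ((rule incl[OF e_in_root_fil(1)] incl[OF e_in_root_fil(2)] incl[OF e_in_root_fil(3)]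
        incl[OF e_in_root_fil(4)] incl[OF e_in_root_fil(5)] incl[OF e_in_root_fil(6)]
        incl0[OF e_in_root_fil(7)] incl0[OF e_in_root_fil(8)]; auto simp: vge_iff roots0_def
            outer_roots[THEN DiffD1]))+
  have left: "h \<in> ?G" if "e ** h \<in> ?G" "e' \<in> ?G" "e' ** e = mat 1" for e e' h
    using gen[OF that(2,1)] by (simp add: matrix_mul_assoc that(3))
  have right: "h \<in> ?G" if "h ** e \<in> ?G" "e' \<in> ?G" "e ** e' = mat 1" for e e' h
    using gen[OF that(1,2)] by (simp add: matrix_mul_assoc[symmetric] that(3))
  have unit: "h$1$1 \<noteq> 0" "h$2$2 \<noteq> 0" "v (h$1$1) = 0" "v (h$2$2) = 0" if "h \<in> deep_gp"
      for h
    using deep_gp_entries(1,2)[OF that] unit_of_one_plus by force+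
  have quot: "vge r (x / h$1$1)" "vge r (x / h$2$2)" if "h \<in> deep_gp" "vge r x" for h r x
    using unit[OF that(1)] vge_divide[OF that(2)] by simp_all
  define g1 where "g1 = e21 (- (g$2$1 / g$1$1)) ** g"
  have g1: "g1 \<in> deep_gp"
    unfolding g1_def by (rule deep_gp_mult[OF e_deep_gp(1)[OF vge_minus[THEN iffD2, OF quot(1)[OF assms
        deep_gp_entries(6)[OF assms]]]] assms])
  have g1_zero: "g1$2$1 = 0"
    unfolding g1_def using unit[OF assms] by (simp_all add: e21_def mat4_simps)
  have g1_gen: "g1 \<in> ?G \<Longrightarrow> g \<in> ?G"
    unfolding g1_def by (erule left[OF _ e(1)[OF quot(1)[OF assms deep_gp_entries(6)[OF assms]]]
        e_cancel(1)])
  define g2 where "g2 = e31 (- (g1$3$1 / g1$1$1)) ** g1"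
  have g2: "g2 \<in> deep_gp"
    unfolding g2_def by (rule deep_gp_mult[OF e_deep_gp(2)[OF vge_minus[THEN iffD2, OF quot(1)[OF g1
        deep_gp_entries(7)[OF g1]]]] g1])
  have g2_zero: "g2$2$1 = 0" "g2$3$1 = 0"
    unfolding g2_def using unit[OF g1] g1_zero by (simp_all add: e31_def mat4_simps)
  have g2_gen: "g2 \<in> ?G \<Longrightarrow> g1 \<in> ?G"
    unfolding g2_def by (erule left[OF _ e(2)[OF quot(1)[OF g1 deep_gp_entries(7)[OF g1]]] e_cancel(2)])
  define g3 where "g3 = e41 (- (g2$4$1 / g2$1$1)) ** g2"
  have g3: "g3 \<in> deep_gp"
    unfolding g3_def by (rule deep_gp_mult[OF e_deep_gp(3)[OF vge_minus[THEN iffD2, OF quot(1)[OF g2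
        deep_gp_entries(8)[OF g2]]]] g2])
  have g3_zero: "g3$2$1 = 0" "g3$3$1 = 0" "g3$4$1 = 0"
    unfolding g3_def using unit[OF g2] g2_zero by (simp_all add: e41_def mat4_simps)
  have g3_gen: "g3 \<in> ?G \<Longrightarrow> g2 \<in> ?G"
    unfolding g3_def by (erule left[OF _ e(3)[OF quot(1)[OF g2 deep_gp_entries(8)[OF g2]]] e_cancel(3)])
  define g4 where "g4 = g3 ** e12 (- (g3$1$2 / g3$1$1))"
  have g4: "g4 \<in> deep_gp"
    unfolding g4_def by (rule deep_gp_mult[OF g3 e_deep_gp(4)[OF vge_minus[THEN iffD2, OF quot(1)[OF g3
        deep_gp_entries(3)[OF g3]]]]])
  have g4_zero: "g4$2$1 = 0" "g4$3$1 = 0" "g4$4$1 = 0" "g4$1$2 = 0"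
    unfolding g4_def using unit[OF g3] g3_zero by (simp_all add: e12_def mat4_simps)
  have g4_gen: "g4 \<in> ?G \<Longrightarrow> g3 \<in> ?G"
    unfolding g4_def by (erule right[OF _ e(4)[OF quot(1)[OF g3 deep_gp_entries(3)[OF g3]]] e_cancel(4)])
  define g5 where "g5 = g4 ** e13 (- (g4$1$3 / g4$1$1))"
  have g5: "g5 \<in> deep_gp"
    unfolding g5_def by (rule deep_gp_mult[OF g4 e_deep_gp(5)[OF vge_minus[THEN iffD2, OF quot(1)[OF g4
        deep_gp_entries(4)[OF g4]]]]])
  have g5_zero: "g5$2$1 = 0" "g5$3$1 = 0" "g5$4$1 = 0" "g5$1$2 = 0" "g5$1$3 = 0"
    unfolding g5_def using unit[OF g4] g4_zero by (simp_all add: e13_def mat4_simps)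
  have g5_gen: "g5 \<in> ?G \<Longrightarrow> g4 \<in> ?G"
    unfolding g5_def by (erule right[OF _ e(5)[OF quot(1)[OF g4 deep_gp_entries(4)[OF g4]]] e_cancel(5)])
  define g6 where "g6 = g5 ** e14 (- (g5$1$4 / g5$1$1))"
  have g6: "g6 \<in> deep_gp"
    unfolding g6_def by (rule deep_gp_mult[OF g5 e_deep_gp(6)[OF vge_minus[THEN iffD2, OF quot(1)[OF g5
        deep_gp_entries(5)[OF g5]]]]])
  have g6_zero: "g6$2$1 = 0" "g6$3$1 = 0" "g6$4$1 = 0" "g6$1$2 = 0" "g6$1$3 = 0" "g6$1$4 = 0"
    unfolding g6_def using unit[OF g5] g5_zero by (simp_all add: e14_def mat4_simps)
  have g6_gen: "g6 \<in> ?G \<Longrightarrow> g5 \<in> ?G"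
    unfolding g6_def by (erule right[OF _ e(6)[OF quot(1)[OF g5 deep_gp_entries(5)[OF g5]]] e_cancel(6)])
  \<comment> \<open>The rest of the first row and column is now zero, and the middle block is next.
    Its off-diagonal positions belong to the roots of \<open>G\<^sup>0\<close>, so the factors must
    have depth above 1/2.\<close>
  define g7 where "g7 = e32 (- (g6$3$2 / g6$2$2)) ** g6"
  have g7: "g7 \<in> deep_gp"
    unfolding g7_def by (rule deep_gp_mult[OF e_deep_gp(8)[OF vge_minus[THEN iffD2, OF quot(2)[OF g6
        deep_gp_entries(10)[OF g6]]]] g6])
  have g7_zero: "g7$2$1 = 0" "g7$3$1 = 0" "g7$4$1 = 0" "g7$1$2 = 0" "g7$1$3 = 0" "g7$1$4 = 0" "g7$3$2 = 0"
    unfolding g7_def using unit[OF g6] g6_zero by (simp_all add: e32_def mat4_simps)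
  have g7_gen: "g7 \<in> ?G \<Longrightarrow> g6 \<in> ?G"
    unfolding g7_def by (erule left[OF _ e(8)[OF quot(2)[OF g6 deep_gp_entries(10)[OF g6]]] e_cancel(8)])
  define g8 where "g8 = g7 ** e23 (- (g7$2$3 / g7$2$2))"
  have g8: "g8 \<in> deep_gp"
    unfolding g8_def by (rule deep_gp_mult[OF g7 e_deep_gp(7)[OF vge_minus[THEN iffD2, OF quot(2)[OF g7
        deep_gp_entries(9)[OF g7]]]]])
  have g8_zero: "g8$2$1 = 0" "g8$3$1 = 0" "g8$4$1 = 0" "g8$1$2 = 0" "g8$1$3 = 0" "g8$1$4 = 0" "g8$3$2 =
      0" "g8$2$3 = 0"
    unfolding g8_def using unit[OF g7] g7_zero by (simp_all add: e23_def mat4_simps)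
  have g8_gen: "g8 \<in> ?G \<Longrightarrow> g7 \<in> ?G"
    unfolding g8_def by (erule right[OF _ e(7)[OF quot(2)[OF g7 deep_gp_entries(9)[OF g7]]] e_cancel(7)])
  have u: "g8$1$1 \<noteq> 0" "g8$2$2 \<noteq> 0" using unit[OF g8] by auto
  \<comment> \<open>What remains of the last row and column was never cleared: the symplectic
    equations force it to vanish and determine the last two diagonal entries.\<close>
  have "g8 \<in> carrier Sp4" using g8 by (simp add: deep_gp_def)
  then have sp: "g8$1$1 * g8$4$2 = 0" "g8$1$1 * g8$4$3 = 0" "g8$1$1 * g8$4$4 = 1"
    "g8$2$2 * g8$3$3 = 1" "g8$2$2 * g8$3$4 = 0" "g8$3$3 * g8$2$4 = 0"
    using u unfolding carrier_Sp4_iff by (simp_all add: g8_zero)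
  then have "g8$4$2 = 0" "g8$4$3 = 0" "g8$3$4 = 0" "g8$2$4 = 0"
    "g8$4$4 = inverse (g8$1$1)" "g8$3$3 = inverse (g8$2$2)"
    using u by (auto simp: inverse_unique)
  then have "g8 = torus_elt (g8$1$1) (g8$2$2)"
    unfolding torus_elt_def by (simp add: mat4_simps g8_zero)
  moreover have "torus_elt (g8$1$1) (g8$2$2) \<in> torus_fil v (After (1/2))"
  proof -
    have "x \<in> val_ideal v (After (1/2))" if "vge (9/16) x" for x
      using that by (auto simp: val_ideal_def)
    then show ?thesis
      using u deep_gp_entries(1,2)[OF g8] unfolding torus_fil_def by blast
  qed
  ultimately have "g8 \<in> ?G" by (metis generate.incl yu_gensI(1))
  then show ?thesis by (intro g1_gen g2_gen g3_gen g4_gen g5_gen g6_gen g7_gen g8_gen)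
qed

end

section \<open>The groups of the Yu datum\<close>

locale ramified_setup =
  fixes v :: "'f::field \<Rightarrow> real" and \<pi> :: 'f and p :: nat
    and \<epsilon> :: "'f \<Rightarrow> 'e::field" and s :: 'e and w :: "'e \<Rightarrow> real"
  assumes local_field: "nonarch_local_field v" and res_char: "residue_char v p" and p_not_2: "p \<noteq> 2"
    and unif: "uniformizer v \<pi>" and sqrt_ext: "sqrt_extension v \<pi> \<epsilon> s w"
begin

sublocale valued v
  using local_field by unfold_locales (simp add: nonarch_local_field_def)

sublocale E: valued w
  using sqrt_ext by unfold_locales (simp add: sqrt_extension_def)

lemma v_int: "x \<noteq> 0 \<Longrightarrow> v x \<in> \<int>"
  using local_field unfolding nonarch_local_field_def by blast

text \<open>Valuations on \<open>F\<close> are integers, so a bound rounds up to an integer. This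
  turns depths in sixteenths into congruences for entries.\<close>

lemma vge_int: "vge r x \<Longrightarrow> of_int n - 1 < r \<Longrightarrow> vge (of_int n) x"
proof (cases "x = 0")
  case False
  assume "vge r x" "of_int n - 1 < r"
  then have "of_int n - 1 < v x" using False by (auto simp: vge_iff)
  moreover obtain m where "v x = of_int m" using v_int[OF False] by (auto elim: Ints_cases)
  ultimately show ?thesis by (simp add: vge_iff)
qed simp

lemma vge_1: "vge r x \<Longrightarrow> 0 < r \<Longrightarrow> vge 1 x" using vge_int[of x r 1] by simp
lemma vge_0: "vge r x \<Longrightarrow> - 1 < r \<Longrightarrow> vge 0 x" using vge_int[of x r 0] by simp

lemma max_ideal_iff: "x \<in> max_ideal v \<longleftrightarrow> vge 1 x"
proof
  assume "x \<in> max_ideal v"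
  then have "x = 0 \<or> vge (v x) x \<and> 0 < v x" by (auto simp: val_ideal_def)
  then show "vge 1 x" using vge_1 by auto
qed (auto simp: val_ideal_def)

lemma pi_nz [simp]: "\<pi> \<noteq> 0" and v_pi [simp]: "v \<pi> = 1"
  using unif by (auto simp: uniformizer_def)

lemma vge_pi: "vge r \<pi> \<longleftrightarrow> r \<le> 1" by (simp add: vge_iff)

lemma vge_one: "vge 0 1" by (simp add: vge_iff)

lemma not_vge_1_one: "\<not> vge 1 1" by (simp add: vge_iff)

lemma vge_of_nat: "vge 0 (of_nat n)"
  by (induction n) (auto intro: vge_add vge_one)

lemma two_unit: "(2 :: 'f) \<noteq> 0" "v 2 = 0"
proof -
  have p: "prime p" "vge 1 (of_nat p)"
    using res_char max_ideal_iff by (auto simp: residue_char_def)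
  have "odd p" using p p_not_2 prime_odd_nat prime_ge_2_nat by (metis le_neq_implies_less)
  then obtain k where k: "p = 2 * k + 1" by (elim oddE)
  have n: "\<not> vge 1 2"
  proof
    assume "vge 1 2"
    then have "vge 1 (2 * of_nat k)" using vge_mult'[of 2 1 "of_nat k" 0] vge_of_nat by simp
    then have "vge 1 (of_nat p - 2 * of_nat k)" using p vge_diff by blast
    then show False using not_vge_1_one by (simp add: k)
  qed
  then show 0: "(2 :: 'f) \<noteq> 0" by auto
  have "vge 0 2" using vge_of_nat[of 2] by simp
  then have "0 \<le> v 2" "v 2 < 1" using n 0 by (auto simp: vge_iff)
  then show "v 2 = 0" using v_int[OF 0] by (auto elim!: Ints_cases)
qed

lemma eps_one: "\<epsilon> 1 = 1" and eps_add: "\<epsilon> (x + y) = \<epsilon> x + \<epsilon> y" and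
    eps_mult: "\<epsilon> (x * y) = \<epsilon> x * \<epsilon> y"
  and s_sq: "s * s = \<epsilon> \<pi>" and w_eps: "x \<noteq> 0 \<Longrightarrow> w (\<epsilon> x) = v x"
  using sqrt_ext by (auto simp: sqrt_extension_def power2_eq_square)

lemma eps_zero [simp]: "\<epsilon> 0 = 0" by (metis add_0 add_cancel_right_right eps_add)

lemma eps_minus: "\<epsilon> (- x) = - \<epsilon> x" using eps_add[of x "- x"] by (simp add:
    eq_neg_iff_add_eq_0 add.commute)

lemma eps_diff: "\<epsilon> (x - y) = \<epsilon> x - \<epsilon> y" using eps_add[of x "- y"] by (simp
    add: eps_minus)

lemma eps_eq_0 [simp]: "\<epsilon> x = 0 \<longleftrightarrow> x = 0"
  using eps_mult[of x "inverse x"] by (cases "x = 0") (auto simp: eps_one)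

lemma eps_divide: "\<epsilon> (x / y) = \<epsilon> x / \<epsilon> y"
proof (cases "y = 0")
  case False
  then have "\<epsilon> (x / y) * \<epsilon> y = \<epsilon> x" using eps_mult[of "x / y" y] by simp
  then show ?thesis using False by (simp add: field_simps)
qed simp

lemma eps_numeral: "\<epsilon> 2 = 2"
  using eps_add[of 1 1] by (simp add: eps_one)

lemma eps_vge: "E.vge r (\<epsilon> x) \<longleftrightarrow> vge r x"
  by (cases "x = 0") (simp_all add: vge_iff E.vge_iff w_eps)

lemma s_nz [simp]: "s \<noteq> 0" using s_sq by auto

lemma w_s [simp]: "w s = 1 / 2"
  using E.v_mult[of s s] s_sq w_eps[of \<pi>] by simp

lemma two_E: "(2 :: 'e) \<noteq> 0" "w 2 = 0"
  using two_unit w_eps[of 2] eps_eq_0[of 2] by (simp_all add: eps_numeral)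

lemma map_eps_mult: "map_matrix \<epsilon> (A ** B) = map_matrix \<epsilon> A ** map_matrix \<epsilon>
    (B :: 'f mat4)"
  by (simp add: vec_eq_iff matrix_matrix_mult_def sum_4 eps_add eps_mult)

lemma map_eps_one: "map_matrix \<epsilon> (mat 1 :: 'f mat4) = mat 1"
  by (simp add: vec_eq_iff mat_def eps_one)

lemma map_eps_diff: "map_matrix \<epsilon> (A - B) = map_matrix \<epsilon> A - map_matrix \<epsilon> (B
    :: 'f mat4)"
  by (simp add: vec_eq_iff eps_diff)

lemma map_eps_Sp4: "g \<in> carrier Sp4 \<Longrightarrow> map_matrix \<epsilon> g \<in> carrier Sp4"
  unfolding carrier_Sp4_iff nth_map_matrix
  by (simp add: eps_mult[symmetric] eps_add[symmetric] eps_diff[symmetric] eps_minus eps_one)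

lemma map_eps_gl4: "map_matrix \<epsilon> A \<in> gl4_fil w (At d) \<longleftrightarrow> A \<in>
    gl4_fil v (At d)"
  unfolding gl4_At_iff E.gl4_At_iff by (simp add: eps_vge)

abbreviation c :: "'e mat4" where "c \<equiv> cayley s"

lemma c_Sp4: "c \<in> carrier Sp4"
  unfolding carrier_Sp4_iff by (simp add: cayley_def vector_4 two_E)

lemma c_inv: "sp_inv c = vector [vector [1, 0, 0, - s], vector [0, 1, 0, 0], vector [0, 0, 1, 0],
    vector [1 / (2 * s), 0, 0, 1 / 2]]"
  by (simp add: sp_inv_def cayley_def vector_4)

text \<open>The entries \<open>s\<close> and \<open>- 1 / (2 * s)\<close> have valuations 1/2 and
  -1/2, compensated exactly by the values of the long roots at their positions. Hence conjugation by
  \<open>cayley\<close> does not lower depths at \<open>x\<^sub>0\<close>.\<close>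

lemma c_gl4: "c \<in> gl4_fil w (At 0)"
  unfolding E.gl4_At_iff forall_4
  by (simp add: cayley_def vector_4 x0_wt_def E.vge_iff E.v_divide E.v_mult two_E)

section \<open>From generators over \<open>E\<close> to matrix entries over \<open>F\<close>\<close>

lemma conj_generate:
  fixes d :: "'e mat4"
  assumes "d \<in> carrier Sp4" "S \<subseteq> carrier Sp4" "x \<in> generate Sp4 S"
  shows "conj_by d x \<in> generate Sp4 (conj_by d ` S)"
  using assms(3)
proof (induction rule: generate.induct)
  case one
  then show ?case using assms generate.one[of Sp4] by (simp add: conj_by_eq sp_inv_right)
next
  case (incl h)
  then show ?case by (simp add: generate.incl)
next
  case (inv h)
  then have h: "h \<in> carrier Sp4" using assms by blast
  have "conj_by d (inv\<^bsub>Sp4\<^esub> h) = inv\<^bsub>Sp4\<^esub> (conj_by d h)"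
    using h assms(1) by (simp add: conj_by_eq inv_Sp4 sp_inv_mult matrix_mul_assoc)
  then show ?case using generate.inv[of "conj_by d h" "conj_by d ` S" Sp4] inv by simp
next
  case (eng h1 h2)
  have "conj_by d (h1 \<otimes>\<^bsub>Sp4\<^esub> h2) = conj_by d h1 \<otimes>\<^bsub>Sp4\<^esub>
      conj_by d h2"
    using assms(1) by (simp add: conj_by_eq matrix_mul_assoc sp_inv_cancel)
  then show ?case using generate.eng[OF eng.IH] by simp
qed

lemma yu_gens_Sp4: "yu_gens (u :: 'e \<Rightarrow> real) d d' \<subseteq> carrier Sp4"
  using root_fil_Sp4 roots0_subset torus_elt_Sp4 unfolding yu_gens_def torus_fil_def by blast

lemma yu_group_eq: "yu_group \<epsilon> s w d d' = {g \<in> carrier Sp4. map_matrix \<epsilon> g \<in>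
    generate Sp4 (conj_by c ` yu_gens w d d')}"
  unfolding yu_group_def twisted_points_def yu_gens_def ..

text \<open>The upper bound does not ask which products of generators are defined over
  \<open>F\<close>: the generators and their conjugates satisfy the congruences over
  \<open>E\<close>, and \<open>\<epsilon>\<close> preserves valuations.\<close>

lemma J_gp_subset: "J_gp \<epsilon> s w \<subseteq> cong_gp (1/4)"
proof
  fix g assume "g \<in> J_gp \<epsilon> s w"
  then have g: "g \<in> carrier Sp4" "map_matrix \<epsilon> g \<in> generate Sp4 (conj_by c ` yu_gens w
      (At (1/2)) (At (1/4)))"
    unfolding J_gp_def yu_group_eq by auto
  have "yu_gens w (At (1/2)) (At (1/4)) \<subseteq> E.cong_gp (1/4)"
    unfolding yu_gens_def
  proof (intro Un_least UN_least)
    show "torus_fil w (At (1/2)) \<subseteq> E.cong_gp (1/4)"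
      using E.torus_fil_mono[of "1/4" "1/2"] E.torus_fil_cong_gp[of "1/4"] by simp
    show "root_fil w \<alpha> (At (1/2)) \<subseteq> E.cong_gp (1/4)" if "\<alpha> \<in> roots0" for
        \<alpha>
      using E.root_fil_mono[of "1/4" "1/2" \<alpha>] E.root_fil_cong_gp[of \<alpha> "1/4"]
          roots0_subset that by auto
    show "root_fil w \<alpha> (At (1/4)) \<subseteq> E.cong_gp (1/4)" if "\<alpha> \<in> roots -
        roots0" for \<alpha>
      using E.root_fil_cong_gp[of \<alpha> "1/4"] that by simp
  qed
  then have "conj_by c ` yu_gens w (At (1/2)) (At (1/4)) \<subseteq> E.cong_gp (1/4)"
    using E.cong_gp_conj[OF c_Sp4 c_gl4] by blast
  then have "map_matrix \<epsilon> g \<in> E.cong_gp (1/4)"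
    using E.generate_cong_gp[OF _ _ g(2), of "1/4"] by simp
  then have "map_matrix \<epsilon> (g - mat 1) \<in> gl4_fil w (At (1/4))"
    by (simp add: E.cong_gp_def map_eps_diff map_eps_one)
  then show "g \<in> cong_gp (1/4)" using g by (simp add: cong_gp_def map_eps_gl4)
qed

lemma cong_gp_entries:
  assumes "g \<in> cong_gp (1/4)"
  shows "vge 1 (g$1$1 - 1)" "vge 1 (g$1$2)" "vge 1 (g$1$3)" "vge 1 (g$1$4)"
    "vge 0 (g$2$1)" "vge 1 (g$2$2 - 1)" "vge 1 (g$2$3)" "vge 1 (g$2$4)"
    "vge 1 (g$3$1)" "vge 1 (g$3$2)" "vge 1 (g$3$3 - 1)" "vge 1 (g$3$4)"
    "vge 0 (g$4$1)" "vge 1 (g$4$2)" "vge 0 (g$4$3)" "vge 1 (g$4$4 - 1)"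
proof -
  have "\<forall>i j. vge (1/4 - x0_wt i + x0_wt j) ((g - mat 1) $ i $ j)"
    using assms unfolding cong_gp_def gl4_At_iff by blast
  note * = this[unfolded forall_4, simplified, unfolded mat_def x0_wt_def, simplified]
  show "vge 1 (g$1$1 - 1)" "vge 1 (g$1$2)" "vge 1 (g$1$3)" "vge 1 (g$1$4)"
    "vge 0 (g$2$1)" "vge 1 (g$2$2 - 1)" "vge 1 (g$2$3)" "vge 1 (g$2$4)"
    "vge 1 (g$3$1)" "vge 1 (g$3$2)" "vge 1 (g$3$3 - 1)" "vge 1 (g$3$4)"
    "vge 0 (g$4$1)" "vge 1 (g$4$2)" "vge 0 (g$4$3)" "vge 1 (g$4$4 - 1)"
    using * by (auto elim: vge_0 vge_1)
qed

lemma cong_gpI: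
  assumes "g \<in> carrier Sp4"
    "vge 1 (g$1$1 - 1)" "vge 1 (g$1$2)" "vge 1 (g$1$3)" "vge 1 (g$1$4)"
    "vge 0 (g$2$1)" "vge 1 (g$2$2 - 1)" "vge 1 (g$2$3)" "vge 1 (g$2$4)"
    "vge 1 (g$3$1)" "vge 1 (g$3$2)" "vge 1 (g$3$3 - 1)" "vge 1 (g$3$4)"
    "vge 0 (g$4$1)" "vge 1 (g$4$2)" "vge 0 (g$4$3)" "vge 1 (g$4$4 - 1)"
  shows "g \<in> cong_gp (5/16)"
  using assms unfolding cong_gp_def gl4_At_iff forall_4
  by (simp add: mat_def x0_wt_def) (auto elim: vge_mono)

text \<open>From 1/4 on, the first depth that integral valuations realise is 5/16, attained by units
  at the positions (2,1) and (4,3).\<close>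

lemma cong_gp_jump: "cong_gp (1/4) = cong_gp (5/16)"
proof
  show "cong_gp (1/4) \<subseteq> cong_gp (5/16)"
    using cong_gpI cong_gp_entries by (auto simp: cong_gp_def)
  show "cong_gp (5/16) \<subseteq> cong_gp (1/4)"
    using gl4_mono[of _ "5/16" "1/4"] by (auto simp: cong_gp_def)
qed

section \<open>The functional \<open>X_fun\<close> on the congruence subgroup\<close>

lemma X_fun_add: "X_fun \<pi> (A + B) = X_fun \<pi> A + X_fun \<pi> B"
  by (simp add: X_fun_def algebra_simps)

lemma X_fun_eq: "X_fun \<pi> A = A$1$4 / \<pi> + A$4$1"
  by (simp add: X_fun_def divide_inverse mult.commute)

text \<open>\<open>X_fun\<close> lowers depth by 1/2. From 10/16 a positive valuation remains, which
  rounds up to 1.\<close>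

lemma X_fun_deep:
  assumes "A \<in> gl4_fil v (At (10/16))"
  shows "vge 1 (X_fun \<pi> A)"
proof -
  have "vge (9/8) (A$1$4)" "vge (1/8) (A$4$1)"
    using assms unfolding gl4_At_iff forall_4 by (simp_all add: x0_wt_def)
  then have "vge (1/8) (A$1$4 / \<pi> + A$4$1)"
    by (intro vge_add vge_divide[where r = "9/8"]) simp_all
  then show ?thesis unfolding X_fun_eq using vge_1 by simp
qed

text \<open>Here the jump matters: the cross term has depth 5/16 + 5/16, beyond 1/2, whereas the
  bound 1/4 + 1/4 would leave it visible to \<open>X_fun\<close>.\<close>

lemma X_fun_mult:
  assumes "g \<in> cong_gp (1/4)" "h \<in> cong_gp (1/4)"
  shows "vge 1 (X_fun \<pi> (g ** h - mat 1) - X_fun \<pi> (g - mat 1) - X_fun \<pi> (h - mat 1))"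
proof -
  have "g ** h - mat 1 = (g - mat 1) + (h - mat 1) + (g - mat 1) ** (h - mat 1)"
    by (simp add: mat_diff_ldistrib mat_diff_rdistrib)
  then have "X_fun \<pi> (g ** h - mat 1) - X_fun \<pi> (g - mat 1) - X_fun \<pi> (h - mat 1)
      = X_fun \<pi> ((g - mat 1) ** (h - mat 1))"
    by (simp only: X_fun_add) simp
  then show ?thesis
    using assms[unfolded cong_gp_jump] X_fun_deep[OF gl4_mult[of "g - mat 1" "5/16" "h - mat 1" "5/16"]]
    by (simp add: cong_gp_def)
qed

lemma X_fun_int:
  assumes "g \<in> cong_gp (1/4)"
  shows "vge 0 (X_fun \<pi> (g - mat 1))"
  unfolding X_fun_eq using cong_gp_entries[OF assms]
  by (intro vge_add vge_divide[where r = 1]) (simp_all add: mat_def)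

text \<open>Conjugation by \<open>cayley\<close> diagonalises the functional: \<open>s\<close> times
  X(A) becomes the difference of the last and the first diagonal entry. So divisibility of X(A) by
  \<open>\<pi>\<close> pushes the torus part beyond depth 1/2.\<close>

lemma conj_c_entries:
  fixes A :: "'f mat4"
  defines "B \<equiv> sp_inv c ** map_matrix \<epsilon> A ** c"
  shows "B$1$1 = (\<epsilon> (A$1$1 + A$4$4) - s * \<epsilon> (X_fun \<pi> A)) / 2"
    "B$4$4 = (\<epsilon> (A$1$1 + A$4$4) + s * \<epsilon> (X_fun \<pi> A)) / 2"
    "B$2$2 = \<epsilon> (A$2$2)" "B$3$3 = \<epsilon> (A$3$3)" "B$2$3 = \<epsilon> (A$2$3)" "B$3$2 =
        \<epsilon> (A$3$2)"
proof -
  have X: "s * \<epsilon> (X_fun \<pi> A) = \<epsilon> (A$1$4) / s + s * \<epsilon> (A$4$1)"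
    by (simp add: X_fun_def eps_add eps_divide inverse_eq_divide eps_mult eps_one s_sq[symmetric]
        field_simps)
  have four: "(4 :: 'e) \<noteq> 0" using two_E(1) by (metis mult_2 mult_eq_0_iff numeral_Bit0)
  show "B$1$1 = (\<epsilon> (A$1$1 + A$4$4) - s * \<epsilon> (X_fun \<pi> A)) / 2"
    "B$4$4 = (\<epsilon> (A$1$1 + A$4$4) + s * \<epsilon> (X_fun \<pi> A)) / 2"
    "B$2$2 = \<epsilon> (A$2$2)" "B$3$3 = \<epsilon> (A$3$3)" "B$2$3 = \<epsilon> (A$2$3)" "B$3$2 =
        \<epsilon> (A$3$2)"
    unfolding X B_def c_inv
    by (simp_all add: cayley_def matrix_matrix_mult_def sum_4 vector_4 eps_add field_simps two_E four)
qed

lemma deep_conj: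
  assumes g: "g \<in> cong_gp (1/4)" and X: "vge 1 (X_fun \<pi> (g - mat 1))"
  shows "conj_by (sp_inv c) (map_matrix \<epsilon> g) \<in> E.deep_gp"
proof -
  let ?A = "map_matrix \<epsilon> (g - mat 1)" and ?B = "conj_by (sp_inv c) (map_matrix \<epsilon> g) -
      mat 1"
  have gS: "g \<in> carrier Sp4" using g by (simp add: cong_gp_def)
  have B: "?B = sp_inv c ** ?A ** c"
    using c_Sp4 by (simp add: conj_by_eq map_eps_diff map_eps_one mat_diff_ldistrib mat_diff_rdistrib
        sp_inv_left)
  have "?A \<in> gl4_fil w (At (5/16))"
    using g unfolding cong_gp_jump map_eps_gl4 by (simp add: cong_gp_def)
  then have gl: "?B \<in> gl4_fil w (At (5/16))"
    unfolding B using c_gl4 E.gl4_sp_inv[OF c_gl4]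
    by (intro E.gl4_mult[where d = "5/16" and d' = 0] E.gl4_mult[where d = 0 and d' = "5/16"]) auto
  let ?a = "\<lambda>i j. (g - mat 1)$i$j"
  have entries: "?B$1$1 = (\<epsilon> (?a 1 1 + ?a 4 4) - s * \<epsilon> (X_fun \<pi> (g - mat 1))) / 2"
    "?B$4$4 = (\<epsilon> (?a 1 1 + ?a 4 4) + s * \<epsilon> (X_fun \<pi> (g - mat 1))) / 2"
    "?B$2$2 = \<epsilon> (?a 2 2)" "?B$3$3 = \<epsilon> (?a 3 3)" "?B$2$3 = \<epsilon> (?a 2 3)"
        "?B$3$2 = \<epsilon> (?a 3 2)"
    unfolding B by (rule conj_c_entries)+
  have a: "vge 1 (?a 1 1 + ?a 4 4)" "vge 1 (?a 2 2)" "vge 1 (?a 3 3)" "vge 1 (?a 2 3)" "vge 1 (?a 3 2)"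
    using cong_gp_entries[OF g] vge_add[of "g$1$1 - 1" 1 "g$4$4 - 1"] by (auto simp: mat_def algebra_simps)
  have sX: "E.vge 1 (s * \<epsilon> (X_fun \<pi> (g - mat 1)))"
    using X E.vge_mult'[of s "1/2" _ 1 1] by (simp add: eps_vge E.vge_iff[of s])
  have "E.vge 1 (?B$1$1)" "E.vge 1 (?B$4$4)"
    unfolding entries(1,2) using a(1) sX two_E
    by (auto intro!: E.vge_divide[where r = 1] E.vge_diff E.vge_add simp: eps_vge)
  moreover have "E.vge 1 (?B$2$2)" "E.vge 1 (?B$3$3)" "E.vge 1 (?B$2$3)" "E.vge 1 (?B$3$2)"
    unfolding entries using a by (simp_all add: eps_vge)
  ultimately have "?B \<in> E.deep_lat"
    unfolding E.deep_lat_def using gl E.vge_mono[of _ 1] by simp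
  then show ?thesis
    using map_eps_Sp4[OF gS] c_Sp4 by (simp add: E.deep_gp_def conj_by_eq)
qed

text \<open>The lower bound: \<open>deep_conj\<close> moves the element to the frame of the diagonal
  torus, elimination applies there, and \<open>conj_generate\<close> brings the factors
  back.\<close>

lemma J_plus_plus_superset:
  assumes "g \<in> cong_gp (1/4)" "vge 1 (X_fun \<pi> (g - mat 1))"
  shows "g \<in> J_plus_plus \<epsilon> s w"
proof -
  have g: "g \<in> carrier Sp4" using assms by (simp add: cong_gp_def)
  have "conj_by c (conj_by (sp_inv c) (map_matrix \<epsilon> g))
      \<in> generate Sp4 (conj_by c ` yu_gens w (After (1/2)) (After (1/4)))"
    by (intro conj_generate c_Sp4 yu_gens_Sp4 E.deep_gp_generated deep_conj assms)
  then show ?thesis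
    using c_Sp4 g unfolding J_plus_plus_def yu_group_eq
    by (simp add: conj_by_eq matrix_mul_assoc sp_inv_cancel sp_inv_right)
qed

end

context ramified_setup
begin

text \<open>Cayley parametrization of the norm-one torus, which avoids extracting square roots.\<close>

definition u1_param :: "'f \<Rightarrow> 'f mat4" where
  "u1_param t = G0_elt \<pi> ((1 + t ^ 2 / \<pi>) / (1 - t ^ 2 / \<pi>)) (2 * t / (1 - t ^ 2 / \<pi>))
      (mat 1)"

lemma u1_denominator:
  assumes "vge 1 t"
  shows "vge 1 (t ^ 2 / \<pi>)" "1 - t ^ 2 / \<pi> \<noteq> 0" "v (1 - t ^ 2 / \<pi>) = 0"
proof -
  show 1: "vge 1 (t ^ 2 / \<pi>)"
    using vge_divide[OF vge_mult[OF assms assms], of \<pi> 1] by (simp add: power2_eq_square)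
  show "1 - t ^ 2 / \<pi> \<noteq> 0" "v (1 - t ^ 2 / \<pi>) = 0"
    using unit_of_one_plus[of "1 - t ^ 2 / \<pi>" 1] 1 by simp_all
qed

lemma u1_norm:
  assumes "vge 1 t"
  shows "((1 + t ^ 2 / \<pi>) / (1 - t ^ 2 / \<pi>)) ^ 2 - (2 * t / (1 - t ^ 2 / \<pi>)) ^ 2 * inverse
      \<pi> = 1"
proof -
  have "(1 + t ^ 2 / \<pi>) ^ 2 - (2 * t) ^ 2 * inverse \<pi> = (1 - t ^ 2 / \<pi>) ^ 2"
    by (simp add: power2_eq_square divide_inverse algebra_simps)
  then have "((1 + t ^ 2 / \<pi>) ^ 2 - (2 * t) ^ 2 * inverse \<pi>) / (1 - t ^ 2 / \<pi>) ^ 2 = 1"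
    using u1_denominator(2)[OF assms] by simp
  then show ?thesis by (simp add: power_divide diff_divide_distrib)
qed

lemma u1_entries:
  assumes "vge 1 t"
  shows "vge 1 ((1 + t ^ 2 / \<pi>) / (1 - t ^ 2 / \<pi>) - 1)"
    "vge 2 (2 * t / (1 - t ^ 2 / \<pi>) - 2 * t)"
    "vge 1 (2 * t / (1 - t ^ 2 / \<pi>))"
proof -
  note d = u1_denominator[OF assms]
  have tt: "vge 1 (2 * t)" using assms two_unit vge_mult'[of 2 0 t 1] by (simp add: vge_iff[of 2])
  define q where "q = t ^ 2 / \<pi>"
  have d: "vge 1 q" "1 - q \<noteq> 0" "v (1 - q) = 0" using d by (simp_all add: q_def)
  have "(1 + q) / (1 - q) - 1 = 2 * q / (1 - q)"
    using d(2) by (simp add: divide_diff_eq_iff)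
  moreover have "vge 1 (2 * q)"
    using d(1) two_unit vge_mult'[of 2 0 q 1] by (simp add: vge_iff[of 2])
  ultimately show "vge 1 ((1 + t ^ 2 / \<pi>) / (1 - t ^ 2 / \<pi>) - 1)"
    using vge_divide[of _ 1 "1 - q" 1] d unfolding q_def[symmetric] by simp
  have "2 * t / (1 - q) - 2 * t = 2 * t * q / (1 - q)"
    using d(2) by (simp add: divide_diff_eq_iff algebra_simps)
  moreover have "vge 2 (2 * t * q)"
    using vge_mult'[OF tt d(1)] by simp
  ultimately show "vge 2 (2 * t / (1 - t ^ 2 / \<pi>) - 2 * t)"
    using vge_divide[of _ 2 "1 - q" 2] d unfolding q_def[symmetric] by simp
  show "vge 1 (2 * t / (1 - t ^ 2 / \<pi>))"
    using vge_divide[OF tt d(2), of 1] d unfolding q_def[symmetric] by simp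
qed

lemma u1_param_K0:
  assumes "vge 1 t"
  shows "u1_param t \<in> K0 v \<pi>"
  unfolding u1_param_def K0_def mem_Collect_eq
  by (intro exI conjI, rule refl)
    (use u1_norm[OF assms] u1_entries(1)[OF assms] vge_one not_vge_1_one
      in \<open>auto simp: mat_def det_2 max_ideal_iff\<close>)

lemma G0_elt_Sp4:
  assumes "a ^ 2 - b ^ 2 * inverse \<pi> = 1" "det h = 1"
  shows "G0_elt \<pi> a b h \<in> carrier Sp4"
  using assms unfolding carrier_Sp4_iff G0_elt_def det_2
  by (simp add: vector_4 power2_eq_square algebra_simps)

lemma u1_param_Sp4: "vge 1 t \<Longrightarrow> u1_param t \<in> carrier Sp4"
  unfolding u1_param_def by (rule G0_elt_Sp4[OF u1_norm]) simp_all

lemma u1_param_cong: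
  assumes "vge 1 t"
  shows "u1_param t \<in> cong_gp (1/4)"
proof -
  have "vge 0 (2 * t / (1 - t ^ 2 / \<pi>) * inverse \<pi>)"
    using vge_divide[OF u1_entries(3)[OF assms], of \<pi> 0] by (simp add: divide_inverse)
  then show ?thesis
    unfolding cong_gp_jump using u1_param_Sp4[OF assms] u1_entries(1,3)[OF assms]
    by (intro cong_gpI) (simp_all add: u1_param_def G0_elt_def vector_4 mat_def)
qed

text \<open>With \<open>b\<close> the (1,4) entry, the positions (1,4) and (4,1) each contribute
  \<open>b / \<pi>\<close>, and \<open>b\<close> agrees with \<open>2 * t\<close> up to valuation 2.
  Hence the factor 4.\<close>

lemma u1_param_X:
  assumes "vge 1 t"
  shows "vge 1 (X_fun \<pi> (u1_param t - mat 1) - 4 * t / \<pi>)"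
proof -
  let ?b = "2 * t / (1 - t ^ 2 / \<pi>)"
  have "X_fun \<pi> (u1_param t - mat 1) - 4 * t / \<pi> = 2 * (?b - 2 * t) / \<pi>"
    by (simp add: X_fun_def u1_param_def G0_elt_def vector_4 mat_def divide_inverse algebra_simps)
  moreover have "vge 2 (2 * (?b - 2 * t))"
    using u1_entries(2)[OF assms] two_unit vge_mult'[of 2 0 "?b - 2 * t" 2] by (simp add: vge_iff[of 2])
  ultimately show ?thesis using vge_divide[of _ 2 \<pi> 1] by simp
qed

lemma conj_torus:
  "c ** torus_elt z 1 ** sp_inv c = vector [vector [(z + inverse z) / 2, 0, 0, - s * (z - inverse z) / 2],
     vector [0, 1, 0, 0], vector [0, 0, 1, 0],
     vector [- s * (z - inverse z) / 2 * inverse (s * s), 0, 0, (z + inverse z) / 2]]"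
proof -
  define i where "i = inverse z"
  have four: "(4 :: 'e) \<noteq> 0" using two_E(1) by (metis mult_2 mult_eq_0_iff numeral_Bit0)
  show ?thesis
    unfolding torus_elt_def i_def[symmetric] unfolding c_inv unfolding cayley_def
    by (simp add: vec_eq_iff forall_4 matrix_matrix_mult_def sum_4 vector_4)
      (simp add: field_simps two_E four)
qed

lemma eps_inverse_pi: "\<epsilon> (inverse \<pi>) = inverse (s * s)"
  using eps_divide[of 1 \<pi>] by (simp add: eps_one s_sq inverse_eq_divide)

lemma map_G0_elt:
  "map_matrix \<epsilon> (G0_elt \<pi> a b (mat 1)) = vector [vector [\<epsilon> a, 0, 0, \<epsilon>
      b], vector [0, 1, 0, 0],
     vector [0, 0, 1, 0], vector [\<epsilon> b * inverse (s * s), 0, 0, \<epsilon> a]]"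
  by (simp add: vec_eq_iff forall_4 G0_elt_def vector_4 mat_def eps_one eps_mult[of _ "inverse \<pi>"]
      eps_inverse_pi)

lemma u1_param_eps:
  assumes "vge 1 t"
  shows "\<exists>z. z \<noteq> 0 \<and> E.vge (1/2) (z - 1) \<and> map_matrix \<epsilon> (u1_param t)
      = conj_by c (torus_elt z 1)"
proof -
  define \<tau> where "\<tau> = \<epsilon> t / s"
  have tau: "E.vge (1/2) \<tau>"
    unfolding \<tau>_def using assms by (intro E.vge_divide[where r = 1]) (auto simp: eps_vge)
  have tau2: "\<epsilon> (t ^ 2 / \<pi>) = \<tau> ^ 2" "\<epsilon> t = \<tau> * s"
    by (simp_all add: \<tau>_def eps_divide eps_mult power2_eq_square s_sq[symmetric])
  have m: "1 - \<tau> \<noteq> 0" using E.unit_of_one_plus[of "1 - \<tau>" "1/2"] tau by simp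
  have pl: "1 + \<tau> \<noteq> 0" "w (1 + \<tau>) = 0" using E.unit_of_one_plus[of "1 + \<tau>" "1/2"]
      tau by simp_all
  have dd: "(1 - \<tau>) * (1 + \<tau>) = 1 - \<tau> ^ 2" by (simp add: power2_eq_square algebra_simps)
  then have d: "1 - \<tau> ^ 2 \<noteq> 0" using m pl by (metis mult_eq_0_iff)
  \<comment> \<open>Galois conjugation sends \<open>s\<close> to \<open>- s\<close>, hence
    \<open>\<tau>\<close> to \<open>- \<tau>\<close> and this quotient to its inverse, as it must
    for an element of norm one.\<close>
  define z where "z = (1 - \<tau>) / (1 + \<tau>)"
  have iz: "inverse z = (1 + \<tau>) / (1 - \<tau>)" by (simp add: z_def)
  have z: "z + inverse z = 2 * ((1 + \<tau> ^ 2) / (1 - \<tau> ^ 2))" "z - inverse z = - 2 * (2 *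
      \<tau> / (1 - \<tau> ^ 2))"
    unfolding iz unfolding z_def using m pl
    by (simp_all add: add_frac_eq diff_frac_eq dd[symmetric] power2_eq_square algebra_simps)
  have half: "2 * x / 2 = x" for x :: 'e using two_E by simp
  have ea: "\<epsilon> ((1 + t ^ 2 / \<pi>) / (1 - t ^ 2 / \<pi>)) = (z + inverse z) / 2"
    unfolding z half by (simp add: eps_divide[of _ "1 - t ^ 2 / \<pi>"] eps_add eps_diff eps_one tau2)
  have eb: "\<epsilon> (2 * t / (1 - t ^ 2 / \<pi>)) = - s * (z - inverse z) / 2"
  proof -
    have "- s * (z - inverse z) / 2 = 2 * (s * (2 * \<tau> / (1 - \<tau> ^ 2))) / 2" unfolding z by simp
    then show ?thesis
      unfolding half by (simp add: eps_divide[of _ "1 - t ^ 2 / \<pi>"] eps_mult eps_diff eps_one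
          eps_numeral tau2)
  qed
  have "map_matrix \<epsilon> (u1_param t) = c ** torus_elt z 1 ** sp_inv c"
    unfolding u1_param_def map_G0_elt ea eb conj_torus ..
  moreover have "z \<noteq> 0" using m pl by (simp add: z_def)
  moreover have "E.vge (1/2) (z - 1)"
  proof -
    have "z - 1 = - 2 * \<tau> / (1 + \<tau>)" using pl by (simp add: z_def divide_diff_eq_iff)
    moreover have "E.vge (1/2) (- 2 * \<tau>)"
      using tau two_E E.vge_mult'[of "- 2" 0 \<tau> "1/2"] by (simp add: E.vge_iff[of 2])
    ultimately show ?thesis using E.vge_divide[of "- 2 * \<tau>" "1/2" "1 + \<tau>"] pl by simp
  qed
  ultimately show ?thesis using c_Sp4 by (auto simp: conj_by_eq)
qed

lemma u1_param_G0_fil: "vge 1 t \<Longrightarrow> u1_param t \<in> G0_fil \<epsilon> s w (At (1/2))"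
proof -
  assume t: "vge 1 t"
  then obtain z where z: "z \<noteq> 0" "E.vge (1/2) (z - 1)" "map_matrix \<epsilon> (u1_param t) =
      conj_by c (torus_elt z 1)"
    using u1_param_eps by blast
  then have "torus_elt z 1 \<in> torus_fil w (At (1/2))"
    unfolding torus_fil_def by force
  then show ?thesis
    unfolding G0_fil_def twisted_points_def using z(3) u1_param_Sp4[OF t] by (auto intro!: generate.incl)
qed

lemma yu_gens_mono: "J_plus_plus \<epsilon> s w \<subseteq> J_plus \<epsilon> s w" "J_plus \<epsilon> s
    w \<subseteq> J_gp \<epsilon> s w"
  "G0_fil \<epsilon> s w (At (1/2)) \<subseteq> J_plus \<epsilon> s w"
proof -
  have m: "generate Sp4 (conj_by c ` A) \<subseteq> generate Sp4 (conj_by c ` B)" if "A \<subseteq> B"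
      for A B
    using that by (intro Sp4.mono_generate image_mono)
  have r: "val_ideal w (After x) \<subseteq> val_ideal w (At x)" "gl4_fil w (After x) \<subseteq>
      gl4_fil w (At x)" for x
    by (auto simp: val_ideal_def gl4_fil_def intro: less_imp_le)
  have t: "torus_fil w (After x) \<subseteq> torus_fil w (At x)" "root_fil w \<alpha> (After x)
      \<subseteq> root_fil w \<alpha> (At x)" for x \<alpha>
    unfolding torus_fil_def root_fil_def using r by blast+
  have y: "yu_gens w (After (1/2)) (After (1/4)) \<subseteq> yu_gens w (At (1/2)) (After (1/4))"
    "yu_gens w (At (1/2)) (After (1/4)) \<subseteq> yu_gens w (At (1/2)) (At (1/4))"
    unfolding yu_gens_def by (intro Un_mono UN_mono order_refl t)+
  have y3: "torus_fil w (At (1/2)) \<union> (\<Union>\<alpha>\<in>roots0. root_fil w \<alpha> (At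
      (1/2))) \<subseteq> yu_gens w (At (1/2)) (After (1/4))"
    unfolding yu_gens_def by (rule Un_upper1)
  note * = y(1)[THEN m] y(2)[THEN m] y3[THEN m]
  show "J_plus_plus \<epsilon> s w \<subseteq> J_plus \<epsilon> s w"
    unfolding J_plus_plus_def J_plus_def yu_group_eq using *(1) by auto
  show "J_plus \<epsilon> s w \<subseteq> J_gp \<epsilon> s w"
    unfolding J_gp_def J_plus_def yu_group_eq using *(2) by auto
  show "G0_fil \<epsilon> s w (At (1/2)) \<subseteq> J_plus \<epsilon> s w"
    unfolding G0_fil_def twisted_points_def J_plus_def yu_group_eq using *(3) by auto
qed

text \<open>Modulo the maximal ideal, X(g - 1) already takes every residue on the norm-one torus.
  Since 4 is a unit, \<open>t\<close> can be chosen to match \<open>g\<close>; the quotient then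
  meets the condition of \<open>J_plus_plus_superset\<close>.\<close>

lemma cong_gp_factor:
  assumes "g \<in> cong_gp (1/4)"
  obtains t g1 where "vge 1 t" "g = u1_param t ** g1" "g1 \<in> J_plus_plus \<epsilon> s w"
    "vge 1 (X_fun \<pi> (g - mat 1) - 4 * t / \<pi>)"
proof -
  have four: "(4 :: 'f) = 2 * 2" by simp
  define t where "t = \<pi> * X_fun \<pi> (g - mat 1) / 4"
  have v4: "(4 :: 'f) \<noteq> 0" "v 4 = 0" using two_unit four v_mult[of 2 2] by (metis mult_eq_0_iff
      add_0)+
  have t: "vge 1 t"
    unfolding t_def using X_fun_int[OF assms] v4 vge_mult'[of \<pi> 1 "X_fun \<pi> (g - mat 1)" 0 1]
    by (intro vge_divide[where r = 1]) (simp_all add: vge_pi)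
  have tX: "4 * t / \<pi> = X_fun \<pi> (g - mat 1)" using v4 by (simp add: t_def)
  define g1 where "g1 = sp_inv (u1_param t) ** g"
  have g: "g = u1_param t ** g1"
    unfolding g1_def using u1_param_Sp4[OF t] by (simp add: sp_inv_cancel)
  have g1: "g1 \<in> cong_gp (1/4)"
    unfolding g1_def by (intro cong_gp_mult cong_gp_sp_inv u1_param_cong t assms) simp_all
  have "vge 1 (X_fun \<pi> (g - mat 1) - X_fun \<pi> (u1_param t - mat 1) - X_fun \<pi> (g1 - mat 1))"
    using X_fun_mult[OF u1_param_cong[OF t] g1] g by simp
  from vge_add[OF this u1_param_X[OF t]] have "vge 1 (- X_fun \<pi> (g1 - mat 1))"
    unfolding tX by simp
  then have "g1 \<in> J_plus_plus \<epsilon> s w" using J_plus_plus_superset[OF g1] by simp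
  then show ?thesis using that[OF t g] tX by simp
qed

section \<open>Identification of \<open>J_plus\<close> and \<open>J_gp\<close>\<close>

lemma J_plus_mult: "x \<in> J_plus \<epsilon> s w \<Longrightarrow> y \<in> J_plus \<epsilon> s w
    \<Longrightarrow> x ** y \<in> J_plus \<epsilon> s w"
  unfolding J_plus_def yu_group_eq
  using generate.eng[of "map_matrix \<epsilon> x" Sp4 _ "map_matrix \<epsilon> y"] by (simp add:
      map_eps_mult)

lemma J_plus_eq: "J_plus \<epsilon> s w = cong_gp (1/4)" and J_gp_eq: "J_gp \<epsilon> s w = cong_gp (1/4)"
proof -
  have "cong_gp (1/4) \<subseteq> J_plus \<epsilon> s w"
  proof
    fix g assume "g \<in> cong_gp (1/4)"
    then show "g \<in> J_plus \<epsilon> s w"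
      by (elim cong_gp_factor) (use J_plus_mult u1_param_G0_fil yu_gens_mono in blast)
  qed
  then show "J_plus \<epsilon> s w = cong_gp (1/4)" "J_gp \<epsilon> s w = cong_gp (1/4)"
    using yu_gens_mono J_gp_subset by auto
qed

end

section \<open>The compact open subgroups\<close>

context ramified_setup
begin

lemma vge_1_0: "vge 1 x \<Longrightarrow> vge 0 x"
  by (erule vge_mono) simp

lemma vge_0_mult: "vge 0 x \<Longrightarrow> vge 0 y \<Longrightarrow> vge 0 (x * y)"
  using vge_mult'[of x 0 y 0 0] by simp

lemma vge_1_mult: "vge 1 x \<Longrightarrow> vge 0 y \<Longrightarrow> vge 1 (x * y)" "vge 0 x
    \<Longrightarrow> vge 1 y \<Longrightarrow> vge 1 (x * y)"
  using vge_mult'[of x 1 y 0 1] vge_mult'[of x 0 y 1 1] by simp_all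

lemma vge_1_mult_minus_one: "vge 1 (x - 1) \<Longrightarrow> vge 1 (y - 1) \<Longrightarrow> vge 1 (x *
    y - 1)"
proof -
  assume "vge 1 (x - 1)" "vge 1 (y - 1)"
  moreover have "x * y - 1 = (x - 1) + (y - 1) + (x - 1) * (y - 1)" by (simp add: algebra_simps)
  ultimately show ?thesis using vge_1_mult(1)[of "x - 1" "y - 1"] vge_1_0 vge_add by metis
qed

lemma vge_0_of_1: "vge 1 (x - 1) \<Longrightarrow> vge 0 x"
  using vge_add[of "x - 1" 0 1] vge_1_0 vge_one by simp

lemma unit_val: "vge 0 x \<Longrightarrow> \<not> vge 1 x \<Longrightarrow> x \<noteq> 0 \<and> v x = 0"
  using vge_1[of x "v x"] by (cases "0 < v x") (auto simp: vge_iff)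

lemma vge_0_divide: "vge 0 x \<Longrightarrow> vge 0 y \<Longrightarrow> \<not> vge 1 y
    \<Longrightarrow> vge 0 (x / y)"
  using unit_val[of y] vge_divide[of x 0 y 0] by auto

lemma vge_1_divide: "vge 1 x \<Longrightarrow> vge 0 y \<Longrightarrow> \<not> vge 1 y
    \<Longrightarrow> vge 1 (x / y)"
  using unit_val[of y] vge_divide[of x 1 y 1] by auto

lemma not_vge_1_mult: "vge 0 x \<Longrightarrow> \<not> vge 1 x \<Longrightarrow> vge 0 y
    \<Longrightarrow> \<not> vge 1 y \<Longrightarrow> \<not> vge 1 (x * y)"
  using unit_val[of x] unit_val[of y] by (simp add: vge_iff[of "x * y"] v_mult)

lemma not_vge_1_diff: "vge 1 (x - y) \<Longrightarrow> vge 1 x \<longleftrightarrow> vge 1 y"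
  using vge_diff[of x 1 "x - y"] vge_add[of "x - y" 1 y] by (metis diff_add_cancel diff_diff_eq2
      add_diff_cancel_left')

text \<open>\<open>K\<^sub>x\<^sub>0\<close> in terms of matrix entries; see \<open>K_gp_eq\<close>.\<close>

definition KP :: "'f mat4 set" where
  "KP = {g \<in> carrier Sp4.
     vge 1 (g$1$1 - 1) \<and> vge 1 (g$1$2) \<and> vge 1 (g$1$3) \<and> vge 1 (g$1$4) \<and>
     vge 0 (g$2$1) \<and> vge 0 (g$2$2) \<and> vge 0 (g$2$3) \<and> vge 1 (g$2$4) \<and>
     vge 1 (g$3$1) \<and> vge 1 (g$3$2) \<and> vge 0 (g$3$3) \<and> vge 1 (g$3$4) \<and>
     vge 0 (g$4$1) \<and> vge 1 (g$4$2) \<and> vge 0 (g$4$3) \<and> vge 1 (g$4$4 - 1)}"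

lemma KP_mult:
  assumes "g \<in> KP" "h \<in> KP"
  shows "g ** h \<in> KP"
proof -
  have g: "vge 0 (g$1$1)" "vge 0 (g$4$4)" "vge 0 (h$1$1)" "vge 0 (h$4$4)"
    using assms vge_0_of_1 by (simp_all add: KP_def)
  have d: "vge 1 (g$1$1 * h$1$1 - 1)" "vge 1 (g$4$4 * h$4$4 - 1)"
    using assms vge_1_mult_minus_one by (simp_all add: KP_def)
  have e: "(g ** h)$1$1 - 1 = (g$1$1 * h$1$1 - 1) + g$1$2 * h$2$1 + g$1$3 * h$3$1 + g$1$4 * h$4$1"
    "(g ** h)$4$4 - 1 = g$4$1 * h$1$4 + g$4$2 * h$2$4 + g$4$3 * h$3$4 + (g$4$4 * h$4$4 - 1)"
    by (simp_all add: matrix_matrix_mult_def sum_4)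
  have "g ** h \<in> carrier Sp4" using assms by (simp add: KP_def)
  moreover have "vge 1 ((g ** h)$1$1 - 1)" "vge 1 ((g ** h)$4$4 - 1)"
    unfolding e using assms g d by (simp_all add: KP_def vge_add vge_1_mult vge_1_0)
  ultimately show ?thesis using assms g
    unfolding KP_def by (simp add: matrix_matrix_mult_def sum_4 vge_add vge_0_mult vge_1_mult vge_1_0)
qed

lemma KP_sp_inv: "g \<in> KP \<Longrightarrow> sp_inv g \<in> KP"
  unfolding KP_def mem_Collect_eq by (intro conjI sp_inv_closed) (simp_all add: sp_inv_def vector_4)

lemma KP_one: "mat 1 \<in> KP"
  unfolding KP_def mem_Collect_eq by (intro conjI Sp4_one_closed) (simp_all add: mat_def vge_one)

lemma KP_gl4: "g \<in> KP \<Longrightarrow> g \<in> gl4_fil v (At 0)"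
  unfolding KP_def gl4_At_iff forall_4 x0_wt_def using vge_0_of_1 by (auto elim: vge_mono)

lemma cong_gp_KP: "cong_gp (1/4) \<subseteq> KP"
  using cong_gp_entries unfolding KP_def by (auto simp: cong_gp_def vge_1_0 vge_0_of_1)

text \<open>From a^2 - 1 = b^2 / \<pi> one gets 2 v(b) - 1 \<ge> 1 for nonzero b.\<close>

lemma vge_1_of_norm:
  assumes "a ^ 2 - b ^ 2 * inverse \<pi> = 1" "vge 1 (a - 1)"
  shows "vge 1 b"
proof (cases "b = 0")
  case False
  have "vge 1 (a * a - 1)" using assms vge_1_mult_minus_one by blast
  moreover have "a * a - 1 = b * b / \<pi>" using assms(1) by (simp add: power2_eq_square
      divide_inverse algebra_simps)
  ultimately have "1 \<le> v (b * b / \<pi>)" using False by (auto simp: vge_iff)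
  then show ?thesis using False by (simp add: v_divide v_mult vge_iff)
qed simp

text \<open>The compact open subgroup of \<open>G\<^sup>0\<close> with \<open>SL\<^sub>2\<close>-component \<open>SL\<^sub>2(O\<^sub>F)\<close> and the same
  \<open>U(1)\<close>-component as \<open>K\<^sup>0\<close>. It is the union of \<open>K\<^sup>0\<close> and \<open>K\<^sup>0 s K\<^sup>0\<close>.\<close>

definition KM :: "'f mat4 set" where
  "KM = {g \<in> carrier Sp4. g$1$2 = 0 \<and> g$1$3 = 0 \<and> g$2$1 = 0 \<and> g$2$4 = 0 \<and> g$3$1
      = 0 \<and> g$3$4 = 0 \<and>
     g$4$2 = 0 \<and> g$4$3 = 0 \<and> g$4$4 = g$1$1 \<and> g$4$1 = g$1$4 / \<pi> \<and> vge 1 (g$1$1 -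
         1) \<and>
     vge 0 (g$2$2) \<and> vge 0 (g$2$3) \<and> vge 0 (g$3$2) \<and> vge 0 (g$3$3)}"

lemma KM_norm:
  assumes "g \<in> KM"
  shows "g$1$1 ^ 2 - g$1$4 ^ 2 * inverse \<pi> = 1" "g$2$2 * g$3$3 - g$2$3 * g$3$2 = 1" "vge 1 (g$1$4)"
    "vge 0 (g$1$4 / \<pi>)"
proof -
  have "g$1$1 * g$1$1 - g$1$4 / \<pi> * g$1$4 = 1" "- (g$2$2 * g$3$3) + g$3$2 * g$2$3 = - 1"
    using assms unfolding KM_def carrier_Sp4_iff by auto
  then show 1: "g$1$1 ^ 2 - g$1$4 ^ 2 * inverse \<pi> = 1" "g$2$2 * g$3$3 - g$2$3 * g$3$2 = 1"
    by (simp_all add: power2_eq_square divide_inverse algebra_simps)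
  show "vge 1 (g$1$4)" using vge_1_of_norm[OF 1(1)] assms by (simp add: KM_def)
  then show "vge 0 (g$1$4 / \<pi>)" using vge_divide[of _ 1 \<pi> 0] by simp
qed

lemma KM_eq: "KM = {G0_elt \<pi> a b h | a b h. a ^ 2 - b ^ 2 * inverse \<pi> = 1 \<and> vge 1 (a - 1)
    \<and> det h = 1 \<and>
    vge 0 (h$1$1) \<and> vge 0 (h$1$2) \<and> vge 0 (h$2$1) \<and> vge 0 (h$2$2)}" (is "_ = ?S")
proof
  show "?S \<subseteq> KM"
  proof
    fix g assume "g \<in> ?S"
    then obtain a b h where g: "g = G0_elt \<pi> a b h" "a ^ 2 - b ^ 2 * inverse \<pi> = 1" "vge 1 (a -
        1)" "det h = 1"
      "vge 0 (h$1$1)" "vge 0 (h$1$2)" "vge 0 (h$2$1)" "vge 0 (h$2$2)" by auto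
    moreover have "g \<in> carrier Sp4" using g G0_elt_Sp4 by blast
    ultimately show "g \<in> KM" unfolding KM_def by (simp add: G0_elt_def vector_4 divide_inverse)
  qed
  show "KM \<subseteq> ?S"
  proof
    fix g assume g: "g \<in> KM"
    define h :: "'f^2^2" where "h = vector [vector [g$2$2, g$2$3], vector [g$3$2, g$3$3]]"
    have h: "h$1$1 = g$2$2" "h$1$2 = g$2$3" "h$2$1 = g$3$2" "h$2$2 = g$3$3"
      by (simp_all add: h_def)
    have "g = G0_elt \<pi> (g$1$1) (g$1$4) h"
      using g unfolding KM_def by (simp add: vec_eq_iff forall_4 G0_elt_def vector_4 h divide_inverse)
    moreover have "det h = 1" using KM_norm(2)[OF g] by (simp add: det_2 h)
    ultimately show "g \<in> ?S"
      using KM_norm[OF g] g unfolding mem_Collect_eq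
      by (intro exI[of _ "g$1$1"] exI[of _ "g$1$4"] exI[of _ h]) (simp add: h KM_def)
  qed
qed

lemma K0_eq: "K0 v \<pi> = {g \<in> KM. vge 1 (g$3$2)}"
proof -
  have unit: "vge 1 (h$2$1) \<Longrightarrow> \<not> vge 1 (h$1$1) \<and> \<not> vge 1 (h$2$2)"
    if "det h = 1" "vge 0 (h$1$1)" "vge 0 (h$1$2)" "vge 0 (h$2$2)" for h :: "'f^2^2"
  proof (rule ccontr)
    assume "vge 1 (h$2$1)" and "\<not> (\<not> vge 1 (h$1$1) \<and> \<not> vge 1 (h$2$2))"
    then have "vge 1 (h$1$1 * h$2$2 - h$1$2 * h$2$1)"
      using that by (intro vge_diff) (auto intro: vge_1_mult)
    then show False using that(1) not_vge_1_one by (simp add: det_2)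
  qed
  have "K0 v \<pi> = {G0_elt \<pi> a b h | a b h. a ^ 2 - b ^ 2 * inverse \<pi> = 1 \<and> vge 1 (a -
      1) \<and> det h = 1 \<and>
    vge 0 (h$1$1) \<and> vge 0 (h$1$2) \<and> vge 0 (h$2$1) \<and> vge 0 (h$2$2) \<and> vge 1 (h$2$1)}"
    unfolding K0_def max_ideal_iff using unit vge_1_0 max_ideal_iff by blast
  also have "\<dots> = {g \<in> KM. vge 1 (g$3$2)}"
  proof -
    have "(G0_elt \<pi> a b h)$3$2 = h$2$1" for a b and h :: "'f^2^2"
      by (simp add: G0_elt_def vector_4)
    then show ?thesis unfolding KM_eq by auto blast
  qed
  finally show ?thesis .
qed

lemma KM_mult:
  assumes "g \<in> KM" "h \<in> KM"
  shows "g ** h \<in> KM"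
proof -
  have "(g ** h)$1$1 - 1 = (g$1$1 * h$1$1 - 1) + g$1$4 * (h$1$4 / \<pi>)"
    using assms by (simp add: KM_def matrix_matrix_mult_def sum_4)
  moreover have "vge 1 (g$1$1 * h$1$1 - 1)" using assms vge_1_mult_minus_one by (simp add: KM_def)
  ultimately have "vge 1 ((g ** h)$1$1 - 1)"
    using KM_norm[OF assms(1)] KM_norm[OF assms(2)] by (simp only: vge_add vge_1_mult)
  moreover have "g ** h \<in> carrier Sp4" using assms by (simp add: KM_def)
  ultimately show ?thesis using assms
    by (simp add: KM_def matrix_matrix_mult_def sum_4 vge_add vge_0_mult add_divide_distrib mult.commute)
qed

lemma KM_sp_inv: "g \<in> KM \<Longrightarrow> sp_inv g \<in> KM"
  unfolding KM_def mem_Collect_eq by (intro conjI sp_inv_closed) (simp_all add: sp_inv_def vector_4)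

lemma KM_one: "mat 1 \<in> KM"
  unfolding KM_def mem_Collect_eq by (intro conjI Sp4_one_closed) (simp_all add: mat_def vge_one)

lemma K0_subset_KM: "K0 v \<pi> \<subseteq> KM"
  by (auto simp: K0_eq)

lemma K0_mult: "g \<in> K0 v \<pi> \<Longrightarrow> h \<in> K0 v \<pi> \<Longrightarrow> g ** h \<in>
    K0 v \<pi>"
  using KM_mult[of g h] by (simp add: K0_eq) (simp add: KM_def matrix_matrix_mult_def sum_4 vge_add
      vge_1_mult)

lemma K0_sp_inv: "g \<in> K0 v \<pi> \<Longrightarrow> sp_inv g \<in> K0 v \<pi>"
  using KM_sp_inv[of g] by (simp add: K0_eq) (simp add: sp_inv_def vector_4)

lemma K0_one: "mat 1 \<in> K0 v \<pi>"
  using KM_one by (simp add: K0_eq mat_def)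

lemma K0_KP: "K0 v \<pi> \<subseteq> KP"
proof
  fix g assume "g \<in> K0 v \<pi>"
  then have g: "g \<in> KM" "vge 1 (g$3$2)" by (auto simp: K0_eq)
  show "g \<in> KP" using g KM_norm(3,4)[OF g(1)] by (simp add: KM_def KP_def)
qed

text \<open>The middle block of \<open>g\<close> has determinant only congruent to 1. Replacing its
  lower right entry makes the determinant exactly 1, so the new block gives an element of
  \<open>K0\<close>, and dividing by it leaves an element congruent to 1.\<close>

lemma KP_factor:
  assumes "g \<in> KP"
  obtains k j where "k \<in> K0 v \<pi>" "j \<in> cong_gp (1/4)" "g = k ** j"
proof -
  have g: "vge 0 (g$2$2)" "vge 0 (g$2$3)" "vge 1 (g$3$2)" "vge 0 (g$3$3)" "vge 1 (g$1$2)" "vge 0 (g$4$3)"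
    "vge 1 (g$4$2)" "vge 1 (g$1$3)" and gS: "g \<in> carrier Sp4"
    using assms by (auto simp: KP_def)
  have "g$1$2 * g$4$3 - g$2$2 * g$3$3 + g$3$2 * g$2$3 - g$4$2 * g$1$3 = - 1"
    using gS unfolding carrier_Sp4_iff by blast
  then have "g$2$2 * g$3$3 - g$3$2 * g$2$3 - 1 = g$1$2 * g$4$3 - g$4$2 * g$1$3" by algebra
  moreover have "vge 1 (g$1$2 * g$4$3 - g$4$2 * g$1$3)"
    using g vge_1_0 by (intro vge_diff) (auto intro: vge_1_mult)
  ultimately have det: "vge 1 (g$2$2 * g$3$3 - g$3$2 * g$2$3 - 1)" by simp
  have nu: "\<not> vge 1 (g$2$2)"
  proof
    assume "vge 1 (g$2$2)"
    then have "vge 1 (g$2$2 * g$3$3 - g$3$2 * g$2$3)" using g by (intro vge_diff) (auto intro: vge_1_mult)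
    then show False using not_vge_1_diff[OF det] not_vge_1_one by simp
  qed
  then have nz: "g$2$2 \<noteq> 0" by auto
  let ?d = "(1 + g$2$3 * g$3$2) / g$2$2"
  define h :: "'f^2^2" where "h = vector [vector [g$2$2, g$2$3], vector [g$3$2, ?d]]"
  have h: "h$1$1 = g$2$2" "h$1$2 = g$2$3" "h$2$1 = g$3$2" "h$2$2 = ?d"
    by (simp_all add: h_def)
  define k where "k = G0_elt \<pi> 1 0 h"
  have "vge 0 ?d" using g nu by (intro vge_0_divide vge_add) (auto intro: vge_1_0 vge_one vge_1_mult)
  moreover have "det h = 1" using nz by (simp add: det_2 h)
  ultimately have "k \<in> KM" unfolding KM_eq k_def using g h vge_1_0
    by (intro CollectI exI[of _ 1] exI[of _ 0] exI[of _ h]) auto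
  then have k: "k \<in> K0 v \<pi>" using g by (simp add: K0_eq k_def G0_elt_def vector_4 h)
  have kS: "k \<in> carrier Sp4" using \<open>k \<in> KM\<close> by (simp add: KM_def)
  define j where "j = sp_inv k ** g"
  have gj: "g = k ** j" unfolding j_def using kS by (simp add: sp_inv_cancel)
  have jK: "j \<in> KP" unfolding j_def using K0_sp_inv[OF k] K0_KP KP_mult assms by blast
  have e: "j$2$2 = 1" "j$2$3 = - (g$2$2 * g$3$3 - g$3$2 * g$2$3 - 1) * (g$2$3 / g$2$2)"
    "j$3$3 - 1 = g$2$2 * g$3$3 - g$3$2 * g$2$3 - 1"
    unfolding j_def k_def G0_elt_def using nz
    by (simp_all add: sp_inv_def matrix_matrix_mult_def sum_4 vector_4 h field_simps)
  have "vge 1 (j$2$3)"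
    unfolding e by (rule vge_1_mult(1)) (use det g nu vge_0_divide in \<open>simp_all only:
        vge_minus\<close>)
  moreover have "vge 1 (j$2$2 - 1)" "vge 1 (j$3$3 - 1)"
    unfolding e using det by simp_all
  ultimately
  have "j \<in> cong_gp (1/4)"
    unfolding cong_gp_jump using jK by (intro cong_gpI) (simp_all add: KP_def)
  then show ?thesis using that k gj by blast
qed

lemma K_gp_eq: "K_gp v \<pi> \<epsilon> s w = KP"
proof
  show "K_gp v \<pi> \<epsilon> s w \<subseteq> KP"
    unfolding K_gp_def J_gp_eq set_mult_def using KP_mult K0_KP cong_gp_KP by auto
  show "KP \<subseteq> K_gp v \<pi> \<epsilon> s w"
  proof
    fix g assume "g \<in> KP"
    then show "g \<in> K_gp v \<pi> \<epsilon> s w"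
      by (elim KP_factor) (auto simp: K_gp_def J_gp_eq set_mult_def)
  qed
qed

end

section \<open>Residues and cosets\<close>

definition weyl :: "'a::field mat4" where
  "weyl = vector [vector [1, 0, 0, 0], vector [0, 0, 1, 0], vector [0, - 1, 0, 0], vector [0, 0, 0, 1]]"

lemma weyl_Sp4 [simp]: "weyl \<in> carrier Sp4"
  unfolding carrier_Sp4_iff weyl_def by (simp add: vector_4)

lemma e_Sp4 [simp]: "e21 x \<in> carrier Sp4" "e23 x \<in> carrier Sp4" "e41 x \<in> carrier Sp4"
  unfolding carrier_Sp4_iff e_defs by (simp_all add: vector_4)

lemma sp_inv_e: "sp_inv (e21 x) = e21 (- x)" "sp_inv (e23 x) = e23 (- x)"
  unfolding sp_inv_def e_defs by (simp_all add: vector_4)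

lemma weyl_conj_entries:
  defines "c g \<equiv> sp_inv weyl ** g ** weyl"
  shows "c g$1$1 = g$1$1" "c g$1$2 = - g$1$3" "c g$1$3 = g$1$2" "c g$1$4 = g$1$4"
    "c g$2$1 = - g$3$1" "c g$2$2 = g$3$3" "c g$2$3 = - g$3$2" "c g$2$4 = - g$3$4"
    "c g$3$1 = g$2$1" "c g$3$2 = - g$2$3" "c g$3$3 = g$2$2" "c g$3$4 = g$2$4"
    "c g$4$1 = g$4$1" "c g$4$2 = - g$4$3" "c g$4$3 = g$4$2" "c g$4$4 = g$4$4"
  unfolding c_def sp_inv_def weyl_def by (simp_all add: matrix_matrix_mult_def sum_4 vector_4)

text \<open>On the middle block this is the rank-one relation that writes a lower unipotent element
  with entry y as upper unipotent, torus, \<open>weyl\<close>, upper unipotent. Carrying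
  \<open>e21\<close> through it creates a term in the long root group \<open>e41\<close> with the
  quadratic parameter \<open>x ^ 2 / y\<close>, the source of the phase in the double sum.\<close>

lemma weyl_relation:
  assumes "(y :: 'a::field) \<noteq> 0"
  shows "sp_inv weyl ** (e21 (- x) ** e23 (- y)) ** weyl =
    e23 (1 / y) ** e21 (x / y) ** e41 (x ^ 2 / y) ** torus_elt 1 (- 1 / y) ** weyl ** e21 (- x / y) **
        e23 (1 / y)"
    (is "?l = ?r")
proof -
  have "?l = vector [vector [1, 0, 0, 0], vector [0, 1, 0, 0], vector [- x, y, 1, 0], vector [0, x, 0, 1]]"
    unfolding vec_eq_iff forall_4 weyl_conj_entries
    by (simp add: e_defs matrix_matrix_mult_def sum_4 vector_4)
  moreover have "?r = vector [vector [1, 0, 0, 0], vector [0, 1, 0, 0], vector [- x, y, 1, 0], vector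
      [0, x, 0, 1]]"
  proof -
    have 1: "e23 (1 / y) ** e21 (x / y) ** e41 (x ^ 2 / y) = vector [vector [1, 0, 0, 0],
        vector [x / y, 1, 1 / y, 0], vector [0, 0, 1, 0], vector [x ^ 2 / y, 0, x / y, 1]]"
      by (simp add: e_defs vec_eq_iff forall_4 matrix_matrix_mult_def sum_4 vector_4)
    have 2: "torus_elt 1 (- 1 / y) ** weyl ** e21 (- x / y) ** e23 (1 / y) = vector [vector [1, 0, 0, 0],
        vector [0, 0, - 1 / y, 0], vector [- x, y, 1, 0], vector [0, 0, - x / y, 1]]"
      using assms by (simp add: e_defs torus_elt_def weyl_def vec_eq_iff forall_4
          matrix_matrix_mult_def sum_4 vector_4)
    have "?r = (e23 (1 / y) ** e21 (x / y) ** e41 (x ^ 2 / y)) **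
        (torus_elt 1 (- 1 / y) ** weyl ** e21 (- x / y) ** e23 (1 / y))"
      by (simp add: matrix_mul_assoc)
    then show ?thesis unfolding 1 2 using assms
      by (simp add: vec_eq_iff forall_4 matrix_matrix_mult_def sum_4 vector_4 power2_eq_square)
  qed
  ultimately show ?thesis by simp
qed

context ramified_setup
begin

text \<open>Congruent arguments satisfy the same predicate, so the choice depends on the residue
  class alone. The representative of the zero class need not be 0; it is only known to lie in the
  maximal ideal.\<close>

definition residue_rep :: "'f \<Rightarrow> 'f" where
  "residue_rep x = (SOME y. vge 0 y \<and> vge 1 (x - y))"

definition residue_reps :: "'f set" where "residue_reps = residue_rep ` {x. vge 0 x}"

lemma residue_rep: "vge 0 x \<Longrightarrow> vge 0 (residue_rep x)" "vge 0 x \<Longrightarrow> vge 1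
    (x - residue_rep x)"
  using someI[of "\<lambda>y. vge 0 y \<and> vge 1 (x - y)" x] unfolding residue_rep_def by simp_all

lemma residue_rep_eq: "vge 1 (x - y) \<Longrightarrow> residue_rep x = residue_rep y"
proof -
  assume xy: "vge 1 (x - y)"
  have "vge 1 (x - z) \<longleftrightarrow> vge 1 (y - z)" for z
    by (rule not_vge_1_diff) (use xy in simp)
  then show ?thesis by (simp add: residue_rep_def)
qed

lemma residue_reps_vge: "r \<in> residue_reps \<Longrightarrow> vge 0 r"
  unfolding residue_reps_def using residue_rep by auto

lemma residue_rep_in_reps: "vge 0 x \<Longrightarrow> residue_rep x \<in> residue_reps"
  unfolding residue_reps_def by simp

lemma residue_rep_idem: "r \<in> residue_reps \<Longrightarrow> residue_rep r = r"
  unfolding residue_reps_def using residue_rep residue_rep_eq by (auto simp: minus_diff_commute) (metis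
      minus_diff_eq vge_minus residue_rep_eq residue_rep(2))

lemma residue_reps_eqI: "r \<in> residue_reps \<Longrightarrow> r' \<in> residue_reps \<Longrightarrow>
    vge 1 (r - r') \<Longrightarrow> r = r'"
  using residue_rep_idem residue_rep_eq by metis

lemma finite_residue_reps: "finite residue_reps"
proof -
  let ?r = "{(x, y). vge 0 x \<and> vge 0 y \<and> x - y \<in> max_ideal v}"
  have "finite (int_ring v // ?r)"
    using local_field unfolding nonarch_local_field_def by simp
  moreover have "residue_reps \<subseteq> (\<lambda>C. SOME y. y \<in> C) ` (int_ring v // ?r)"
  proof
    fix r assume "r \<in> residue_reps"
    then obtain x where x: "vge 0 x" "r = residue_rep x" unfolding residue_reps_def by auto
    have "r = (SOME y. y \<in> ?r `` {x})" using x unfolding residue_rep_def max_ideal_iff by simp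
    moreover have "?r `` {x} \<in> int_ring v // ?r" using x by (intro quotientI) simp
    ultimately show "r \<in> (\<lambda>C. SOME y. y \<in> C) ` (int_ring v // ?r)" by blast
  qed
  ultimately show ?thesis using finite_surj by blast
qed

section \<open>Cosets in the double cosets of \<open>weyl\<close>\<close>

lemma KP_units:
  assumes "g \<in> KP"
  shows "\<not> vge 1 (g$2$2)" "\<not> vge 1 (g$3$3)"
proof -
  have g: "vge 0 (g$2$2)" "vge 0 (g$2$3)" "vge 1 (g$3$2)" "vge 0 (g$3$3)" "vge 1 (g$1$2)" "vge 0 (g$4$3)"
    "vge 1 (g$4$2)" "vge 1 (g$1$3)"
    and "g$1$2 * g$4$3 - g$2$2 * g$3$3 + g$3$2 * g$2$3 - g$4$2 * g$1$3 = - 1"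
    using assms unfolding KP_def carrier_Sp4_iff by auto
  then have "1 = g$2$2 * g$3$3 + (g$4$2 * g$1$3 - g$3$2 * g$2$3 - g$1$2 * g$4$3)" by algebra
  moreover have "vge 1 (g$4$2 * g$1$3 - g$3$2 * g$2$3 - g$1$2 * g$4$3)"
    using g vge_1_0 by (intro vge_diff) (auto intro: vge_1_mult)
  ultimately have *: "\<not> vge 1 (g$2$2 * g$3$3)" using vge_add not_vge_1_one by metis
  then show "\<not> vge 1 (g$2$2)" "\<not> vge 1 (g$3$3)" using g vge_1_mult by blast+
qed

lemma e_KP: "vge 0 x \<Longrightarrow> e21 x \<in> KP" "vge 0 x \<Longrightarrow> e23 x \<in> KP" "vge
    0 x \<Longrightarrow> e41 x \<in> KP"
  unfolding KP_def mem_Collect_eq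
  by (simp_all add: vge_one) (simp_all add: e_defs vector_4 vge_one)

lemma e_cong_gp: "vge 0 x \<Longrightarrow> e21 x \<in> cong_gp (1/4)" "vge 0 x \<Longrightarrow> e41 x
    \<in> cong_gp (1/4)"
  unfolding cong_gp_jump using cong_gpI[of "e21 x"] cong_gpI[of "e41 x"]
  by (simp_all only: e_Sp4 simp_thms) (simp_all add: e_defs vector_4)

lemma e23_K0: "vge 0 x \<Longrightarrow> e23 x \<in> K0 v \<pi>"
  unfolding K0_eq KM_def by (simp add: vge_one) (simp add: e_defs vector_4 vge_one)

lemma torus_K0:
  assumes "d \<noteq> 0" "v d = 0"
  shows "torus_elt 1 d \<in> K0 v \<pi>"
proof -
  have "vge 0 (inverse d)" using assms by (simp add: vge_iff v_inverse)
  then show ?thesis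
    using assms torus_elt_Sp4[of 1 d] unfolding K0_eq KM_def
    by simp (simp add: torus_elt_def vector_4 vge_one vge_iff[of d])
qed

text \<open>Conjugation by \<open>weyl\<close> swaps the middle indices, so the entries (2,3), (4,3)
  and (2,1) must become divisible by \<open>\<pi>\<close>. The first two are the conditions that x
  and y parametrize; the third follows from a symplectic equation in which (2,1) is multiplied by
  the unit \<open>g$3$3\<close>.\<close>

lemma weyl_conj_KP:
  assumes "g \<in> KP" "vge 1 (g$2$3)" "vge 1 (g$4$3)"
  shows "sp_inv weyl ** g ** weyl \<in> KP"
proof -
  have gS: "g \<in> carrier Sp4" using assms by (simp add: KP_def)
  then have "g$1$1 * g$4$3 - g$2$1 * g$3$3 + g$3$1 * g$2$3 - g$4$1 * g$1$3 = 0"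
    unfolding carrier_Sp4_iff by blast
  then have "g$2$1 * g$3$3 = g$1$1 * g$4$3 + g$3$1 * g$2$3 - g$4$1 * g$1$3" by algebra
  moreover have "vge 1 (g$1$1 * g$4$3 + g$3$1 * g$2$3 - g$4$1 * g$1$3)"
    using assms vge_1_0 vge_0_of_1 unfolding KP_def by (intro vge_diff vge_add) (auto intro: vge_1_mult)
  ultimately have "vge 1 (g$2$1)"
    using not_vge_1_mult[of "g$2$1" "g$3$3"] KP_units[OF assms(1)] assms(1) unfolding KP_def by auto
  moreover have "sp_inv weyl ** g ** weyl \<in> carrier Sp4" using gS by simp
  ultimately show ?thesis
    using assms unfolding KP_def mem_Collect_eq weyl_conj_entries by (simp add: vge_1_0)
qed

text \<open>The conditions of \<open>weyl_conj_KP\<close> are reached by clearing the third column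
  modulo \<open>\<pi>\<close> with pivot (3,3). Treating (4,3) second is harmless: it changes (2,3)
  by a multiple of the entry (1,3), which lies in the maximal ideal.\<close>

lemma weyl_cover:
  assumes "k \<in> KP"
  obtains y x k' where "y \<in> residue_reps" "x \<in> residue_reps" "k' \<in> KP" "k ** weyl = e23 y
      ** e21 x ** weyl ** k'"
proof -
  have kO: "vge 0 (k$2$3)" "vge 0 (k$3$3)" using assms by (auto simp: KP_def)
  define y where "y = residue_rep (k$2$3 / k$3$3)"
  have yq: "vge 0 (k$2$3 / k$3$3)" using kO KP_units[OF assms] vge_0_divide by simp
  then have y: "y \<in> residue_reps" "vge 0 y" unfolding y_def using residue_rep_in_reps residue_rep
      by simp_all
  define k1 where "k1 = e23 (- y) ** k"
  have k1: "k1 \<in> KP" unfolding k1_def using y assms by (intro KP_mult e_KP) simp_all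
  have "k1$2$3 = k$3$3 * (k$2$3 / k$3$3 - y)"
    using KP_units[OF assms] unfolding k1_def
    by (auto simp: e_defs matrix_matrix_mult_def sum_4 vector_4 field_simps)
  then have k123: "vge 1 (k1$2$3)" using vge_1_mult(2)[OF kO(2) residue_rep(2)[OF yq]] by (simp add: y_def)
  have k1O: "vge 0 (k1$4$3)" "vge 0 (k1$3$3)" "vge 1 (k1$1$3)" using k1 by (auto simp: KP_def)
  define x where "x = residue_rep (k1$4$3 / k1$3$3)"
  have xq: "vge 0 (k1$4$3 / k1$3$3)" using k1O KP_units[OF k1] vge_0_divide by simp
  then have x: "x \<in> residue_reps" "vge 0 x" unfolding x_def using residue_rep_in_reps residue_rep
      by simp_all
  define m where "m = e21 (- x) ** k1"
  have m: "m \<in> KP" unfolding m_def using x k1 by (intro KP_mult e_KP) simp_all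
  have "m$4$3 = k1$3$3 * (k1$4$3 / k1$3$3 - x)"
    using KP_units[OF k1] unfolding m_def
    by (auto simp: e_defs matrix_matrix_mult_def sum_4 vector_4 field_simps)
  then have m43: "vge 1 (m$4$3)" using vge_1_mult(2)[OF k1O(2) residue_rep(2)[OF xq]] by (simp add: x_def)
  have "m$2$3 = k1$2$3 - x * k1$1$3"
    unfolding m_def by (simp add: e_defs matrix_matrix_mult_def sum_4 vector_4)
  then have m23: "vge 1 (m$2$3)" using k123 k1O x vge_1_mult(2) by (simp add: vge_diff)
  have "e23 y ** e21 x ** weyl ** (sp_inv weyl ** m ** weyl) = e23 y ** (e21 x ** m) ** weyl"
    by (simp add: matrix_mul_assoc sp_inv_cancel)
  also have "e21 x ** m = k1"
    unfolding m_def using e_cancel(1)[of x] by (simp add: matrix_mul_assoc)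
  also have "e23 y ** k1 = k"
    unfolding k1_def using e_cancel(7)[of "- y"] by (simp add: matrix_mul_assoc)
  finally have "k ** weyl = e23 y ** e21 x ** weyl ** (sp_inv weyl ** m ** weyl)" ..
  then show ?thesis using that[OF y(1) x(1) weyl_conj_KP[OF m m23 m43]] by blast
qed

lemma weyl_coset_inj:
  assumes "y \<in> residue_reps" "x \<in> residue_reps" "y' \<in> residue_reps" "x' \<in> residue_reps"
    and "sp_inv (e23 y ** e21 x ** weyl) ** (e23 y' ** e21 x' ** weyl) \<in> KP"
  shows "y = y' \<and> x = x'"
proof -
  let ?m = "e21 (- x) ** e23 (- y) ** e23 y' ** e21 x'"
  have "sp_inv (e23 y ** e21 x ** weyl) ** (e23 y' ** e21 x' ** weyl) = sp_inv weyl ** ?m ** weyl"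
    by (simp add: sp_inv_mult sp_inv_e matrix_mul_assoc)
  then have "vge 1 (- ?m$2$3)" "vge 1 (- ?m$4$3)"
    using assms(5) unfolding KP_def by (simp_all add: weyl_conj_entries)
  moreover have "?m$2$3 = y' - y" "?m$4$3 = x' - x"
    by (simp_all add: e_defs matrix_matrix_mult_def sum_4 vector_4)
  ultimately show ?thesis using residue_reps_eqI assms by auto
qed

text \<open>Modulo the maximal ideal only \<open>- (k$3$3 * k'$2$2)\<close> survives, a product of
  units. The entry thus tells when an element lies outside the support of \<open>T\<close>.\<close>

lemma KWK_entry:
  assumes "k \<in> KP" "k' \<in> KP"
  shows "\<not> vge 1 ((k ** weyl ** k')$3$2)"
proof -
  have k: "vge 1 (k$3$1)" "vge 1 (k$3$2)" "vge 0 (k$3$3)" "vge 1 (k$3$4)"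
    and k': "vge 1 (k'$1$2)" "vge 0 (k'$2$2)" "vge 1 (k'$3$2)" "vge 1 (k'$4$2)"
    using assms by (auto simp: KP_def)
  have "vge 1 ((k ** weyl ** k')$3$2 - - (k$3$3 * k'$2$2))"
    by (simp add: weyl_def matrix_matrix_mult_def sum_4 vector_4 vge_add vge_1_mult k k' vge_1_0)
  from not_vge_1_diff[OF this] show ?thesis
    using not_vge_1_mult[OF k(3) KP_units(2)[OF assms(1)] k'(2) KP_units(1)[OF assms(2)]] by simp
qed

lemma KM_weyl: "weyl \<in> KM"
  unfolding KM_def by simp (simp add: weyl_def vector_4 vge_one)

text \<open>The Bruhat decomposition of SL2 over the residue field: the (3,2) entry is a unit, and
  the ratio of the two entries in its column gives the residue y.\<close>

lemma K0_cover:
  assumes "h \<in> KM" "h \<notin> K0 v \<pi>"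
  obtains y where "y \<in> residue_reps" "sp_inv (e23 y ** weyl) ** h \<in> K0 v \<pi>"
proof -
  have h: "vge 0 (h$2$2)" "vge 0 (h$3$2)" "\<not> vge 1 (h$3$2)" using assms by (auto simp: K0_eq KM_def)
  define y where "y = residue_rep (h$2$2 / h$3$2)"
  have yq: "vge 0 (h$2$2 / h$3$2)" using h vge_0_divide by simp
  then have y: "y \<in> residue_reps" "vge 0 y" unfolding y_def using residue_rep_in_reps residue_rep
      by simp_all
  let ?k = "sp_inv (e23 y ** weyl) ** h"
  have "?k \<in> KM"
    using assms KM_weyl e23_K0[OF y(2)] K0_subset_KM by (intro KM_mult KM_sp_inv) auto
  moreover have "?k$3$2 = h$3$2 * (h$2$2 / h$3$2 - y)"
    using h by (auto simp: e_defs weyl_def sp_inv_def matrix_matrix_mult_def sum_4 vector_4 field_simps)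
  ultimately have "?k \<in> K0 v \<pi>"
    using vge_1_mult(2)[OF h(2) residue_rep(2)[OF yq]] by (simp add: K0_eq y_def)
  then show ?thesis using that y by blast
qed

end

section \<open>Compactness\<close>

context ramified_setup
begin

lemma openin_mat_topology:
  "openin (mat_topology v) U \<longleftrightarrow> (\<forall>g\<in>U. \<exists>r. \<forall>g'.
      (\<forall>i j. vge r (g'$i$j - g$i$j)) \<longrightarrow> g' \<in> U)"
proof -
  let ?L = "\<lambda>U. \<forall>g\<in>U. \<exists>r. \<forall>g'. (\<forall>i j. vge r (g'$i$j -
      g$i$j)) \<longrightarrow> g' \<in> U"
  have "istopology ?L"
    unfolding istopology_def
  proof (intro conjI allI impI ballI)
    fix S T g assume ST: "?L S" "?L T" and g: "g \<in> S \<inter> T"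
    obtain r1 where r1: "\<forall>g'. (\<forall>i j. vge r1 (g'$i$j - g$i$j)) \<longrightarrow> g'
        \<in> S" using ST(1) g by blast
    obtain r2 where r2: "\<forall>g'. (\<forall>i j. vge r2 (g'$i$j - g$i$j)) \<longrightarrow> g'
        \<in> T" using ST(2) g by blast
    have "\<forall>g'. (\<forall>i j. vge (max r1 r2) (g'$i$j - g$i$j)) \<longrightarrow> g' \<in> S
        \<inter> T"
    proof (intro allI impI)
      fix g' assume "\<forall>i j. vge (max r1 r2) (g'$i$j - g$i$j)"
      then have "\<forall>i j. vge r1 (g'$i$j - g$i$j)" "\<forall>i j. vge r2 (g'$i$j - g$i$j)"
        by (auto intro: vge_mono[of _ "max r1 r2"])
      then show "g' \<in> S \<inter> T" using r1 r2 by blast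
    qed
    then show "\<exists>r. \<forall>g'. (\<forall>i j. vge r (g'$i$j - g$i$j)) \<longrightarrow> g'
        \<in> S \<inter> T" by blast
  next
    fix K g assume "\<forall>S\<in>K. ?L S" "g \<in> \<Union>K"
    then show "\<exists>r. \<forall>g'. (\<forall>i j. vge r (g'$i$j - g$i$j)) \<longrightarrow> g'
        \<in> \<Union>K" by (meson UnionE UnionI)
  qed
  from topology_inverse'[OF this] show ?thesis unfolding mat_topology_def by (rule fun_cong)
qed

definition mball :: "'f mat4 \<Rightarrow> nat \<Rightarrow> 'f mat4 set" where
  "mball L n = {g. \<forall>i j. vge (real n) (g$i$j - L$i$j)}"

lemma vge_pi_power: "vge (real n) (\<pi> ^ n)"
proof -
  have "v (\<pi> ^ n) = real n" by (induction n) (simp_all add: v_mult)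
  then show ?thesis by (simp add: vge_iff)
qed

lemma v_pi_power: "v (\<pi> ^ n) = real n"
  by (induction n) (simp_all add: v_mult)

text \<open>One more residue digit for each of the sixteen entries, and the residue field is
  finite.\<close>

lemma mball_split:
  obtains \<L> where "finite \<L>" "\<L> \<subseteq> mball L n" "mball L n \<subseteq>
      (\<Union>L'\<in>\<L>. mball L' (Suc n))"
proof -
  define f :: "(4 \<Rightarrow> 4 \<Rightarrow> 'f) \<Rightarrow> 'f mat4" where "f = (\<lambda>m.
      \<chi> i j. L$i$j + \<pi> ^ n * m i j)"
  let ?M = "PiE UNIV (\<lambda>_::4. PiE UNIV (\<lambda>_::4. residue_reps))"
  have fin: "finite (f ` ?M)" by (intro finite_imageI finite_PiE finite_residue_reps) auto
  moreover have "f ` ?M \<subseteq> mball L n"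
  proof (clarsimp simp: mball_def f_def)
    fix m i j assume "m \<in> ?M"
    then have "vge 0 (m i j)" using residue_reps_vge by (auto simp: PiE_def Pi_def)
    then show "vge (real n) (\<pi> ^ n * m i j)" using vge_mult'[OF vge_pi_power] by simp
  qed
  moreover have "mball L n \<subseteq> (\<Union>L'\<in>f ` ?M. mball L' (Suc n))"
  proof
    fix g assume g: "g \<in> mball L n"
    define q where "q = (\<lambda>i j. (g$i$j - L$i$j) / \<pi> ^ n)"
    have q: "vge 0 (q i j)" for i j
      unfolding q_def using g by (intro vge_divide[where r = "real n"]) (auto simp: mball_def v_pi_power)
    then have "(\<lambda>i j. residue_rep (q i j)) \<in> ?M" using residue_rep_in_reps by auto
    moreover have "vge (real (Suc n)) (g$i$j - f (\<lambda>i j. residue_rep (q i j))$i$j)" for i j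
    proof -
      have "g$i$j - f (\<lambda>i j. residue_rep (q i j))$i$j = \<pi> ^ n * (q i j - residue_rep (q i j))"
        by (simp add: f_def q_def field_simps)
      then show ?thesis using vge_mult'[OF vge_pi_power residue_rep(2)[OF q], of "real (Suc n)"] by simp
    qed
    ultimately show "g \<in> (\<Union>L'\<in>f ` ?M. mball L' (Suc n))" unfolding mball_def by blast
  qed
  ultimately show ?thesis by (rule that)
qed

lemma mball_mono: "m \<le> n \<Longrightarrow> mball L n \<subseteq> mball L m"
  unfolding mball_def by (auto intro: vge_mono[of _ "real n"])

lemma mball_eq:
  assumes "L' \<in> mball L n"
  shows "mball L n = mball L' n"
proof -
  have l: "vge (real n) (L'$i$j - L$i$j)" for i j using assms by (simp add: mball_def)
  have "vge (real n) (g$i$j - L$i$j) \<longleftrightarrow> vge (real n) (g$i$j - L'$i$j)" for g :: "'f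
      mat4" and i j
    using vge_diff[OF _ l, of "g$i$j - L$i$j" i j] vge_add[OF _ l, of "g$i$j - L'$i$j" i j] by auto
  then show ?thesis unfolding mball_def by simp
qed

text \<open>Compactness by successive subdivision: if no finite subfamily of an open cover
  suffices, some nested sequence of balls of radii \<open>n\<close> is never finitely covered, and its
  limit lies in one member of the cover.\<close>

lemma compactin_mat_topology:
  assumes int: "S \<subseteq> mball 0 0" and closed: "\<And>L. (\<And>n. S \<inter> mball L n \<noteq>
      {}) \<Longrightarrow> L \<in> S"
  shows "compactin (mat_topology v) S"
proof -
  have top: "topspace (mat_topology v) = UNIV"
    using openin_subset[of "mat_topology v" UNIV] unfolding openin_mat_topology by auto
  have "\<exists>F. finite F \<and> F \<subseteq> \<U> \<and> S \<subseteq> \<Union>F"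
    if op: "\<forall>u\<in>\<U>. openin (mat_topology v) u" and cover: "S \<subseteq> \<Union>\<U>" for \<U>
  proof (rule ccontr)
    assume none: "\<nexists>F. finite F \<and> F \<subseteq> \<U> \<and> S \<subseteq> \<Union>F"
    define bad where "bad = (\<lambda>B. \<nexists>F. finite F \<and> F \<subseteq> \<U> \<and> S
        \<inter> B \<subseteq> \<Union>F)"
    have "bad (mball 0 0)" unfolding bad_def using none int by (metis Int_absorb2)
    moreover have "\<exists>L'. bad (mball L' (Suc n)) \<and> L' \<in> mball L n" if b: "bad (mball L
        n)" for L n
    proof (rule ccontr)
      assume "\<nexists>L'. bad (mball L' (Suc n)) \<and> L' \<in> mball L n"
      then have "\<forall>L'\<in>mball L n. \<exists>F. finite F \<and> F \<subseteq> \<U> \<and> S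
          \<inter> mball L' (Suc n) \<subseteq> \<Union>F"
        unfolding bad_def by blast
      then obtain F where F: "\<forall>L'\<in>mball L n. finite (F L') \<and> F L' \<subseteq> \<U>
          \<and> S \<inter> mball L' (Suc n) \<subseteq> \<Union>(F L')"
        by metis
      obtain \<L> where \<L>: "finite \<L>" "\<L> \<subseteq> mball L n" "mball L n \<subseteq>
          (\<Union>L'\<in>\<L>. mball L' (Suc n))"
        by (rule mball_split)
      have "finite (\<Union>(F ` \<L>))" "\<Union>(F ` \<L>) \<subseteq> \<U>" using F \<L> by auto
      moreover have "S \<inter> mball L n \<subseteq> \<Union>(\<Union>(F ` \<L>))"
      proof
        fix g assume g: "g \<in> S \<inter> mball L n"
        then obtain L' where L': "L' \<in> \<L>" "g \<in> mball L' (Suc n)" using \<L> by blast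
        then have "S \<inter> mball L' (Suc n) \<subseteq> \<Union>(F L')" using F \<L> by auto
        then have "g \<in> \<Union>(F L')" using g L' by auto
        then show "g \<in> \<Union>(\<Union>(F ` \<L>))" using L'(1) by auto
      qed
      ultimately show False using b unfolding bad_def by blast
    qed
    ultimately obtain a where a: "\<And>n. bad (mball (a n) n)" "\<And>n. a (Suc n) \<in> mball (a n) n"
      using dependent_nat_choice[of "\<lambda>n L. bad (mball L n)" "\<lambda>n L L'. L' \<in> mball L
          n"] by metis
    have step: "a m \<in> mball (a n) n" if "n \<le> m" for m n
      using that
    proof (induction m rule: dec_induct)
      case base
      then show ?case by (simp add: mball_def)
    next
      case (step m)
      have "a (Suc m) \<in> mball (a m) n" using a(2)[of m] mball_mono[OF step(1)] by blast
      then show ?case using mball_eq[OF step(3)] by simp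
    qed
    have "\<exists>l. \<forall>r. \<exists>N. \<forall>n\<ge>N. vge r (a n$i$j - l)" for i j
    proof -
      have "\<exists>N. \<forall>m\<ge>N. \<forall>n\<ge>N. vge r (a m$i$j - a n$i$j)" for r
      proof -
        obtain N :: nat where N: "r \<le> real N" using real_arch_simple by blast
        have "vge r (a m$i$j - a n$i$j)" if "N \<le> m" "N \<le> n" for m n
        proof -
          have "vge (real N) (a m$i$j - a N$i$j)" "vge (real N) (a n$i$j - a N$i$j)"
            using step[OF that(1)] step[OF that(2)] by (simp_all add: mball_def)
          from vge_diff[OF this] show ?thesis using N vge_mono by simp
        qed
        then show ?thesis by blast
      qed
      then have cauchy: "\<forall>r. \<exists>N. \<forall>m\<ge>N. \<forall>n\<ge>N. vge r (a m$i$j - a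
          n$i$j)" by blast
      have "val_complete v" using local_field unfolding nonarch_local_field_def by simp
      from mp[OF spec[OF this[unfolded val_complete_def], of "\<lambda>n. a n$i$j"] cauchy]
      show ?thesis .
    qed
    then obtain l where l: "\<And>i j r. \<exists>N. \<forall>n\<ge>N. vge r (a n$i$j - l i j)" by metis
    define L :: "'f mat4" where "L = (\<chi> i j. l i j)"
    have "L \<in> mball (a n) n" for n
    proof -
      have "vge (real n) (l i j - a n$i$j)" for i j
      proof -
        obtain N where N: "\<forall>m\<ge>N. vge (real n) (a m$i$j - l i j)" using l by blast
        let ?m = "max N n"
        have "vge (real n) (a ?m$i$j - l i j)" using N by simp
        moreover have "vge (real n) (a ?m$i$j - a n$i$j)" using step[of n ?m] by (simp add: mball_def)
        ultimately show ?thesis using vge_diff[of "a ?m$i$j - a n$i$j" "real n" "a ?m$i$j - l i j"] by simp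
      qed
      then show ?thesis by (simp add: mball_def L_def)
    qed
    then have L: "bad (mball L n)" for n using a(1)[of n] mball_eq by metis
    \<comment> \<open>An empty intersection would be covered by the empty subfamily.\<close>
    have "S \<inter> mball L n \<noteq> {}" for n
      using L[of n] unfolding bad_def by (metis Union_empty empty_subsetI finite.emptyI subset_refl)
    then have "L \<in> S" by (rule closed)
    then obtain u where u: "u \<in> \<U>" "L \<in> u" using cover by blast
    then obtain r where r: "\<forall>g'. (\<forall>i j. vge r (g'$i$j - L$i$j)) \<longrightarrow> g'
        \<in> u"
      using op unfolding openin_mat_topology by blast
    obtain n :: nat where "r \<le> real n" using real_arch_simple by blast
    then have "mball L n \<subseteq> u" using r unfolding mball_def by (auto intro: vge_mono[of _ "real n"])
    then have "S \<inter> mball L n \<subseteq> \<Union>{u}" by auto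
    then show False using L[of n] u(1) unfolding bad_def by (metis empty_subsetI finite.emptyI
        finite.insertI insert_subset)
  qed
  then show ?thesis unfolding compactin_def top by auto
qed

section \<open>Compactness of the supports in \<open>G\<^sup>0\<close>\<close>

lemma vge_all_zero:
  assumes "\<And>n::nat. vge (real n) x"
  shows "x = 0"
proof (rule ccontr)
  assume x: "x \<noteq> 0"
  obtain n :: nat where "v x < real n" using reals_Archimedean2 by blast
  then show False using assms[of n] x by (auto simp: vge_iff)
qed

text \<open>An integrality bound or congruence passes to \<open>L\<close> from one element close
  enough to it. An equation passes to \<open>L\<close> because its defect there has arbitrarily
  large valuation, being zero on \<open>KM\<close>.\<close>

lemma KM_closed:
  assumes "\<And>n. KM \<inter> mball L n \<noteq> {}"
  shows "L \<in> KM"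
proof -
  have *: "\<exists>g\<in>KM. \<forall>i j. vge (real n) (g$i$j - L$i$j)" for n
    using assms[of n] by (auto simp: mball_def)
  obtain g where g: "g \<in> KM" "\<And>i j. vge 1 (g$i$j - L$i$j)" using *[of 1] by auto
  have near: "vge 0 (L$i$j)" if "vge 0 (g$i$j)" for i j
    using vge_diff[OF that vge_1_0[OF g(2)[of i j]]] by simp
  have L: "vge 0 (L$2$2)" "vge 0 (L$2$3)" "vge 0 (L$3$2)" "vge 0 (L$3$3)" "vge 0 (L$1$1)" "vge 0 (L$1$4)"
    using g(1) near vge_0_of_1 KM_norm(3)[OF g(1)] vge_1_0 by (auto simp: KM_def)
  have L11: "vge 1 (L$1$1 - 1)"
    using vge_diff[of "g$1$1 - 1" 1 "g$1$1 - L$1$1"] g by (simp add: KM_def)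
  have zero: "L$i$j = 0" if "\<And>h. h \<in> KM \<Longrightarrow> h$i$j = 0" for i j
  proof -
    have "vge (real n) (- L$i$j)" for n using *[of n] that by (metis diff_0)
    then show ?thesis using vge_all_zero by simp
  qed
  have L0: "L$1$2 = 0" "L$1$3 = 0" "L$2$1 = 0" "L$2$4 = 0" "L$3$1 = 0" "L$3$4 = 0" "L$4$2 = 0" "L$4$3 = 0"
    by (rule zero, simp add: KM_def)+
  have e1: "L$4$4 - L$1$1 = 0"
  proof (rule vge_all_zero)
    fix n obtain h where h: "h \<in> KM" "\<And>i j. vge (real n) (h$i$j - L$i$j)" using * by blast
    have "L$4$4 - L$1$1 = (h$1$1 - L$1$1) - (h$4$4 - L$4$4)" using h(1) by (simp add: KM_def)
    then show "vge (real n) (L$4$4 - L$1$1)" using vge_diff h(2) by metis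
  qed
  have e2: "L$4$1 - L$1$4 / \<pi> = 0"
  proof (rule vge_all_zero)
    \<comment> \<open>Dividing by \<open>\<pi>\<close> costs one unit of valuation, hence
      \<open>Suc n\<close>.\<close>
    fix n obtain h where h: "h \<in> KM" "\<And>i j. vge (real (Suc n)) (h$i$j - L$i$j)" using *[of
        "Suc n"] by blast
    have "L$4$1 - L$1$4 / \<pi> = (h$1$4 - L$1$4) / \<pi> - (h$4$1 - L$4$1)"
      using h(1) by (simp add: KM_def diff_divide_distrib)
    moreover have "vge (real n) ((h$1$4 - L$1$4) / \<pi>)" by (rule vge_divide[OF h(2)]) simp_all
    moreover have "vge (real n) (h$4$1 - L$4$1)" by (rule vge_mono[OF h(2)]) simp
    ultimately show "vge (real n) (L$4$1 - L$1$4 / \<pi>)" by (metis vge_diff)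
  qed
  have e3: "L$1$1 * L$1$1 - L$1$4 * L$1$4 / \<pi> - 1 = 0"
  proof (rule vge_all_zero)
    fix n obtain h where h: "h \<in> KM" "\<And>i j. vge (real (Suc n)) (h$i$j - L$i$j)" using *[of
        "Suc n"] by blast
    have n: "h$1$1 * h$1$1 - h$1$4 * h$1$4 / \<pi> = 1"
      using KM_norm(1)[OF h(1)] by (simp add: power2_eq_square divide_inverse)
    have hO: "vge 0 (h$1$1)" "vge 0 (h$1$4)" using h(1) vge_0_of_1 KM_norm(3)[OF h(1)] vge_1_0 by (auto
        simp: KM_def)
    have "L$1$1 * L$1$1 - L$1$4 * L$1$4 / \<pi> - 1
        = (h$1$4 - L$1$4) * (h$1$4 + L$1$4) / \<pi> - (h$1$1 - L$1$1) * (h$1$1 + L$1$1)"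
      unfolding n[symmetric] by (simp add: field_simps)
    moreover have "vge (real n) ((h$1$4 - L$1$4) * (h$1$4 + L$1$4) / \<pi>)"
      by (rule vge_divide[OF vge_mult'[OF h(2) vge_add[OF hO(2) L(6)]]]) auto
    moreover have "vge (real n) ((h$1$1 - L$1$1) * (h$1$1 + L$1$1))"
      by (rule vge_mult'[OF h(2) vge_add[OF hO(1) L(5)]]) simp
    ultimately show "vge (real n) (L$1$1 * L$1$1 - L$1$4 * L$1$4 / \<pi> - 1)" using vge_diff by simp
  qed
  have e4: "L$2$2 * L$3$3 - L$2$3 * L$3$2 - 1 = 0"
  proof (rule vge_all_zero)
    fix n obtain h where h: "h \<in> KM" "\<And>i j. vge (real n) (h$i$j - L$i$j)" using * by blast
    have n: "h$2$2 * h$3$3 - h$2$3 * h$3$2 = 1" using KM_norm(2)[OF h(1)] .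
    have hO: "vge 0 (h$3$3)" "vge 0 (h$3$2)" using h(1) by (auto simp: KM_def)
    have "L$2$2 * L$3$3 - L$2$3 * L$3$2 - 1
        = ((h$2$3 - L$2$3) * h$3$2 + (h$3$2 - L$3$2) * L$2$3) - ((h$2$2 - L$2$2) * h$3$3 + (h$3$3 -
            L$3$3) * L$2$2)"
      unfolding n[symmetric] by (simp add: algebra_simps)
    moreover have "vge (real n) ((h$2$3 - L$2$3) * h$3$2 + (h$3$2 - L$3$2) * L$2$3)"
      by (intro vge_add vge_mult'[OF h(2) hO(2)] vge_mult'[OF h(2) L(2)]) simp_all
    moreover have "vge (real n) ((h$2$2 - L$2$2) * h$3$3 + (h$3$3 - L$3$3) * L$2$2)"
      by (intro vge_add vge_mult'[OF h(2) hO(1)] vge_mult'[OF h(2) L(1)]) simp_all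
    ultimately show "vge (real n) (L$2$2 * L$3$3 - L$2$3 * L$3$2 - 1)" using vge_diff by simp
  qed
  have "L \<in> carrier Sp4"
    using e1 e2 e3 e4 unfolding carrier_Sp4_iff by (simp add: L0 algebra_simps)
  then show ?thesis using e1 e2 L L0 L11 by (simp add: KM_def)
qed

lemma KM_bounded: "KM \<subseteq> mball 0 0"
  unfolding mball_def using KM_norm(3,4) vge_1_0 vge_0_of_1 by (auto simp: forall_4 KM_def)

lemma compactin_KM: "compactin (mat_topology v) KM"
  by (rule compactin_mat_topology[OF KM_bounded KM_closed])

text \<open>\<open>K0\<close> is open in \<open>KM\<close>: whether the (3,2) entry is a unit
  depends only on its residue class.\<close>

lemma compactin_KM_minus_K0: "compactin (mat_topology v) (KM - K0 v \<pi>)"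
proof (rule compactin_mat_topology)
  show "KM - K0 v \<pi> \<subseteq> mball 0 0" using KM_bounded by auto
  fix L assume *: "\<And>n. (KM - K0 v \<pi>) \<inter> mball L n \<noteq> {}"
  have "L \<in> KM" by (rule KM_closed) (use * in blast)
  moreover obtain g where "g \<in> KM" "\<not> vge 1 (g$3$2)" "vge 1 (g$3$2 - L$3$2)"
    using *[of 1] by (auto simp: K0_eq mball_def)
  ultimately show "L \<in> KM - K0 v \<pi>" using not_vge_1_diff by (auto simp: K0_eq)
qed

end

section \<open>The Hecke algebra of the twisted Levi subgroup\<close>

lemma l_coset_Sp4: "h <#\<^bsub>Sp4\<^esub> K = (\<lambda>k. h ** k) ` K"
  by (auto simp: l_coset_def)

text \<open>Passing to another element of the coset inserts \<open>\<rho> k\<close> and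
  \<open>\<rho> (sp_inv k)\<close>, which cancel. So explicit representatives may replace the choice
  made by \<open>SOME\<close>.\<close>

lemma hecke_conv_reindex:
  fixes f1 f2 :: "'f::field mat4 \<Rightarrow> 'w::ab_group_add \<Rightarrow> 'w"
  assumes cosets: "{h <#\<^bsub>Sp4\<^esub> K | h. h \<in> supp f1} = (\<lambda>i. r i
      <#\<^bsub>Sp4\<^esub> K) ` I"
    and inj: "inj_on (\<lambda>i. r i <#\<^bsub>Sp4\<^esub> K) I" and one: "mat 1 \<in> K"
    and Sp4: "K \<subseteq> carrier Sp4" "\<And>i. i \<in> I \<Longrightarrow> r i \<in> carrier Sp4"
    and f1: "\<And>i k. i \<in> I \<Longrightarrow> k \<in> K \<Longrightarrow> f1 (r i ** k) = f1 (r
        i) \<circ> \<rho> k"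
    and f2: "\<And>i k. i \<in> I \<Longrightarrow> k \<in> K \<Longrightarrow>
      f2 (sp_inv k ** (sp_inv (r i) ** g)) = \<rho> (sp_inv k) \<circ> f2 (sp_inv (r i) ** g)"
    and \<rho>: "\<And>k. k \<in> K \<Longrightarrow> \<rho> k \<circ> \<rho> (sp_inv k) = id"
  shows "hecke_conv K f1 f2 g x = (\<Sum>i\<in>I. f1 (r i) (f2 (sp_inv (r i) ** g) x))"
proof -
  have "(let h = SOME h. h \<in> r i <#\<^bsub>Sp4\<^esub> K in f1 h (f2 (inv\<^bsub>Sp4\<^esub> h **
      g) x)) = f1 (r i) (f2 (sp_inv (r i) ** g) x)"
    if i: "i \<in> I" for i
  proof -
    have "r i ** mat 1 \<in> r i <#\<^bsub>Sp4\<^esub> K" unfolding l_coset_Sp4 using one by blast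
    then have "(SOME h. h \<in> r i <#\<^bsub>Sp4\<^esub> K) \<in> r i <#\<^bsub>Sp4\<^esub> K" by
        (rule someI)
    then obtain k where k: "k \<in> K" "(SOME h. h \<in> r i <#\<^bsub>Sp4\<^esub> K) = r i ** k"
        unfolding l_coset_Sp4 by blast
    have s: "k \<in> carrier Sp4" "r i \<in> carrier Sp4" using k Sp4 i by auto
    have inv: "inv\<^bsub>Sp4\<^esub> (r i ** k) ** g = sp_inv k ** (sp_inv (r i) ** g)"
      using s by (simp add: inv_Sp4 sp_inv_mult matrix_mul_assoc)
    have "f1 (r i ** k) (f2 (inv\<^bsub>Sp4\<^esub> (r i ** k) ** g) x) = f1 (r i) ((\<rho> k \<circ>
        \<rho> (sp_inv k)) (f2 (sp_inv (r i) ** g) x))"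
      unfolding inv f1[OF i k(1)] f2[OF i k(1)] by simp
    then show ?thesis unfolding k(2) Let_def \<rho>[OF k(1)] by simp
  qed
  then show ?thesis
    unfolding hecke_conv_def cosets by (simp add: sum.reindex[OF inj])
qed

context ramified_setup
begin

text \<open>As a trace pairing, the functional is fixed by every symplectic \<open>g\<close> that
  commutes with the pairing matrix.\<close>

lemma X_fun_trace: "X_fun \<pi> A = trace (A ** vector [vector [0, 0, 0, 1], 0, 0, vector [inverse
    \<pi>, 0, 0, 0]])"
  by (simp add: X_fun_def trace_def matrix_matrix_mult_def sum_4 vector_4)

lemma KM_subset_G0: "KM \<subseteq> G0 \<pi>"
proof
  fix g assume g: "g \<in> KM"
  then have gS: "g \<in> carrier Sp4" by (simp add: KM_def)
  let ?M = "vector [vector [0, 0, 0, 1], 0, 0, vector [inverse \<pi>, 0, 0, 0]] :: 'f mat4"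
  have comm: "g ** ?M = ?M ** g"
    using g by (simp add: KM_def vec_eq_iff forall_4 matrix_matrix_mult_def sum_4 vector_4 divide_inverse)
  have "X_fun \<pi> (conj_by (inv\<^bsub>Sp4\<^esub> g) A) = X_fun \<pi> A" for A
  proof -
    have "X_fun \<pi> (conj_by (inv\<^bsub>Sp4\<^esub> g) A) = trace (sp_inv g ** (A ** (g ** ?M)))"
      using gS by (simp add: conj_by_eq inv_Sp4 X_fun_trace matrix_mul_assoc)
    also have "\<dots> = trace (A ** (?M ** g) ** sp_inv g)" unfolding comm by (rule trace_mul_sym)
    also have "\<dots> = X_fun \<pi> A" using gS by (simp add: matrix_mul_assoc sp_inv_cancel X_fun_trace)
    finally show ?thesis .
  qed
  then show "g \<in> G0 \<pi>" using gS by (simp add: G0_def)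
qed

lemma KM_bi_invariant:
  assumes "k1 \<in> KM" "k2 \<in> KM"
  shows "k1 ** h ** k2 \<in> KM \<longleftrightarrow> h \<in> KM"
proof
  have "k1 \<in> carrier Sp4" "k2 \<in> carrier Sp4" using assms by (auto simp: KM_def)
  then have h: "sp_inv k1 ** (k1 ** h ** k2) ** sp_inv k2 = h"
    by (simp add: matrix_mul_assoc sp_inv_cancel sp_inv_left)
  assume "k1 ** h ** k2 \<in> KM"
  then have "sp_inv k1 ** (k1 ** h ** k2) ** sp_inv k2 \<in> KM"
    using KM_mult[OF KM_mult[OF KM_sp_inv[OF assms(1)]] KM_sp_inv[OF assms(2)]] by blast
  then show "h \<in> KM" by (simp only: h)
qed (use assms in \<open>auto intro: KM_mult\<close>)

lemma K0_bi_invariant: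
  assumes "k1 \<in> K0 v \<pi>" "k2 \<in> K0 v \<pi>"
  shows "k1 ** h ** k2 \<in> K0 v \<pi> \<longleftrightarrow> h \<in> K0 v \<pi>"
proof
  have "k1 \<in> carrier Sp4" "k2 \<in> carrier Sp4" using assms K0_subset_KM by (auto simp: KM_def)
  then have h: "sp_inv k1 ** (k1 ** h ** k2) ** sp_inv k2 = h"
    by (simp add: matrix_mul_assoc sp_inv_cancel sp_inv_left)
  assume "k1 ** h ** k2 \<in> K0 v \<pi>"
  then have "sp_inv k1 ** (k1 ** h ** k2) ** sp_inv k2 \<in> K0 v \<pi>"
    using K0_mult[OF K0_mult[OF K0_sp_inv[OF assms(1)]] K0_sp_inv[OF assms(2)]] by blast
  then show "h \<in> K0 v \<pi>" by (simp only: h)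
qed (use assms in \<open>auto intro: K0_mult\<close>)

section \<open>The indicator function on \<open>G\<^sup>0\<close> and its square\<close>

lemma scalar_in_hecke:
  fixes a :: "'f mat4 \<Rightarrow> 'c::field"
  assumes supp: "{g. a g \<noteq> 0} \<subseteq> KM" "compactin (mat_topology v) {g. a g \<noteq> 0}"
    and inv: "\<And>k1 h k2. k1 \<in> K0 v \<pi> \<Longrightarrow> k2 \<in> K0 v \<pi>
        \<Longrightarrow> a (k1 ** h ** k2) = a h"
  shows "(\<lambda>g x. a g * x) \<in> hecke v (G0 \<pi>) (K0 v \<pi>) (*) trivial_rep"
proof -
  have s: "supp (\<lambda>g x. a g * x) = {g. a g \<noteq> 0}"
    unfolding supp_def by (auto simp: fun_eq_iff)
  have "Vector_Spaces.linear (*) (*) (\<lambda>x. a h * x)" for h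
    by unfold_locales (simp_all add: algebra_simps)
  then show ?thesis
    unfolding hecke_def mem_Collect_eq s using supp KM_subset_G0 inv by (auto simp: trivial_rep_def
        fun_eq_iff)
qed

definition D_ind :: "'f mat4 \<Rightarrow> 'c::field \<Rightarrow> 'c" where
  "D_ind = (\<lambda>g x. (if g \<in> KM - K0 v \<pi> then 1 else 0) * x)"

lemma supp_D_ind: "supp (D_ind :: 'f mat4 \<Rightarrow> 'c::field \<Rightarrow> 'c) = KM - K0 v \<pi>"
  unfolding supp_def D_ind_def by (auto simp: fun_eq_iff intro: exI[of _ 1])

lemma D_ind_in_hecke: "D_ind \<in> hecke v (G0 \<pi>) (K0 v \<pi>) (*) trivial_rep"
  unfolding D_ind_def
proof (rule scalar_in_hecke)
  have "{g. (if g \<in> KM - K0 v \<pi> then 1 else 0 :: 'a) \<noteq> 0} = KM - K0 v \<pi>" by auto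
  then show "{g. (if g \<in> KM - K0 v \<pi> then 1 else 0 :: 'a) \<noteq> 0} \<subseteq> KM"
    "compactin (mat_topology v) {g. (if g \<in> KM - K0 v \<pi> then 1 else 0 :: 'a) \<noteq> 0}"
    using compactin_KM_minus_K0 by auto
  show "(if k1 ** h ** k2 \<in> KM - K0 v \<pi> then 1 else 0 :: 'a) = (if h \<in> KM - K0 v \<pi> then
      1 else 0)"
    if "k1 \<in> K0 v \<pi>" "k2 \<in> K0 v \<pi>" for k1 h k2
    using KM_bi_invariant[of k1 k2 h] K0_bi_invariant[OF that, of h] that K0_subset_KM by auto
qed

definition D_cosets :: "'f mat4 set set" where
  "D_cosets = {h <#\<^bsub>Sp4\<^esub> K0 v \<pi> | h. h \<in> KM - K0 v \<pi>}"

lemma K0_coset_iff: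
  assumes "g \<in> KM" "h \<in> KM"
  shows "h <#\<^bsub>Sp4\<^esub> K0 v \<pi> = g <#\<^bsub>Sp4\<^esub> K0 v \<pi> \<longleftrightarrow>
      sp_inv h ** g \<in> K0 v \<pi>"
proof
  have S: "g \<in> carrier Sp4" "h \<in> carrier Sp4" using assms by (simp_all add: KM_def)
  assume "h <#\<^bsub>Sp4\<^esub> K0 v \<pi> = g <#\<^bsub>Sp4\<^esub> K0 v \<pi>"
  moreover have "g ** mat 1 \<in> g <#\<^bsub>Sp4\<^esub> K0 v \<pi>" unfolding l_coset_Sp4 using
      K0_one by blast
  ultimately obtain k where "k \<in> K0 v \<pi>" "g = h ** k" unfolding l_coset_Sp4 by auto
  then show "sp_inv h ** g \<in> K0 v \<pi>" using S by (simp add: sp_inv_cancel)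
next
  have S: "g \<in> carrier Sp4" "h \<in> carrier Sp4" using assms by (simp_all add: KM_def)
  assume k: "sp_inv h ** g \<in> K0 v \<pi>"
  have 1: "h ** x = g ** (sp_inv (sp_inv h ** g) ** x)" for x
    using S by (simp add: sp_inv_mult matrix_mul_assoc sp_inv_cancel sp_inv_right)
  have 2: "g ** x = h ** ((sp_inv h ** g) ** x)" for x
    using S by (simp add: matrix_mul_assoc sp_inv_cancel sp_inv_right)
  show "h <#\<^bsub>Sp4\<^esub> K0 v \<pi> = g <#\<^bsub>Sp4\<^esub> K0 v \<pi>"
    unfolding l_coset_Sp4
  proof (intro equalityI image_subsetI)
    show "h ** x \<in> (**) g ` K0 v \<pi>" if "x \<in> K0 v \<pi>" for x
      using K0_mult[OF K0_sp_inv[OF k] that] unfolding 1 by blast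
    show "g ** x \<in> (**) h ` K0 v \<pi>" if "x \<in> K0 v \<pi>" for x
      using K0_mult[OF k that] unfolding 2 by blast
  qed
qed

text \<open>For g in \<open>KM\<close>, a coset of h contributes unless the inverse of h times g
  falls into \<open>K0\<close>, which happens for the coset of g alone. So all cosets but that one
  are counted.\<close>

lemma D_conv:
  "hecke_conv (K0 v \<pi>) D_ind D_ind = (\<lambda>g x. (if g \<in> KM then
     of_nat (card (D_cosets - {g <#\<^bsub>Sp4\<^esub> K0 v \<pi>})) else 0) * (x :: 'c::field))"
proof (intro ext)
  fix g :: "'f mat4" and x :: 'c
  have summand: "(let h = SOME h. h \<in> C in D_ind h (D_ind (inv\<^bsub>Sp4\<^esub> h ** g) x))
      = (if g \<in> KM \<and> C \<noteq> g <#\<^bsub>Sp4\<^esub> K0 v \<pi> then x else 0)" if C_in: "C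
          \<in> D_cosets" for C
  proof -
    obtain h where h: "h \<in> KM" "h \<notin> K0 v \<pi>" "C = h <#\<^bsub>Sp4\<^esub> K0 v \<pi>"
      using C_in unfolding D_cosets_def by blast
    have "h ** mat 1 \<in> C" unfolding h l_coset_Sp4 using K0_one by blast
    then have "(SOME h. h \<in> C) \<in> C" by (rule someI)
    then obtain k where k: "k \<in> K0 v \<pi>" "(SOME h. h \<in> C) = h ** k" unfolding h l_coset_Sp4
        by blast
    let ?h = "h ** k"
    have kM: "k \<in> KM" using k K0_subset_KM by blast
    have hM: "?h \<in> KM" using h kM KM_mult by blast
    have hD: "?h \<notin> K0 v \<pi>" using K0_bi_invariant[OF K0_one k(1), of h] h by simp
    have S: "?h \<in> carrier Sp4" using hM by (simp add: KM_def)
    have C: "C = ?h <#\<^bsub>Sp4\<^esub> K0 v \<pi>"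
      unfolding h K0_coset_iff[OF hM h(1)] using k h by (simp add: sp_inv_cancel KM_def)
    have "sp_inv ?h ** g \<in> KM \<longleftrightarrow> g \<in> KM"
      using KM_bi_invariant[OF KM_sp_inv[OF hM] KM_one, of g] by simp
    moreover have "sp_inv ?h ** g \<in> K0 v \<pi> \<longleftrightarrow> C = g <#\<^bsub>Sp4\<^esub> K0
        v \<pi>" if "g \<in> KM"
      unfolding C K0_coset_iff[OF that hM] ..
    ultimately show ?thesis
      unfolding k(2) Let_def using hM hD S by (auto simp: D_ind_def inv_Sp4)
  qed
  have "hecke_conv (K0 v \<pi>) D_ind D_ind g x
      = (\<Sum>C\<in>D_cosets. if g \<in> KM \<and> C \<noteq> g <#\<^bsub>Sp4\<^esub> K0 v \<pi> then
          x else 0)"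
    unfolding hecke_conv_def supp_D_ind D_cosets_def[symmetric] by (intro sum.cong refl summand)
  also have "\<dots> = (if g \<in> KM then of_nat (card (D_cosets - {g <#\<^bsub>Sp4\<^esub> K0 v
      \<pi>})) else 0) * x"
  \<comment> \<open>Sums and \<open>card\<close> both default to 0 on infinite sets, so the formula
    can precede \<open>finite_D_cosets\<close>.\<close>
  proof (cases "g \<in> KM \<and> finite D_cosets")
    case True
    then have "(\<Sum>C\<in>D_cosets. if g \<in> KM \<and> C \<noteq> g <#\<^bsub>Sp4\<^esub> K0 v
        \<pi> then x else 0)
      = (\<Sum>C\<in>D_cosets - {g <#\<^bsub>Sp4\<^esub> K0 v \<pi>}. x)"
      by (intro sum.mono_neutral_cong_right) auto
    then show ?thesis using True by simp
  qed auto
  finally show "hecke_conv (K0 v \<pi>) D_ind D_ind g x = (if g \<in> KM then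
     of_nat (card (D_cosets - {g <#\<^bsub>Sp4\<^esub> K0 v \<pi>})) else 0) * x" .
qed

lemma finite_D_cosets: "finite D_cosets"
proof -
  have "D_cosets \<subseteq> (\<lambda>y. (e23 y ** weyl) <#\<^bsub>Sp4\<^esub> K0 v \<pi>) ` residue_reps"
  proof
    fix C assume "C \<in> D_cosets"
    then obtain h where h: "h \<in> KM" "h \<notin> K0 v \<pi>" "C = h <#\<^bsub>Sp4\<^esub> K0 v \<pi>"
      unfolding D_cosets_def by blast
    obtain y where y: "y \<in> residue_reps" "sp_inv (e23 y ** weyl) ** h \<in> K0 v \<pi>" using
        K0_cover[OF h(1,2)] .
    have "e23 y ** weyl \<in> KM"
      using e23_K0[OF residue_reps_vge[OF y(1)]] K0_subset_KM KM_weyl KM_mult by blast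
    then have "C = (e23 y ** weyl) <#\<^bsub>Sp4\<^esub> K0 v \<pi>"
      unfolding h(3) using K0_coset_iff[OF h(1)] y(2) by metis
    then show "C \<in> (\<lambda>y. (e23 y ** weyl) <#\<^bsub>Sp4\<^esub> K0 v \<pi>) ` residue_reps"
        using y(1) by blast
  qed
  then show ?thesis using finite_residue_reps finite_surj by blast
qed

text \<open>The cosets of \<open>weyl\<close> and \<open>e23 1 ** weyl\<close> are distinct, so one
  remains whichever is removed. In characteristic 0 the count then stays nonzero as a
  coefficient.\<close>

lemma card_D_cosets_minus: "card (D_cosets - {C}) \<noteq> 0"
proof -
  have one: "e23 1 ** weyl \<in> KM" using e23_K0[OF vge_one] K0_subset_KM KM_weyl KM_mult by blast
  have w: "weyl \<notin> K0 v \<pi>" unfolding K0_eq by (simp add: weyl_def vector_4 not_vge_1_one)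
  have "e23 1 ** weyl \<notin> K0 v \<pi>"
    unfolding K0_eq by (simp add: e_defs weyl_def matrix_matrix_mult_def sum_4 vector_4 not_vge_1_one)
  then have "weyl <#\<^bsub>Sp4\<^esub> K0 v \<pi> \<in> D_cosets" "(e23 1 ** weyl)
      <#\<^bsub>Sp4\<^esub> K0 v \<pi> \<in> D_cosets"
    unfolding D_cosets_def using one w KM_weyl by blast+
  moreover have "weyl <#\<^bsub>Sp4\<^esub> K0 v \<pi> \<noteq> (e23 1 ** weyl) <#\<^bsub>Sp4\<^esub>
      K0 v \<pi>"
    unfolding K0_coset_iff[OF one KM_weyl] unfolding K0_eq
    by (simp add: e_defs weyl_def sp_inv_def matrix_matrix_mult_def sum_4 vector_4 not_vge_1_one)
  ultimately have "D_cosets - {C} \<noteq> {}" by blast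
  then show ?thesis using finite_D_cosets by simp
qed

lemma supp_D_conv: "supp (hecke_conv (K0 v \<pi>) D_ind (D_ind :: 'f mat4 \<Rightarrow>
    'c::field_char_0 \<Rightarrow> 'c)) = KM"
  unfolding D_conv supp_def using card_D_cosets_minus by (auto simp: fun_eq_iff intro: exI[of _ 1])

text \<open>Support preservation speaks only of members of the algebra, so the square has to be
  shown to be one. Its values are bi-invariant because the count depends only on whether g lies in
  \<open>K0\<close>.\<close>

lemma D_conv_in_hecke:
  "hecke_conv (K0 v \<pi>) D_ind (D_ind :: 'f mat4 \<Rightarrow> 'c::field_char_0 \<Rightarrow> 'c)
     \<in> hecke v (G0 \<pi>) (K0 v \<pi>) (*) trivial_rep"
  unfolding D_conv
proof (rule scalar_in_hecke)
  let ?a = "\<lambda>g. if g \<in> KM then of_nat (card (D_cosets - {g <#\<^bsub>Sp4\<^esub> K0 v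
      \<pi>})) else 0 :: 'c"
  have nonzero: "{g. ?a g \<noteq> 0} = KM"
  proof (intro equalityI subsetI)
    fix g
    have card: "of_nat (card (D_cosets - {g <#\<^bsub>Sp4\<^esub> K0 v \<pi>})) \<noteq> (0 :: 'c)"
      using card_D_cosets_minus by (simp only: of_nat_eq_0_iff not_False_eq_True)
    show "g \<in> KM" if "g \<in> {g. ?a g \<noteq> 0}" using that by (simp split: if_splits)
    show "g \<in> {g. ?a g \<noteq> 0}" if "g \<in> KM" using that card by simp
  qed
  show "{g. ?a g \<noteq> 0} \<subseteq> KM" unfolding nonzero ..
  show "compactin (mat_topology v) {g. ?a g \<noteq> 0}" unfolding nonzero by (rule compactin_KM)
  have mem: "g <#\<^bsub>Sp4\<^esub> K0 v \<pi> \<in> D_cosets \<longleftrightarrow> g \<notin> K0 v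
      \<pi>" if g: "g \<in> KM" for g
  proof
    assume "g <#\<^bsub>Sp4\<^esub> K0 v \<pi> \<in> D_cosets"
    then obtain h where h: "h \<in> KM" "h \<notin> K0 v \<pi>" and gh: "g <#\<^bsub>Sp4\<^esub> K0 v
        \<pi> = h <#\<^bsub>Sp4\<^esub> K0 v \<pi>"
      unfolding D_cosets_def by blast
    have "sp_inv g ** h \<in> K0 v \<pi>" using gh unfolding K0_coset_iff[OF h(1) g] .
    then have "h \<in> K0 v \<pi>" if "g \<in> K0 v \<pi>"
      using K0_mult[OF that] g by (metis (no_types, lifting) KM_def mem_Collect_eq sp_inv_cancel(2))
    then show "g \<notin> K0 v \<pi>" using h(2) by blast
  next
    assume "g \<notin> K0 v \<pi>"
    then show "g <#\<^bsub>Sp4\<^esub> K0 v \<pi> \<in> D_cosets" unfolding D_cosets_def using g by blast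
  qed
  have card: "card (D_cosets - {g <#\<^bsub>Sp4\<^esub> K0 v \<pi>}) = (if g \<in> K0 v \<pi> then card
      D_cosets else card D_cosets - 1)"
    if g: "g \<in> KM" for g
  proof (cases "g \<in> K0 v \<pi>")
    case True
    then have "D_cosets - {g <#\<^bsub>Sp4\<^esub> K0 v \<pi>} = D_cosets" using mem[OF g] by blast
    then show ?thesis using True by simp
  next
    case False
    then show ?thesis using card_Diff_singleton[of "g <#\<^bsub>Sp4\<^esub> K0 v \<pi>" D_cosets]
        mem[OF g] by simp
  qed
  fix k1 h k2 assume k: "k1 \<in> K0 v \<pi>" "k2 \<in> K0 v \<pi>"
  have "k1 \<in> KM" "k2 \<in> KM" using k K0_subset_KM by auto
  note iff = KM_bi_invariant[OF this, of h] K0_bi_invariant[OF k, of h]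
  show "?a (k1 ** h ** k2) = ?a h"
  proof (cases "h \<in> KM")
    case True
    then have "k1 ** h ** k2 \<in> KM" using iff(1) by blast
    then show ?thesis using True by (simp only: card iff(2) if_True)
  next
    case False
    then show ?thesis using iff(1) by simp
  qed
qed

end

section \<open>The Hecke algebra of the Kim--Yu pair\<close>

context ramified_setup
begin

lemma residue_rep_eq_iff: "vge 0 x \<Longrightarrow> vge 0 y \<Longrightarrow> residue_rep x =
    residue_rep y \<longleftrightarrow> vge 1 (x - y)"
  using vge_diff[OF residue_rep(2) residue_rep(2), of x y] residue_rep_eq by auto

definition unit_reps :: "'f set" where "unit_reps = {y \<in> residue_reps. \<not> vge 1 y}"

lemma residue_rep_zero: "vge 1 (residue_rep 0)"
  using residue_rep(2)[of 0] by simp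

lemma residue_reps_split: "residue_reps = insert (residue_rep 0) unit_reps" "residue_rep 0 \<notin>
    unit_reps" "finite unit_reps"
  unfolding unit_reps_def using residue_rep_zero residue_rep_in_reps[of 0] residue_reps_eqI vge_diff
      finite_residue_reps by auto

lemma unit_reps_val: "y \<in> unit_reps \<Longrightarrow> vge 0 y" "y \<in> unit_reps \<Longrightarrow>
    \<not> vge 1 y" "y \<in> unit_reps \<Longrightarrow> y \<noteq> 0" "y \<in> unit_reps
    \<Longrightarrow> v y = 0"
  using residue_reps_vge unit_val by (auto simp: unit_reps_def)

lemma residue_rep_unit: "vge 0 x \<Longrightarrow> \<not> vge 1 x \<Longrightarrow> residue_rep x \<in>
    unit_reps"
  unfolding unit_reps_def using residue_rep_in_reps not_vge_1_diff[OF residue_rep(2)] by simp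

end

locale kim_yu_datum = ramified_setup v \<pi> p \<epsilon> s w
  for v :: "'f::field \<Rightarrow> real" and \<pi> p and \<epsilon> :: "'f \<Rightarrow> 'e::field"
      and s w +
  fixes \<Psi> :: "'f \<Rightarrow> 'c::field_char_0" and \<iota> :: "'c \<Rightarrow> 'k::{finite,
      field}" and \<phi> :: "'f mat4 \<Rightarrow> 'c"
    and sc :: "'c \<Rightarrow> 'w::ab_group_add \<Rightarrow> 'w" and \<rho> :: "'f mat4 \<Rightarrow>
        'w \<Rightarrow> 'w"
  assumes char: "level_zero_additive_char v \<Psi>" and iso: "root_of_unity_iso p \<iota>"
    and phi: "is_phi v \<pi> \<epsilon> s w \<Psi> \<phi>"
    and kim_yu: "nontwisted_kim_yu_rep v \<pi> p \<epsilon> s w \<iota> \<phi> sc \<rho>"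
begin

section \<open>Character sums over the residue field\<close>

lemma psi_add: "\<Psi> (x + y) = \<Psi> x * \<Psi> y"
  using char unfolding level_zero_additive_char_def by blast

lemma psi_one: "vge 1 x \<Longrightarrow> \<Psi> x = 1"
  using char max_ideal_iff unfolding level_zero_additive_char_def by blast

lemma psi_cong: "vge 1 (x - y) \<Longrightarrow> \<Psi> x = \<Psi> y"
  using psi_add[of "x - y" y] psi_one[of "x - y"] by simp

lemma psi_power: "\<Psi> x ^ n = \<Psi> (of_nat n * x)"
  by (induction n) (simp_all add: psi_add psi_one distrib_right)

text \<open>\<open>\<iota>\<close> is controlled only on p-th roots of unity; this puts the values
  of \<open>\<Psi>\<close> on integers within its reach.\<close>

lemma psi_root_of_unity: "vge 0 x \<Longrightarrow> \<Psi> x ^ p = 1"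
  using res_char max_ideal_iff psi_one vge_1_mult(1) unfolding psi_power residue_char_def by blast

text \<open>Translation by an integral \<open>a\<close> with \<open>\<Psi> a \<noteq> 1\<close>
  permutes the residues and multiplies the sum by \<open>\<Psi> a\<close>.\<close>

lemma psi_sum: "(\<Sum>z\<in>residue_reps. \<Psi> z) = 0"
proof -
  obtain a where a: "vge 0 a" "\<Psi> a \<noteq> 1"
    using char unfolding level_zero_additive_char_def by blast
  have inj: "inj_on (\<lambda>z. residue_rep (z + a)) residue_reps"
    by (rule inj_onI) (use a residue_reps_vge residue_reps_eqI residue_rep_eq_iff vge_add in force)
  have "(\<lambda>z. residue_rep (z + a)) ` residue_reps = residue_reps"
    by (rule endo_inj_surj[OF finite_residue_reps _ inj]) (use a residue_reps_vge residue_rep_in_reps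
        vge_add in auto)
  then have "(\<Sum>z\<in>residue_reps. \<Psi> z) = (\<Sum>z\<in>residue_reps. \<Psi> (residue_rep (z +
      a)))"
    using sum.reindex[OF inj, of \<Psi>] by simp
  also have "\<dots> = (\<Sum>z\<in>residue_reps. \<Psi> z * \<Psi> a)"
  proof (intro sum.cong refl)
    fix z assume "z \<in> residue_reps"
    then have "vge 0 (z + a)" using a residue_reps_vge vge_add by blast
    then show "\<Psi> (residue_rep (z + a)) = \<Psi> z * \<Psi> a" by (metis psi_cong psi_add
        residue_rep(2))
  qed
  also have "\<dots> = (\<Sum>z\<in>residue_reps. \<Psi> z) * \<Psi> a" by (simp add: sum_distrib_right)
  finally have "(\<Sum>z\<in>residue_reps. \<Psi> z) * (1 - \<Psi> a) = 0" by (simp add: algebra_simps)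
  then show ?thesis using a by simp
qed

lemma psi_sum_units: "(\<Sum>z\<in>unit_reps. \<Psi> z) = - 1"
proof -
  have "1 + (\<Sum>z\<in>unit_reps. \<Psi> z) = 0" using psi_sum residue_reps_split psi_one[OF
      residue_rep_zero] by simp
  then show ?thesis by (simp add: eq_neg_iff_add_eq_0 add.commute)
qed

text \<open>The map y |-> b / y permutes the nonzero residues.\<close>

lemma psi_sum_quotients:
  assumes b: "vge 0 b" "\<not> vge 1 b"
  shows "(\<Sum>y\<in>unit_reps. \<Psi> (b / y)) = - 1"
proof -
  have q: "vge 0 (b / y)" "\<not> vge 1 (b / y)" if "y \<in> unit_reps" for y
    using vge_0_divide[OF b(1)] unit_reps_val[OF that] vge_1_mult(1)[of "b / y" y] b by auto
  have inj: "inj_on (\<lambda>y. residue_rep (b / y)) unit_reps"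
  proof (rule inj_onI)
    fix y z assume yz: "y \<in> unit_reps" "z \<in> unit_reps" "residue_rep (b / y) = residue_rep (b / z)"
    then have "vge 1 (b / y - b / z)" using residue_rep_eq_iff q by simp
    then have "vge 1 ((b / y - b / z) * (y * z))"
      using yz unit_reps_val by (intro vge_1_mult(1) vge_0_mult)
    moreover have "(b / y - b / z) * (y * z) = b * (z - y)"
      using unit_reps_val yz by (simp add: field_simps)
    moreover have "b \<noteq> 0" using b by auto
    ultimately have "vge 1 (z - y)" using vge_1_divide[of "b * (z - y)" b] b by simp
    then show "y = z" using residue_reps_eqI[of z y] yz by (simp add: unit_reps_def)
  qed
  have "(\<lambda>y. residue_rep (b / y)) ` unit_reps = unit_reps"
    by (rule endo_inj_surj[OF residue_reps_split(3) _ inj]) (use q residue_rep_unit in auto)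
  then have "(\<Sum>y\<in>unit_reps. \<Psi> y) = (\<Sum>y\<in>unit_reps. \<Psi> (residue_rep (b / y)))"
    using sum.reindex[OF inj, of \<Psi>] by simp
  also have "\<dots> = (\<Sum>y\<in>unit_reps. \<Psi> (b / y))"
    using psi_cong[OF residue_rep(2)] q by (intro sum.cong refl) auto
  finally show ?thesis using psi_sum_units by simp
qed

lemma psi_double_sum: "(\<Sum>y\<in>unit_reps. \<Sum>x\<in>residue_reps. \<Psi> (x ^ 2 / y)) = 0"
proof -
  have "(\<Sum>y\<in>unit_reps. \<Sum>x\<in>residue_reps. \<Psi> (x ^ 2 / y)) =
      (\<Sum>x\<in>residue_reps. \<Sum>y\<in>unit_reps. \<Psi> (x ^ 2 / y))"
    by (rule sum.swap)
  also have "\<dots> = (\<Sum>y\<in>unit_reps. \<Psi> (residue_rep 0 ^ 2 / y)) +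
      (\<Sum>x\<in>unit_reps. \<Sum>y\<in>unit_reps. \<Psi> (x ^ 2 / y))"
    using residue_reps_split by simp
  also have "(\<Sum>y\<in>unit_reps. \<Psi> (residue_rep 0 ^ 2 / y)) = (\<Sum>y\<in>unit_reps. 1)"
    using unit_reps_val residue_rep_zero vge_1_0 unfolding power2_eq_square
    by (intro sum.cong refl psi_one vge_1_divide vge_1_mult(1))
  also have "(\<Sum>x\<in>unit_reps. \<Sum>y\<in>unit_reps. \<Psi> (x ^ 2 / y)) =
      (\<Sum>x\<in>unit_reps. - 1)"
    using unit_reps_val vge_0_mult not_vge_1_mult unfolding power2_eq_square
    by (intro sum.cong refl psi_sum_quotients) auto
  finally show ?thesis by (simp add: sum_negf)
qed

section \<open>Values of \<open>\<phi>\<close> and of its extension\<close>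

lemma phi_u1_param:
  assumes t: "vge 1 t"
  shows "\<phi> (u1_param t) = \<Psi> (4 * t / \<pi>)"
proof -
  let ?b = "2 * t / (1 - t ^ 2 / \<pi>)"
  \<comment> \<open>The first-order part of \<open>u1_param t - mat 1\<close>. The remainder has
    depth above 1/2, so the condition on \<open>\<phi>\<close> at depth 1/2 applies with this
    \<open>Y\<close>.\<close>
  define Y :: "'f mat4" where
    "Y = vector [vector [0, 0, 0, 2 * t], 0, 0, vector [2 * t / \<pi>, 0, 0, 0]]"
  have t2: "vge 1 (2 * t)" using t two_unit vge_mult'[of 2 0 t 1] by (simp add: vge_iff[of 2])
  have t3: "vge 0 (2 * t / \<pi>)" using vge_divide[OF t2, of \<pi> 0] by simp
  have lie: "Y \<in> lie_sp4" by (simp add: lie_sp4_iff Y_def vector_4)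
  have "X_fun \<pi> (Y ** A - A ** Y) = 0" if "A \<in> lie_sp4" for A
    using that unfolding lie_sp4_iff X_fun_def Y_def
    by (simp add: matrix_matrix_mult_def sum_4 vector_4 field_simps)
  then have "Y \<in> lie_G0 \<pi>" using lie by (simp add: lie_G0_def)
  moreover have "Y \<in> gl4_fil v (At (1/2))"
    unfolding gl4_At_iff forall_4 using t2 t3 by (simp add: Y_def vector_4 x0_wt_def)
  moreover have "u1_param t - mat 1 - Y \<in> gl4_fil v (After (1/2))"
  proof -
    have d: "vge 2 (?b - 2 * t)" using u1_entries(2)[OF t] .
    have "vge 1 ((?b - 2 * t) / \<pi>)" using vge_divide[OF d, of \<pi> 1] by simp
    then have d': "vge 1 (?b * inverse \<pi> - 2 * t / \<pi>)" by (simp add: divide_inverse algebra_simps)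
    have pos: "x = 0 \<or> reaches (After (1/2)) (v x + r)" if "vge n x" "1/2 < n + r" for x n r
      using that by (auto simp: vge_iff)
    have "u1_param t - mat 1 - Y = vector [vector [(1 + t ^ 2 / \<pi>) / (1 - t ^ 2 / \<pi>) - 1, 0, 0,
        ?b - 2 * t], 0, 0,
        vector [?b * inverse \<pi> - 2 * t / \<pi>, 0, 0, (1 + t ^ 2 / \<pi>) / (1 - t ^ 2 / \<pi>) - 1]]"
      by (simp add: u1_param_def G0_elt_def Y_def vec_eq_iff forall_4 vector_4 mat_def)
    then show ?thesis
      unfolding gl4_fil_def mem_Collect_eq root_at_x0_wt forall_4
      using pos[OF u1_entries(1)[OF t], of 0] pos[OF d, of "- 1/2"] pos[OF d', of "1/2"]
      by (simp only: vector_4 x0_wt_def) simp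
  qed
  ultimately have "\<phi> (u1_param t) = \<Psi> (X_fun \<pi> Y)"
    using phi u1_param_G0_fil[OF t] unfolding is_phi_def by blast
  also have "X_fun \<pi> Y = 4 * t / \<pi>" by (simp add: X_fun_eq Y_def vector_4)
  finally show ?thesis .
qed

text \<open>\<open>\<phi>h\<close> is prescribed only on \<open>K0\<close> and
  \<open>J_plus_plus\<close>. The factorization through the norm-one torus, whose elements
  \<open>u1_param t\<close> are in \<open>K0\<close>, reduces every value to these two.\<close>

lemma phi_hat_cong_gp:
  assumes hat: "is_phi_hat v \<pi> \<epsilon> s w \<phi> \<phi>h" and g: "g \<in> cong_gp (1/4)"
  shows "\<phi>h g = \<Psi> (X_fun \<pi> (g - mat 1))"
proof -
  obtain t g1 where t: "vge 1 t" "g = u1_param t ** g1" "g1 \<in> J_plus_plus \<epsilon> s w"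
    "vge 1 (X_fun \<pi> (g - mat 1) - 4 * t / \<pi>)"
    using cong_gp_factor[OF g] by blast
  let ?D = "K0 v \<pi> <#>\<^bsub>Sp4\<^esub> J_plus \<epsilon> s w"
  have one: "mat 1 \<in> J_plus \<epsilon> s w"
    unfolding J_plus_eq by (simp add: cong_gp_def gl4_At_iff)
  have "u1_param t ** mat 1 \<in> ?D" "mat 1 ** g1 \<in> ?D"
    unfolding set_mult_def Sp4_simps using u1_param_K0[OF t(1)] one K0_one t(3) yu_gens_mono(1) by blast+
  then have D: "u1_param t \<in> ?D" "g1 \<in> ?D" by simp_all
  have "\<phi>h g = \<phi>h (u1_param t) * \<phi>h g1"
    unfolding t(2) using hat D unfolding is_phi_hat_def Let_def by blast
  moreover have "\<phi>h (u1_param t) = \<phi> (u1_param t)" "\<phi>h g1 = 1"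
    using hat u1_param_K0[OF t(1)] t(3) unfolding is_phi_hat_def Let_def by blast+
  ultimately show ?thesis using phi_u1_param[OF t(1)] psi_cong[OF t(4)] by simp
qed

section \<open>Triviality of \<open>V_space\<close> and scalar action of
  \<open>\<rho>\<close>\<close>

lemma subgroup_cong_gp: "subgroup (cong_gp (1/4)) Sp4"
proof (rule Sp4.subgroupI)
  show "cong_gp (1/4) \<subseteq> carrier Sp4" by (auto simp: cong_gp_def)
  have "mat 1 \<in> cong_gp (1/4)" by (simp add: cong_gp_def gl4_At_iff)
  then show "cong_gp (1/4) \<noteq> {}" by blast
  show "inv\<^bsub>Sp4\<^esub> g \<in> cong_gp (1/4)" if "g \<in> cong_gp (1/4)" for g
  proof -
    have "g \<in> carrier Sp4" using that by (simp add: cong_gp_def)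
    then show ?thesis using cong_gp_sp_inv[OF _ that] by (simp add: inv_Sp4)
  qed
  show "g \<otimes>\<^bsub>Sp4\<^esub> h \<in> cong_gp (1/4)" if "g \<in> cong_gp (1/4)" "h \<in>
      cong_gp (1/4)" for g h
    using cong_gp_mult[OF _ that] by simp
qed

lemma V_space_carrier: "carrier (V_space \<epsilon> s w) = {cong_gp (1/4)}" "\<one>\<^bsub>V_space
    \<epsilon> s w\<^esub> = cong_gp (1/4)"
proof -
  have "mat 1 \<in> cong_gp (1/4)" by (simp add: cong_gp_def gl4_At_iff)
  moreover have "cong_gp (1/4) #>\<^bsub>Sp4\<^esub> x = cong_gp (1/4)" if "x \<in> cong_gp (1/4)" for x
    using Sp4.coset_join2[OF _ subgroup_cong_gp that] that by (simp add: cong_gp_def)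
  ultimately show "carrier (V_space \<epsilon> s w) = {cong_gp (1/4)}"
    unfolding V_space_def carrier_FactGroup J_gp_eq J_plus_eq by auto
  show "\<one>\<^bsub>V_space \<epsilon> s w\<^esub> = cong_gp (1/4)" by (simp add: V_space_def J_plus_eq)
qed

lemma Ad_V_trivial:
  assumes k: "k \<in> K0 v \<pi>"
  shows "Ad_V (V_space \<epsilon> s w) k = \<one>\<^bsub>symp_gp (V_space \<epsilon> s w) form\<^esub>"
proof -
  have kS: "k \<in> carrier Sp4" using k K0_KP by (auto simp: KP_def)
  have kgl: "k \<in> gl4_fil v (At 0)" "sp_inv k \<in> gl4_fil v (At 0)"
    using k K0_sp_inv[OF k] K0_KP KP_gl4 by blast+
  have "conj_by k ` cong_gp (1/4) = cong_gp (1/4)"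
  proof (intro equalityI image_subsetI subsetI)
    show "conj_by k g \<in> cong_gp (1/4)" if "g \<in> cong_gp (1/4)" for g
      by (rule cong_gp_conj[OF kS kgl(1) that])
    show "g \<in> conj_by k ` cong_gp (1/4)" if "g \<in> cong_gp (1/4)" for g
    proof (rule image_eqI)
      show "conj_by (sp_inv k) g \<in> cong_gp (1/4)"
        by (rule cong_gp_conj[OF _ kgl(2) that]) (simp add: kS)
      show "g = conj_by k (conj_by (sp_inv k) g)"
        using kS by (simp add: conj_by_eq matrix_mul_assoc sp_inv_cancel sp_inv_right)
    qed
  qed
  then show ?thesis
    unfolding Ad_V_def symp_gp_def BijGroup_def V_space_carrier by (auto simp: restrict_def fun_eq_iff)
qed

lemma rho_rep: "is_rep (Sp4\<lparr>carrier := KP\<rparr>) sc \<rho>"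
  using kim_yu unfolding nontwisted_kim_yu_rep_def K_gp_eq by blast

lemma sc_vector_space: "vector_space sc"
  using rho_rep unfolding is_rep_def by blast

lemma sc_module: "module sc"
  using sc_vector_space unfolding module_iff_vector_space .

lemma sc_one: "sc 1 x = x"
  using sc_vector_space by (simp add: vector_space_def)

lemma rho_one: "\<rho> (mat 1) = id"
  using rho_rep unfolding is_rep_def by simp

lemma rho_mult: "g \<in> KP \<Longrightarrow> h \<in> KP \<Longrightarrow> \<rho> (g ** h) = \<rho> g
    \<circ> \<rho> h"
  using rho_rep unfolding is_rep_def by simp

text \<open>With \<open>V_space\<close> reduced to one element, \<open>K0\<close> acts through
  \<open>\<omega>\<close> at the identity, which leaves the scalar \<open>\<phi>\<close>. Every
  element of \<open>J_gp\<close> maps to the centre of the Heisenberg group, where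
  \<open>\<omega>\<close> is prescribed.\<close>

lemma rho_K0: "k \<in> K0 v \<pi> \<Longrightarrow> \<rho> k x = sc (\<phi> k) x"
  and rho_cong_gp: "u \<in> cong_gp (1/4) \<Longrightarrow> \<rho> u x = sc (\<Psi> (X_fun \<pi> (u -
      mat 1))) x"
proof -
  let ?V = "V_space \<epsilon> s w"
  obtain \<phi>h j \<omega> where hat: "is_phi_hat v \<pi> \<epsilon> s w \<phi> \<phi>h"
    and special: "special_hom v \<pi> \<epsilon> s w \<iota> \<phi>h j"
    and hw: "heisenberg_weil p \<iota> ?V (V_form \<iota> \<phi>h) sc \<omega>"
    and K: "\<forall>k\<in>K0 v \<pi>. \<forall>x. \<rho> k x = sc (\<phi> k) (\<omega> (Ad_V ?V k,
        \<one>\<^bsub>heis_gp ?V (V_form \<iota> \<phi>h)\<^esub>) x)"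
    and J: "\<forall>u\<in>J_gp \<epsilon> s w. \<rho> u = \<omega> (\<one>\<^bsub>symp_gp ?V (V_form
        \<iota> \<phi>h)\<^esub>, j u)"
    using kim_yu unfolding nontwisted_kim_yu_rep_def Let_def by blast
  have "is_rep (jacobi_gp ?V (V_form \<iota> \<phi>h)) sc \<omega>"
    using hw unfolding heisenberg_weil_def by blast
  then have "\<omega> \<one>\<^bsub>jacobi_gp ?V (V_form \<iota> \<phi>h)\<^esub> = id" unfolding
      is_rep_def by blast
  then have w1: "\<omega> (\<one>\<^bsub>symp_gp ?V (V_form \<iota> \<phi>h)\<^esub>,
      \<one>\<^bsub>heis_gp ?V (V_form \<iota> \<phi>h)\<^esub>) = id"
    by (simp add: jacobi_gp_def)
  show "\<rho> k x = sc (\<phi> k) x" if "k \<in> K0 v \<pi>"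
    using K that w1 Ad_V_trivial[OF that, of "V_form \<iota> \<phi>h"] by simp
  show "\<rho> u x = sc (\<Psi> (X_fun \<pi> (u - mat 1))) x" if u: "u \<in> cong_gp (1/4)"
  proof -
    have "j u = (\<one>\<^bsub>?V\<^esub>, \<iota> (\<phi>h u))"
      using special u unfolding special_hom_def Let_def J_plus_eq by blast
    moreover have "\<omega> (\<one>\<^bsub>symp_gp ?V (V_form \<iota> \<phi>h)\<^esub>,
        (\<one>\<^bsub>?V\<^esub>, a)) = sc (iota_inv p \<iota> a)" for a
      using hw unfolding heisenberg_weil_def by blast
    ultimately have "\<rho> u = sc (iota_inv p \<iota> (\<iota> (\<phi>h u)))"
      using J u unfolding J_gp_eq by simp
    moreover have "\<phi>h u ^ p = 1"
      using phi_hat_cong_gp[OF hat u] psi_root_of_unity[OF X_fun_int[OF u]] by simp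
    then have "iota_inv p \<iota> (\<iota> (\<phi>h u)) = \<phi>h u"
      using iso unfolding iota_inv_def root_of_unity_iso_def bij_betw_def by (intro inv_into_f_f) auto
    ultimately show ?thesis using phi_hat_cong_gp[OF hat u] by simp
  qed
qed

lemma phi_SL2: "det h = 1 \<Longrightarrow> \<phi> (G0_elt \<pi> 1 0 h) = 1"
  using phi unfolding is_phi_def by blast

lemma rho_e23: "vge 0 y \<Longrightarrow> \<rho> (e23 y) = id"
proof -
  assume y: "vge 0 y"
  have "e23 y = G0_elt \<pi> 1 0 (vector [vector [1, y], vector [0, 1]])"
    by (simp add: e23_def G0_elt_def)
  then have "\<phi> (e23 y) = 1" using phi_SL2 by (simp add: det_2)
  then show ?thesis using rho_K0[OF e23_K0[OF y]] by (simp add: fun_eq_iff sc_one)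
qed

lemma rho_torus: "d \<noteq> 0 \<Longrightarrow> v d = 0 \<Longrightarrow> \<rho> (torus_elt 1 d) = id"
proof -
  assume d: "d \<noteq> 0" "v d = 0"
  have "torus_elt 1 d = G0_elt \<pi> 1 0 (vector [vector [d, 0], vector [0, inverse d]])"
    by (simp add: torus_elt_def G0_elt_def)
  then have "\<phi> (torus_elt 1 d) = 1" using phi_SL2 d by (simp add: det_2)
  then show ?thesis using rho_K0[OF torus_K0[OF d]] by (simp add: fun_eq_iff sc_one)
qed

lemma rho_e21: "vge 0 x \<Longrightarrow> \<rho> (e21 x) = id"
  using rho_cong_gp[OF e_cong_gp(1)] psi_one[of 0]
  by (simp add: fun_eq_iff X_fun_def mat_def) (simp add: e21_def vector_4 sc_one)

text \<open>Among the factors in \<open>weyl_relation\<close> other than \<open>weyl\<close> itself,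
  this is the one on which \<open>\<rho>\<close> can be nontrivial.\<close>

lemma rho_e41: "vge 0 x \<Longrightarrow> \<rho> (e41 x) = sc (\<Psi> x)"
  using rho_cong_gp[OF e_cong_gp(2)]
  by (simp add: fun_eq_iff X_fun_def mat_def) (simp add: e41_def vector_4)

section \<open>Convolution over the double coset of \<open>weyl\<close>\<close>

definition KWK :: "'f mat4 set" where
  "KWK = {k ** weyl ** k' | k k'. k \<in> KP \<and> k' \<in> KP}"

lemma KP_coset: "k \<in> KP \<Longrightarrow> h \<in> carrier Sp4 \<Longrightarrow> (h ** k)
    <#\<^bsub>Sp4\<^esub> KP = h <#\<^bsub>Sp4\<^esub> KP"
proof -
  assume k: "k \<in> KP" and h: "h \<in> carrier Sp4"
  have kS: "k \<in> carrier Sp4" using k by (simp add: KP_def)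
  show ?thesis unfolding l_coset_Sp4
  proof (intro equalityI image_subsetI)
    show "h ** k ** x \<in> (**) h ` KP" if "x \<in> KP" for x
      using KP_mult[OF k that] by (auto simp: matrix_mul_assoc[symmetric])
    show "h ** x \<in> (**) (h ** k) ` KP" if "x \<in> KP" for x
    proof (rule image_eqI)
      show "h ** x = h ** k ** (sp_inv k ** x)" using kS by (simp add: matrix_mul_assoc sp_inv_cancel)
      show "sp_inv k ** x \<in> KP" using KP_mult KP_sp_inv k that by blast
    qed
  qed
qed

definition coset_rep :: "'f \<times> 'f \<Rightarrow> 'f mat4" where
  "coset_rep i = e23 (fst i) ** e21 (snd i) ** weyl"

lemma coset_rep_Sp4: "coset_rep i \<in> carrier Sp4"
  by (simp add: coset_rep_def)

lemma e23_e21_KP: "y \<in> residue_reps \<Longrightarrow> x \<in> residue_reps \<Longrightarrow> e23 y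
    ** e21 x \<in> KP"
  by (intro KP_mult e_KP residue_reps_vge)

lemma KWK_cosets: "{h <#\<^bsub>Sp4\<^esub> KP | h. h \<in> KWK} = (\<lambda>i. coset_rep i
    <#\<^bsub>Sp4\<^esub> KP) ` (residue_reps \<times> residue_reps)"
proof (intro equalityI subsetI)
  fix C assume "C \<in> {h <#\<^bsub>Sp4\<^esub> KP | h. h \<in> KWK}"
  then obtain k k' where k: "k \<in> KP" "k' \<in> KP" "C = (k ** weyl ** k') <#\<^bsub>Sp4\<^esub> KP"
    unfolding KWK_def by blast
  obtain y x k'' where yx: "y \<in> residue_reps" "x \<in> residue_reps" "k'' \<in> KP" "k ** weyl =
      e23 y ** e21 x ** weyl ** k''"
    using weyl_cover[OF k(1)] by blast
  have "C = (coset_rep (y, x) ** (k'' ** k')) <#\<^bsub>Sp4\<^esub> KP"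
    unfolding k(3) yx(4) coset_rep_def by (simp add: matrix_mul_assoc)
  also have "\<dots> = coset_rep (y, x) <#\<^bsub>Sp4\<^esub> KP"
    by (rule KP_coset[OF KP_mult[OF yx(3) k(2)] coset_rep_Sp4])
  finally show "C \<in> (\<lambda>i. coset_rep i <#\<^bsub>Sp4\<^esub> KP) ` (residue_reps \<times>
      residue_reps)" using yx by blast
next
  fix C assume "C \<in> (\<lambda>i. coset_rep i <#\<^bsub>Sp4\<^esub> KP) ` (residue_reps \<times>
      residue_reps)"
  then obtain y x where yx: "y \<in> residue_reps" "x \<in> residue_reps" "C = coset_rep (y, x)
      <#\<^bsub>Sp4\<^esub> KP" by blast
  have "coset_rep (y, x) = e23 y ** e21 x ** weyl ** mat 1" by (simp add: coset_rep_def)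
  then have "coset_rep (y, x) \<in> KWK" unfolding KWK_def using e23_e21_KP[OF yx(1,2)] KP_one by blast
  then show "C \<in> {h <#\<^bsub>Sp4\<^esub> KP | h. h \<in> KWK}" using yx by blast
qed

lemma inj_coset_rep: "inj_on (\<lambda>i. coset_rep i <#\<^bsub>Sp4\<^esub> KP) (residue_reps \<times>
    residue_reps)"
proof (rule inj_onI)
  fix i i' assume i: "i \<in> residue_reps \<times> residue_reps" "i' \<in> residue_reps \<times>
      residue_reps" and eq: "coset_rep i <#\<^bsub>Sp4\<^esub> KP = coset_rep i' <#\<^bsub>Sp4\<^esub> KP"
  have "coset_rep i' ** mat 1 \<in> coset_rep i' <#\<^bsub>Sp4\<^esub> KP" unfolding l_coset_Sp4 using
      KP_one by blast
  then have "coset_rep i' \<in> coset_rep i <#\<^bsub>Sp4\<^esub> KP" unfolding eq by simp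
  then obtain k where "k \<in> KP" "coset_rep i' = coset_rep i ** k" unfolding l_coset_Sp4 by blast
  then have "sp_inv (coset_rep i) ** coset_rep i' \<in> KP" using coset_rep_Sp4 by (simp add: sp_inv_cancel)
  then show "i = i'"
    using weyl_coset_inj[of "fst i" "snd i" "fst i'" "snd i'"] i unfolding coset_rep_def
    by (auto simp: prod_eq_iff)
qed

lemma weyl_square_vanishes:
  assumes T: "T \<in> hecke v (carrier Sp4) KP sc \<rho>" and supp: "supp T = KWK"
  shows "hecke_conv KP T T weyl z = 0"
proof -
  have KS: "KP \<subseteq> carrier Sp4" by (auto simp: KP_def)
  have bi: "T (k1 ** h ** k2) = \<rho> k1 \<circ> T h \<circ> \<rho> k2" if "k1 \<in> KP" "h \<in>
      carrier Sp4" "k2 \<in> KP" for k1 h k2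
    using T that unfolding hecke_def by blast
  have lin: "Vector_Spaces.linear sc sc (T h)" if "h \<in> carrier Sp4" for h
    using T that unfolding hecke_def by blast
  have conv: "hecke_conv KP T T weyl z
      = (\<Sum>i\<in>residue_reps \<times> residue_reps. T (coset_rep i) (T (sp_inv (coset_rep i) **
          weyl) z))"
  proof (rule hecke_conv_reindex[where \<rho> = \<rho>])
    show "{h <#\<^bsub>Sp4\<^esub> KP | h. h \<in> supp T} = (\<lambda>i. coset_rep i
        <#\<^bsub>Sp4\<^esub> KP) ` (residue_reps \<times> residue_reps)"
      unfolding supp by (rule KWK_cosets)
    show "T (coset_rep i ** k) = T (coset_rep i) \<circ> \<rho> k" if "k \<in> KP" for i k
      using bi[OF KP_one coset_rep_Sp4 that, of i] by (simp add: rho_one)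
    show "T (sp_inv k ** (sp_inv (coset_rep i) ** weyl)) = \<rho> (sp_inv k) \<circ> T (sp_inv
        (coset_rep i) ** weyl)"
      if "k \<in> KP" for i k
      using bi[OF KP_sp_inv[OF that] _ KP_one, of "sp_inv (coset_rep i) ** weyl"] coset_rep_Sp4
      by (simp add: rho_one)
    show "\<rho> k \<circ> \<rho> (sp_inv k) = id" if "k \<in> KP" for k
      using rho_mult[OF that KP_sp_inv[OF that]] that by (simp add: KP_def sp_inv_right rho_one)
  qed (use KS inj_coset_rep KP_one coset_rep_Sp4 in auto)
  \<comment> \<open>The factors to the left of \<open>weyl\<close> in a coset representative are of
    type \<open>e23\<close> and \<open>e21\<close>, on which \<open>\<rho>\<close> is
    trivial.\<close>
  have residue_rep: "T (coset_rep (y, x)) = T weyl" if "y \<in> residue_reps" "x \<in> residue_reps" for y x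
  proof -
    have "T (e23 y ** e21 x ** weyl ** mat 1) = \<rho> (e23 y ** e21 x) \<circ> T weyl \<circ> \<rho>
        (mat 1)"
      using bi[OF e23_e21_KP[OF that] weyl_Sp4 KP_one] .
    then show ?thesis
      using rho_mult[OF e_KP(2) e_KP(1), of y x] residue_reps_vge that rho_e23 rho_e21
      by (simp add: coset_rep_def rho_one)
  qed
  have inv_rep: "sp_inv (coset_rep (y, x)) ** weyl = sp_inv weyl ** (e21 (- x) ** e23 (- y)) ** weyl"
      for y x
    by (simp add: coset_rep_def sp_inv_mult sp_inv_e matrix_mul_assoc)
  \<comment> \<open>The argument of the inner \<open>T\<close> has \<open>y\<close> as its (3,2)
    entry, so it leaves the support once \<open>y\<close> lies in the maximal ideal.\<close>
  have nonunit: "T (coset_rep (y, x)) (T (sp_inv (coset_rep (y, x)) ** weyl) z) = 0"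
    if "y \<in> residue_reps" "x \<in> residue_reps" "vge 1 y" for y x
  proof -
    have "(sp_inv (coset_rep (y, x)) ** weyl)$3$2 = y"
      unfolding inv_rep weyl_conj_entries by (simp add: e_defs matrix_matrix_mult_def sum_4 vector_4)
    then have "sp_inv (coset_rep (y, x)) ** weyl \<notin> supp T"
      unfolding supp KWK_def using KWK_entry that(3) by auto
    then have "T (sp_inv (coset_rep (y, x)) ** weyl) z = 0" unfolding supp_def by simp
    then show ?thesis using module_hom.zero[OF lin[OF coset_rep_Sp4, unfolded linear_iff_module_hom]]
        by simp
  qed
  have unit: "T (coset_rep (y, x)) (T (sp_inv (coset_rep (y, x)) ** weyl) z) = sc (\<Psi> (x ^ 2 / y))
      (T weyl (T weyl z))"
    if "y \<in> unit_reps" "x \<in> residue_reps" for y x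
  proof -
    note y = unit_reps_val[OF that(1)] and x = residue_reps_vge[OF that(2)]
    have q: "vge 0 (1 / y)" "vge 0 (x / y)" "vge 0 (x ^ 2 / y)" "vge 0 (- x / y)" "- 1 / y \<noteq> 0"
        "v (- 1 / y) = 0"
      using y x vge_0_divide[OF vge_one y(1,2)] vge_0_divide[OF x y(1,2)] vge_0_divide[OF _ y(1,2), of
          "x ^ 2"]
        vge_0_mult[OF x x] v_divide[of 1 y] by (simp_all add: power2_eq_square)
    \<comment> \<open>The two sides of \<open>weyl\<close> in \<open>weyl_relation\<close>:
      \<open>\<rho> k1\<close> is the scalar coming from \<open>e41\<close>, and
      \<open>\<rho> k2\<close> is the identity.\<close>
    define k1 where "k1 = e23 (1 / y) ** e21 (x / y) ** e41 (x ^ 2 / y) ** torus_elt 1 (- 1 / y)"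
    define k2 where "k2 = e21 (- x / y) ** e23 (1 / y)"
    have tK: "torus_elt 1 (- 1 / y) \<in> KP" using torus_K0[OF q(5,6)] K0_KP by blast
    have K: "e23 (1 / y) ** e21 (x / y) \<in> KP" "e23 (1 / y) ** e21 (x / y) ** e41 (x ^ 2 / y) \<in> KP"
      "k1 \<in> KP" "k2 \<in> KP"
      unfolding k1_def k2_def using q tK by (simp_all add: KP_mult e_KP)
    have "\<rho> k1 = sc (\<Psi> (x ^ 2 / y))"
      unfolding k1_def using q
      by (simp only: rho_mult K tK e_KP rho_e23 rho_e21 rho_e41 rho_torus[OF q(5,6)]) simp
    moreover have "\<rho> k2 = id"
      unfolding k2_def using q by (simp only: rho_mult e_KP rho_e23 rho_e21) simp
    moreover have "sp_inv (coset_rep (y, x)) ** weyl = k1 ** weyl ** k2"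
      unfolding inv_rep weyl_relation[OF y(3)] k1_def k2_def by (simp add: matrix_mul_assoc)
    ultimately have "T (sp_inv (coset_rep (y, x)) ** weyl) z = sc (\<Psi> (x ^ 2 / y)) (T weyl z)"
      using bi[OF K(3) weyl_Sp4 K(4)] by simp
    moreover have "y \<in> residue_reps" using that(1) by (simp add: unit_reps_def)
    ultimately show ?thesis
      using residue_rep[OF _ that(2), of y] module_hom.scale[OF lin[OF weyl_Sp4, unfolded
          linear_iff_module_hom]] by simp
  qed
  have "hecke_conv KP T T weyl z = (\<Sum>y\<in>residue_reps. \<Sum>x\<in>residue_reps. T (coset_rep
      (y, x)) (T (sp_inv (coset_rep (y, x)) ** weyl) z))"
    unfolding conv by (simp add: sum.cartesian_product case_prod_unfold)
  also have "\<dots> = (\<Sum>y\<in>unit_reps. \<Sum>x\<in>residue_reps. T (coset_rep (y, x)) (T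
      (sp_inv (coset_rep (y, x)) ** weyl) z))"
    using nonunit by (intro sum.mono_neutral_right finite_residue_reps) (auto simp: unit_reps_def)
  also have "\<dots> = (\<Sum>y\<in>unit_reps. \<Sum>x\<in>residue_reps. sc (\<Psi> (x ^ 2 / y)) (T
      weyl (T weyl z)))"
    by (intro sum.cong refl unit)
  also have "\<dots> = sc (\<Sum>y\<in>unit_reps. \<Sum>x\<in>residue_reps. \<Psi> (x ^ 2 / y)) (T weyl
      (T weyl z))"
    by (simp add: module.scale_sum_left[OF sc_module])
  also have "\<dots> = 0"
    unfolding psi_double_sum by (rule module.scale_zero_left[OF sc_module])
  finally show ?thesis .
qed

lemma KP_D_KP: "KP <#>\<^bsub>Sp4\<^esub> (KM - K0 v \<pi>) <#>\<^bsub>Sp4\<^esub> KP = KWK"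
proof (intro equalityI subsetI)
  fix g assume "g \<in> KP <#>\<^bsub>Sp4\<^esub> (KM - K0 v \<pi>) <#>\<^bsub>Sp4\<^esub> KP"
  then obtain k h k' where g: "k \<in> KP" "k' \<in> KP" "h \<in> KM" "h \<notin> K0 v \<pi>" "g = k **
      h ** k'"
    unfolding set_mult_def by auto
  obtain y where y: "y \<in> residue_reps" "sp_inv (e23 y ** weyl) ** h \<in> K0 v \<pi>" using
      K0_cover[OF g(3,4)] .
  let ?k = "sp_inv (e23 y ** weyl) ** h"
  have "e23 y ** weyl ** ?k = h"
    by (rule sp_inv_cancel(2)) simp
  then have "k ** (e23 y ** weyl ** ?k) ** k' = g" using g(5) by (simp only:)
  then have "g = (k ** e23 y) ** weyl ** (?k ** k')" by (simp add: matrix_mul_assoc)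
  moreover have "k ** e23 y \<in> KP" "?k ** k' \<in> KP"
    using KP_mult g e_KP(2)[OF residue_reps_vge[OF y(1)]] y(2) K0_KP by blast+
  ultimately show "g \<in> KWK" unfolding KWK_def by blast
next
  fix g assume "g \<in> KWK"
  moreover have "weyl \<in> KM - K0 v \<pi>"
    using KM_weyl unfolding K0_eq by (simp add: weyl_def vector_4 not_vge_1_one)
  ultimately show "g \<in> KP <#>\<^bsub>Sp4\<^esub> (KM - K0 v \<pi>) <#>\<^bsub>Sp4\<^esub> KP"
    unfolding KWK_def set_mult_def by auto
qed

lemma no_support_preserving_iso:
  assumes I: "hecke_algebra_iso v (G0 \<pi>) (K0 v \<pi>) (*) trivial_rep (carrier Sp4) (K_gp v \<pi>
      \<epsilon> s w) sc \<rho> I"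
    and sp: "support_preserving (hecke v (G0 \<pi>) (K0 v \<pi>) (*) trivial_rep) (K_gp v \<pi>
        \<epsilon> s w) I"
  shows False
proof -
  let ?A = "hecke v (G0 \<pi>) (K0 v \<pi>) ((*) :: 'c \<Rightarrow> 'c \<Rightarrow> 'c) trivial_rep"
  let ?D = "D_ind :: 'f mat4 \<Rightarrow> 'c \<Rightarrow> 'c"
  have bij: "bij_betw I ?A (hecke v (carrier Sp4) KP sc \<rho>)"
    and mult: "I (hecke_conv (K0 v \<pi>) ?D ?D) = hecke_conv KP (I ?D) (I ?D)"
    using I D_ind_in_hecke[where 'a = 'c] unfolding hecke_algebra_iso_def Let_def K_gp_eq by blast+
  have supp: "supp (I f) = KP <#>\<^bsub>Sp4\<^esub> supp f <#>\<^bsub>Sp4\<^esub> KP" if "f \<in> ?A" for f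
    using sp that unfolding support_preserving_def K_gp_eq by blast
  have "I ?D \<in> hecke v (carrier Sp4) KP sc \<rho>"
    using bij D_ind_in_hecke[where 'a = 'c] by (rule bij_betwE[THEN bspec])
  moreover have "supp (I ?D) = KWK"
    unfolding supp[OF D_ind_in_hecke] supp_D_ind by (rule KP_D_KP)
  ultimately have "hecke_conv KP (I ?D) (I ?D) weyl = (\<lambda>_. 0)"
    using weyl_square_vanishes by blast
  then have "weyl \<notin> supp (I (hecke_conv (K0 v \<pi>) ?D ?D))"
    unfolding mult supp_def by simp
  \<comment> \<open>The square of \<open>D_ind\<close> has all of \<open>KM\<close> as support, so
    support preservation places \<open>weyl\<close> in the support of its image, which contradicts
    the vanishing there.\<close>
  moreover have "mat 1 ** weyl ** mat 1 \<in> KP <#>\<^bsub>Sp4\<^esub> KM <#>\<^bsub>Sp4\<^esub> KP"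
    unfolding set_mult_def Sp4_simps using KP_one KM_weyl by blast
  ultimately show False
    unfolding supp[OF D_conv_in_hecke] supp_D_conv by simp
qed

end

theorem propositionA2p4:
  fixes v :: "'f::field \<Rightarrow> real" and \<pi> :: 'f and p :: nat
    and \<Psi> :: "'f \<Rightarrow> 'c::{alg_closed_field, field_char_0}"
    and \<iota> :: "'c \<Rightarrow> 'k::{finite, field}"
    and \<epsilon> :: "'f \<Rightarrow> 'e::field" and s :: 'e and w :: "'e \<Rightarrow> real"
    and \<phi> :: "'f mat4 \<Rightarrow> 'c"
    and sc :: "'c \<Rightarrow> 'w::ab_group_add \<Rightarrow> 'w" and \<rho> :: "'f mat4 \<Rightarrow> 'w \<Rightarrow> 'w"
  assumes "nonarch_local_field v" and "residue_char v p" and "p \<noteq> 2" and "uniformizer v \<pi>"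
    and "level_zero_additive_char v \<Psi>"
    and "CARD('k) = p" and "root_of_unity_iso p \<iota>"
    and "sqrt_extension v \<pi> \<epsilon> s w"
    and "is_phi v \<pi> \<epsilon> s w \<Psi> \<phi>"
    and "nontwisted_kim_yu_rep v \<pi> p \<epsilon> s w \<iota> \<phi> sc \<rho>"
  shows "\<not> (\<exists>I. hecke_algebra_iso v (G0 \<pi>) (K0 v \<pi>) (*) trivial_rep
                   (carrier Sp4) (K_gp v \<pi> \<epsilon> s w) sc \<rho> I \<and>
                 support_preserving (hecke v (G0 \<pi>) (K0 v \<pi>) (*) trivial_rep) (K_gp v \<pi> \<epsilon> s w) I)"
proof -
  interpret kim_yu_datum v \<pi> p \<epsilon> s w \<Psi> \<iota> \<phi> sc \<rho>
    using assms by unfold_locales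
  show ?thesis using no_support_preserving_iso by blast
qed

end
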